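(* Let $m,m'$ be nonnegative integers, let $s\in\mathbb{R}$, set $\mu:=m+m'$ and $\nu:=m-m'$, and let $$\mathcal{J}_{s,m,m'}(r):=\sum_{l=1}^\infty l^{-2s}J_{l+m}(r)\,J_{l+m'}(r),\qquad r>0.$$ Then, as $r\to\infty$: - if $s<\frac12$, $\ \mathcal{J}_{s,m,m'}(r)=c^1_{s,\nu}\,r^{-2s}+o(r^{-2s})$; - if $s=\frac12$ and $\nu$ is even, $\ \mathcal{J}_{s,m,m'}(r)=c^2_{\nu}\,\dfrac{\log r}{r}+O(r^{-1})$; - if $s=\frac12$ and $\nu$ is odd, $\ \mathcal{J}_{s,m,m'}(r)=\dfrac{c^3_{\nu}-c^4\sin(2r-c^7_{\mu})}{r}+o(r^{-1})$; - if $s>\frac12$, $\ \mathcal{J}_{s,m,m'}(r)=\dfrac{c^5_{s,\nu}-c^6_{s}\sin(2r-c^7_{\mu})}{r}+o(r^{-1})$; where $$c^1_{s,\nu}=\frac{2^{2s-1}\,\Gamma(1-2s)}{\Gamma(1-s-\frac\nu2)\,\Gamma(1-s+\frac\nu2)},\quad c^2_\nu=\frac1\pi\cos\frac{\pi\nu}2,\quad c^3_\nu=\frac12\sin\frac{\pi|\nu|}2,\quad c^4=\frac{\log2}\pi,$$ $$c^5_{s,\nu}=\frac{\zeta(2s)}\pi\cos\frac{\pi\nu}2,\quad c^6_s=\frac{\zeta(2s)(1-2^{1-2s})}{\pi},\quad c^7_\mu=\frac{\pi\mu}2.$$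
   Context: $J_n$ denotes the Bessel function of the first kind of integer order $n$, $\Gamma$ is the Gamma function (with the convention $1/\Gamma(z)=0$ when $z$ is a nonpositive integer) and $\zeta$ is the Riemann zeta function. The implied constants and rates in $o(\cdot)$, $O(\cdot)$ may depend on $s,m,m'$. *)

theory Defs
  imports "HOL-Analysis.Analysis" "HOL-Library.Landau_Symbols"
begin

text \<open>
  The Bessel function of the first kind, by its power series. Only orders \<open>n \<ge> 0\<close> are needed,
  so the order is a natural number and \<open>\<Gamma>(k + n + 1)\<close> is \<open>(k + n)!\<close>.
\<close>

definition bessel_J :: "nat \<Rightarrow> real \<Rightarrow> real" where
  "bessel_J n x = (\<Sum>k. (-1) ^ k / (fact k * fact (k + n)) * (x / 2) ^ (2 * k + n))"

text \<open>
  The Riemann zeta function on the half-line \<open>x > 1\<close>, where it is its Dirichlet series.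
  Not meaningful for \<open>x \<le> 1\<close>.
\<close>

definition zeta_real :: "real \<Rightarrow> real" where
  "zeta_real x = (\<Sum>n. real (Suc n) powr (- x))"

text \<open>The index is shifted: the summand with index \<open>l\<close> is the one of index \<open>l + 1\<close> in
  \<open>\<Sum>\<^sub>l\<^sub>\<ge>\<^sub>1 l\<^sup>-\<^sup>2\<^sup>s J\<^sub>l\<^sub>+\<^sub>m(r) J\<^sub>l\<^sub>+\<^sub>m\<^sub>'(r)\<close>.\<close>

definition bessel_sum :: "real \<Rightarrow> nat \<Rightarrow> nat \<Rightarrow> real \<Rightarrow> real" where
  "bessel_sum s m m' r =
     (\<Sum>l. real (Suc l) powr (- 2 * s) * bessel_J (Suc l + m) r * bessel_J (Suc l + m') r)"

text \<open>\<^const>\<open>rGamma\<close> is the entire function \<open>1/\<Gamma>\<close>, which vanishes at the nonpositive integers.\<close>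

definition c1 :: "real \<Rightarrow> int \<Rightarrow> real" where
  "c1 s \<nu> = 2 powr (2 * s - 1) * Gamma (1 - 2 * s) *
             rGamma (1 - s - of_int \<nu> / 2) * rGamma (1 - s + of_int \<nu> / 2)"

definition c2 :: "int \<Rightarrow> real" where
  "c2 \<nu> = 1 / pi * cos (pi * of_int \<nu> / 2)"

definition c3 :: "int \<Rightarrow> real" where
  "c3 \<nu> = 1 / 2 * sin (pi * of_int \<bar>\<nu>\<bar> / 2)"

definition c4 :: real where
  "c4 = ln 2 / pi"

definition c5 :: "real \<Rightarrow> int \<Rightarrow> real" where
  "c5 s \<nu> = zeta_real (2 * s) / pi * cos (pi * of_int \<nu> / 2)"

definition c6 :: "real \<Rightarrow> real" where
  "c6 s = zeta_real (2 * s) * (1 - 2 powr (1 - 2 * s)) / pi"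

definition c7 :: "nat \<Rightarrow> real" where
  "c7 \<mu> = pi * real \<mu> / 2"

text \<open>The series above converge, so none of the infinite sums is a junk value.\<close>

lemma zeta_real_summable:
  assumes "x > 1"
  shows "summable (\<lambda>n. real (Suc n) powr (- x))"
  using assms by (subst summable_Suc_iff) (simp add: summable_real_powr_iff)

lemma bessel_J_term_bound:
  "\<bar>(-1) ^ k / (fact k * fact (k + n)) * (x / 2) ^ (2 * k + n)\<bar>
     \<le> \<bar>x / 2\<bar> ^ n / fact n * ((x\<^sup>2 / 4) ^ k / fact k :: real)"
proof -
  have p: "\<bar>x / 2\<bar> ^ (2 * k + n) = \<bar>x / 2\<bar> ^ n * (x\<^sup>2 / 4) ^ k"
  proof -
    have "x\<^sup>2 / 4 = \<bar>x / 2\<bar>\<^sup>2" by (simp add: power_divide)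
    then show ?thesis by (metis power_add power_mult mult.commute)
  qed
  have "\<bar>(-1) ^ k / (fact k * fact (k + n)) * (x / 2) ^ (2 * k + n)\<bar>
     = \<bar>x / 2\<bar> ^ n * (x\<^sup>2 / 4) ^ k / fact k / fact (k + n)"
    unfolding p[symmetric] by (simp add: abs_mult power_abs)
  also have "\<dots> \<le> \<bar>x / 2\<bar> ^ n * (x\<^sup>2 / 4) ^ k / fact k / fact n"
    by (intro divide_left_mono fact_mono) auto
  finally show ?thesis
    by (simp add: field_simps)
qed

lemma bessel_J_summable:
  "summable (\<lambda>k. (-1) ^ k / (fact k * fact (k + n)) * (x / 2) ^ (2 * k + n) :: real)"
proof (rule summable_comparison_test')
  show "summable (\<lambda>k. \<bar>x / 2\<bar> ^ n / fact n * ((x\<^sup>2 / 4) ^ k / fact k))"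
    using summable_exp[of "x\<^sup>2 / 4"] by (intro summable_mult) (simp add: field_simps)
qed (use bessel_J_term_bound in \<open>simp only: real_norm_def\<close>)

lemma bessel_J_bound: "\<bar>bessel_J n x\<bar> \<le> \<bar>x / 2\<bar> ^ n / fact n * exp (x\<^sup>2 / 4)"
proof -
  have s: "(\<lambda>k. \<bar>x / 2\<bar> ^ n / fact n * ((x\<^sup>2 / 4) ^ k / fact k))
             sums (\<bar>x / 2\<bar> ^ n / fact n * exp (x\<^sup>2 / 4))"
    using exp_converges[of "x\<^sup>2 / 4"] by (intro sums_mult) (simp add: field_simps)
  show ?thesis
    unfolding bessel_J_def sums_unique[OF s]
    using norm_suminf_le[OF _ sums_summable[OF s]] bessel_J_term_bound
    by (metis (no_types, lifting) real_norm_def)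
qed

lemma bessel_sum_summable:
  "summable (\<lambda>l. real (Suc l) powr (- 2 * s) * bessel_J (Suc l + m) r * bessel_J (Suc l + m') r)"
proof (rule summable_comparison_test')
  define C where "C = \<bar>r / 2\<bar> ^ (2 + m + m') * (exp (r\<^sup>2 / 4))\<^sup>2"
  define q where "q = exp \<bar>2 * s\<bar> * \<bar>r / 2\<bar>\<^sup>2"
  show "summable (\<lambda>l. C * (q ^ l / fact l))"
    using summable_exp[of q] by (intro summable_mult) (simp add: field_simps)
  fix l :: nat
  have "ln (real (Suc l)) \<le> real l"
    using ln_le_minus_one[of "real (Suc l)"] by simp
  then have "- 2 * s * ln (real (Suc l)) \<le> \<bar>2 * s\<bar> * real l"
    by (intro mult_mono) auto
  then have a: "real (Suc l) powr (- 2 * s) \<le> exp \<bar>2 * s\<bar> ^ l"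
    by (simp add: powr_def exp_of_nat_mult[symmetric] mult.commute)
  have f: "(1::real) / fact (Suc l + m) / fact (Suc l + m') \<le> 1 / fact l / 1"
  proof -
    have "(1::real) \<le> fact (Suc l + m')" by (rule fact_ge_1)
    moreover have "(fact l :: real) \<le> fact (Suc l + m)" by (rule fact_mono) simp
    ultimately show ?thesis by (intro frac_le) auto
  qed
  have "\<bar>bessel_J (Suc l + m) r\<bar> * \<bar>bessel_J (Suc l + m') r\<bar>
     \<le> (\<bar>r / 2\<bar> ^ (Suc l + m) / fact (Suc l + m) * exp (r\<^sup>2 / 4)) *
       (\<bar>r / 2\<bar> ^ (Suc l + m') / fact (Suc l + m') * exp (r\<^sup>2 / 4))"
    by (intro mult_mono bessel_J_bound) auto
  also have "\<dots> = C * (\<bar>r / 2\<bar>\<^sup>2) ^ l * (1 / fact (Suc l + m) / fact (Suc l + m'))"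
  proof -
    have alg: "(x ^ (Suc l + m) / u * e) * (x ^ (Suc l + m') / v * e)
        = x ^ (2 + m + m') * e\<^sup>2 * (x\<^sup>2) ^ l * (1 / u / v)" for x u v e :: real
      by (simp add: power_add power2_eq_square power_mult_distrib)
    show ?thesis unfolding C_def by (rule alg)
  qed
  also have "\<dots> \<le> C * (\<bar>r / 2\<bar>\<^sup>2) ^ l * (1 / fact l / 1)"
    by (intro mult_left_mono f) (auto simp: C_def)
  finally have b: "\<bar>bessel_J (Suc l + m) r\<bar> * \<bar>bessel_J (Suc l + m') r\<bar>
     \<le> C * (\<bar>r / 2\<bar>\<^sup>2) ^ l / fact l"
    by simp
  have "real (Suc l) powr (- 2 * s) * (\<bar>bessel_J (Suc l + m) r\<bar> * \<bar>bessel_J (Suc l + m') r\<bar>)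
     \<le> exp \<bar>2 * s\<bar> ^ l * (C * (\<bar>r / 2\<bar>\<^sup>2) ^ l / fact l)"
    by (intro mult_mono a b) auto
  then show "norm (real (Suc l) powr (- 2 * s) * bessel_J (Suc l + m) r * bessel_J (Suc l + m') r)
     \<le> C * (q ^ l / fact l)"
    by (simp add: abs_mult q_def power_mult_distrib mult_ac del: of_nat_Suc)
qed

end

theory Submission
  imports Defs
begin

text \<open>
  Two scales compete in \<open>\<Sum> l powr (- 2 s) * J (l + m) r * J (l + m') r\<close>. At bounded \<open>l\<close> the product behaves
  like \<open>1 / r\<close> times an explicit oscillation. At \<open>l\<close> of order \<open>r\<close> the squares \<open>(J l r)\<^sup>2\<close>, placed at
  the points \<open>l / r\<close>, form a measure that converges to the arcsine law on \<open>[- 1, 1]\<close>. The weight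
  \<open>l powr (- 2 s)\<close> selects the second scale for \<open>s < 1/2\<close>, where \<open>c1\<close> is a fractional moment of the
  arcsine law twisted by the order difference, and the first one for \<open>s > 1/2\<close>. At \<open>s = 1/2\<close>
  all intermediate scales contribute equally, and they produce the logarithm unless the mean of the product
  vanishes, which happens for odd order difference.

  Uniformity in the order comes from three consequences of the recurrence \<open>r (J (l-1) + J (l+1)) = 2 l J l\<close>.

  First, the recurrence turns multiplication by \<open>l / r\<close> into a step of the simple random walk on the order
  shift (\<open>J_moment_Suc\<close>). With the orthonormality of shifts (\<open>J_moment_0\<close>) all moments of the
  measure converge to those of the arcsine law (\<open>J_mass_tendsto\<close>). A weighted form of the Weierstrass
  theorem passes from polynomials to the power \<open>x powr (- 2 s)\<close> and gives the case \<open>m = m' = 0\<close>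
  (\<open>bessel_sum_diag_base\<close>).

  Second, seen as a slowly varying rotation in the variable \<open>l\<close>, the recurrence has an almost conserved energy.
  This gives \<open>(J l r)\<^sup>2 = O(1 / r)\<close> uniformly for \<open>l \<le> r / 2\<close> (\<open>J_sq_bound\<close>). Together with
  the moment bounds beyond \<open>r / 4\<close> it dominates all sums. For \<open>s > 1/2\<close> dominated convergence then reduces
  everything to fixed orders (\<open>bessel_weighted_sum_asymp\<close>), that is, by the recurrence, to \<open>J 0\<close> and \<open>J 1\<close>,
  where the square of a single Fresnel integral gives amplitude and phase at once (\<open>J_01_asymp\<close>).

  Third, the recurrence in the second factor relates the sums for \<open>m'\<close>, \<open>m' + 1\<close> and \<open>m' + 2\<close>, with the exponent
  \<open>s - 1/2\<close> in the middle (\<open>bessel_sum_recurrence\<close>), while a simultaneous shift of both orders changes the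
  sum by a lower order term (\<open>bessel_sum_shift_bigo\<close>). For \<open>s \<le> 1/2\<close> this reduces all pairs of orders to
  equal or neighbouring ones.

  For \<open>s = 1/2\<close> and equal orders the logarithm comes from a harmonic sum whose coefficient is the nearly constant
  energy (\<open>J_energy_sum_near\<close>). For neighbouring orders, adding and subtracting the sums for \<open>m\<close> and
  \<open>m + 1\<close> isolates the constant, which is half the total mass, and an absolutely convergent series, which gives the
  oscillation (\<open>bessel_sum_half_odd_consecutive\<close>).
\<close>

section \<open>Power series and recurrences\<close>

abbreviation J :: "nat \<Rightarrow> real \<Rightarrow> real" where
  "J \<equiv> bessel_J"

abbreviation weight :: "real \<Rightarrow> nat \<Rightarrow> real" where
  "weight s n \<equiv> real (Suc n) powr (- 2 * s)"

text \<open>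
  \<open>J n x / (x/2)^n\<close> as a power series in \<open>(x/2)\<^sup>2\<close>. Dividing out the leading power turns the
  recurrence and the derivative formula of \<open>J\<close> into identities between coefficients.
\<close>

definition J_cofactor :: "nat \<Rightarrow> real \<Rightarrow> real" where
  "J_cofactor n y = (\<Sum>k. (-1) ^ k / (fact k * fact (k + n)) * y ^ k)"

lemma summable_J_cofactor:
  "summable (\<lambda>k. (-1) ^ k / (fact k * fact (k + n)) * y ^ k :: real)"
proof (rule summable_comparison_test')
  show "summable (\<lambda>k. \<bar>y\<bar> ^ k / fact k)"
    using summable_exp[of "\<bar>y\<bar>"] by (simp add: field_simps)
next
  fix k :: nat
  have "\<bar>y\<bar> ^ k / (fact k * fact (k + n)) \<le> \<bar>y\<bar> ^ k / (fact k * 1)"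
    by (intro divide_left_mono mult_left_mono fact_ge_1) auto
  then show "norm ((-1) ^ k / (fact k * fact (k + n)) * y ^ k) \<le> \<bar>y\<bar> ^ k / fact k"
    by (simp add: abs_mult power_abs)
qed

lemma J_eq_cofactor: "J n x = (x / 2) ^ n * J_cofactor n ((x / 2)\<^sup>2)"
proof -
  have p: "(x / 2) ^ (2 * k + n) = (x / 2) ^ n * ((x / 2)\<^sup>2) ^ k" for k
    by (simp only: power_add power_mult) (simp only: mult.commute)
  show ?thesis
    unfolding bessel_J_def J_cofactor_def p
    by (subst suminf_mult[symmetric, OF summable_J_cofactor]) (simp only: mult_ac)
qed

lemma J_cofactor_recurrence:
  "J_cofactor n y + y * J_cofactor (n + 2) y = real (n + 1) * J_cofactor (n + 1) y"
proof -
  let ?c = "\<lambda>n k. (-1) ^ k / (fact k * fact (k + n)) * y ^ k :: real"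
  have e: "?c n (Suc k) + y * ?c (n + 2) k = real (n + 1) * ?c (n + 1) (Suc k)" for k
  proof -
    have f: "(fact (Suc k + (n + 1)) :: real) = real (k + n + 2) * fact (Suc k + n)"
            "(fact (k + (n + 2)) :: real) = real (k + n + 2) * fact (Suc k + n)"
      by (simp_all add: algebra_simps)
    show ?thesis unfolding f fact_Suc[of k]
      by (simp add: divide_simps del: fact_Suc) (simp add: algebra_simps)
  qed
  have s1: "summable (\<lambda>k. ?c m (Suc k))" for m
    using summable_J_cofactor[of m y] by (subst summable_Suc_iff)
  have "J_cofactor n y + y * J_cofactor (n + 2) y
      = ?c n 0 + (\<Sum>k. ?c n (Suc k)) + (\<Sum>k. y * ?c (n + 2) k)"
    unfolding J_cofactor_def
    by (simp only: suminf_split_head[OF summable_J_cofactor]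
          suminf_mult[OF summable_J_cofactor])
  also have "\<dots> = ?c n 0 + (\<Sum>k. ?c n (Suc k) + y * ?c (n + 2) k)"
    using suminf_add[OF s1[of n] summable_mult[OF summable_J_cofactor[of "n + 2" y]], of y]
    by linarith
  also have "\<dots> = real (n + 1) * ?c (n + 1) 0 + real (n + 1) * (\<Sum>k. ?c (n + 1) (Suc k))"
  proof -
    have "(fact (0 + (n + 1)) :: real) = real (n + 1) * fact (0 + n)" by simp
    then have "?c n 0 = real (n + 1) * ?c (n + 1) 0" by (simp del: of_nat_Suc of_nat_add)
    then show ?thesis unfolding e suminf_mult[OF s1] by linarith
  qed
  also have "\<dots> = real (n + 1) * J_cofactor (n + 1) y"
    unfolding J_cofactor_def suminf_split_head[OF summable_J_cofactor] right_diff_distrib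
    by (simp only: add_diff_cancel_left' add_diff_eq)
  finally show ?thesis .
qed

lemma has_field_derivative_J_cofactor:
  "(J_cofactor n has_field_derivative - J_cofactor (n + 1) y) (at y)"
proof -
  have d: "diffs (\<lambda>k. (-1) ^ k / (fact k * fact (k + n)) :: real)
      = (\<lambda>k. - ((-1) ^ k / (fact k * fact (k + (n + 1)))))"
  proof
    fix k :: nat
    have f: "(fact (Suc k + n) :: real) = fact (k + (n + 1))" by simp
    show "diffs (\<lambda>k. (-1) ^ k / (fact k * fact (k + n)) :: real) k
      = - ((-1) ^ k / (fact k * fact (k + (n + 1))))"
      unfolding diffs_def f fact_Suc[of k] by (simp del: fact_Suc)
  qed
  have "((\<lambda>y. \<Sum>k. (-1) ^ k / (fact k * fact (k + n)) * y ^ k) has_field_derivative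
      (\<Sum>k. diffs (\<lambda>k. (-1) ^ k / (fact k * fact (k + n)) :: real) k * y ^ k)) (at y)"
    by (rule termdiffs_strong_converges_everywhere) (rule summable_J_cofactor)
  also have "(\<Sum>k. diffs (\<lambda>k. (-1) ^ k / (fact k * fact (k + n)) :: real) k * y ^ k)
      = - J_cofactor (n + 1) y"
    unfolding d J_cofactor_def
    by (subst suminf_minus[symmetric, OF summable_J_cofactor]) simp
  finally show ?thesis
    by (simp add: J_cofactor_def[abs_def])
qed

lemma J_recurrence:
  "r * (J n r + J (n + 2) r) = 2 * real (n + 1) * J (n + 1) r"
proof -
  have "r * (J n r + J (n + 2) r)
      = 2 * (r / 2) ^ (n + 1) * (J_cofactor n ((r / 2)\<^sup>2)
          + (r / 2)\<^sup>2 * J_cofactor (n + 2) ((r / 2)\<^sup>2))"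
    by (simp add: J_eq_cofactor algebra_simps power2_eq_square)
  then show ?thesis
    unfolding J_cofactor_recurrence J_eq_cofactor[of "n + 1"]
    by (simp only: mult_ac)
qed

lemma J_0_deriv: "(J 0 has_field_derivative - J 1 r) (at r)"
proof -
  have "((\<lambda>x. J_cofactor 0 ((x / 2)\<^sup>2)) has_field_derivative
      - J_cofactor (0 + 1) ((r / 2)\<^sup>2) * (r / 2)) (at r)"
    by (rule DERIV_chain2[where f = "J_cofactor 0", OF has_field_derivative_J_cofactor])
       (auto intro!: derivative_eq_intros)
  then show ?thesis
    by (simp add: J_eq_cofactor[abs_def] mult.commute)
qed

lemma J_Suc_deriv:
  "(J (Suc n) has_field_derivative (J n r - J (n + 2) r) / 2) (at r)"
proof -
  let ?y = "(r / 2)\<^sup>2"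
  have c: "((\<lambda>x. J_cofactor (Suc n) ((x / 2)\<^sup>2)) has_field_derivative
      - J_cofactor (Suc n + 1) ?y * (r / 2)) (at r)"
    by (rule DERIV_chain2[where f = "J_cofactor (Suc n)", OF has_field_derivative_J_cofactor])
       (auto intro!: derivative_eq_intros)
  have "((\<lambda>x. (x / 2) ^ Suc n * J_cofactor (Suc n) ((x / 2)\<^sup>2)) has_field_derivative
      (real (Suc n) * (r / 2) ^ n / 2) * J_cofactor (Suc n) ?y
        + (- J_cofactor (Suc n + 1) ?y * (r / 2)) * (r / 2) ^ Suc n) (at r)"
    by (rule DERIV_mult[OF DERIV_cong[OF DERIV_power_Suc] c]) (auto intro!: derivative_eq_intros)
  also have "(real (Suc n) * (r / 2) ^ n / 2) * J_cofactor (Suc n) ?y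
      = (r / 2) ^ n / 2 * (J_cofactor n ?y + ?y * J_cofactor (n + 2) ?y)"
    using J_cofactor_recurrence[of n ?y] by simp
  also have "\<dots> + (- J_cofactor (Suc n + 1) ?y * (r / 2)) * (r / 2) ^ Suc n
      = (J n r - J (n + 2) r) / 2"
    by (simp add: J_eq_cofactor field_simps power2_eq_square)
  finally show ?thesis
    by (simp add: J_eq_cofactor[abs_def])
qed

text \<open>
  The point is the geometric decay in the order: it makes every sum over the order converge
  absolutely, with arbitrary polynomial weights.
\<close>

lemma J_geometric_bound: "\<bar>J n r\<bar> \<le> exp (\<bar>r\<bar> + r\<^sup>2 / 4) * (1 / 2) ^ n"
proof -
  have "\<bar>r\<bar> ^ n / fact n \<le> exp \<bar>r\<bar>"
    using sum_le_suminf[OF summable_exp[of "\<bar>r\<bar>"], of "{n}"] by (simp add: exp_def field_simps)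
  then have "\<bar>r / 2\<bar> ^ n / fact n \<le> exp \<bar>r\<bar> * (1 / 2) ^ n"
    by (simp add: power_divide field_simps)
  then have "\<bar>r / 2\<bar> ^ n / fact n * exp (r\<^sup>2 / 4) \<le> (exp \<bar>r\<bar> * (1 / 2) ^ n) * exp (r\<^sup>2 / 4)"
    by (rule mult_right_mono) simp
  with bessel_J_bound[of n r] show ?thesis
    by (simp add: exp_add mult_ac)
qed

section \<open>The Fresnel integral\<close>

text \<open>
  The Fresnel integral and the function that completes its square: the derivatives of
  \<open>(fresnel x)\<^sup>2\<close> and of \<open>- \<i> * fresnel_aux x\<close> agree, as both equal \<open>2x\<close> times the integral of
  \<open>cis (x\<^sup>2 (1 + t\<^sup>2))\<close> over \<open>t\<close> in \<open>[0,1]\<close>. This is the trigonometric form of the familiar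
  evaluation of the Gaussian integral.
\<close>

definition fresnel :: "real \<Rightarrow> complex" where
  "fresnel x = integral {0..x} (\<lambda>u. cis (u\<^sup>2))"

definition fresnel_aux :: "real \<Rightarrow> complex" where
  "fresnel_aux x = integral {0..1} (\<lambda>t. cis (x\<^sup>2 * (1 + t\<^sup>2)) / of_real (1 + t\<^sup>2))"

lemma continuous_on_cis_compose [continuous_intros]:
  "continuous_on A f \<Longrightarrow> continuous_on A (\<lambda>x. cis (f x))"
  by (intro continuous_on_compose2[OF continuous_on_cis]) auto

lemma has_vector_derivative_cis:
  assumes "(f has_real_derivative d) (at x within A)"
  shows "((\<lambda>x. cis (f x)) has_vector_derivative (of_real d * \<i> * cis (f x))) (at x within A)"
proof -
  have "((\<lambda>x. cis (f x)) has_derivative (\<lambda>h. (d * h) *\<^sub>R (\<i> * cis (f x)))) (at x within A)"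
    by (rule has_derivative_eq_rhs, rule has_derivative_cis[OF assms[unfolded has_field_derivative_def]])
      (simp add: mult_ac)
  then show ?thesis
    by (simp add: has_vector_derivative_def scaleR_conv_of_real mult_ac)
qed

lemma fresnel_rescale:
  assumes "x \<ge> 0"
  shows "fresnel x = of_real x * integral {0..1} (\<lambda>t. cis (x\<^sup>2 * t\<^sup>2))"
proof -
  have "((\<lambda>t. x *\<^sub>R cis ((x * t)\<^sup>2)) has_integral (integral {x * 0..x * 1} (\<lambda>u. cis (u\<^sup>2)))) {0..1}"
    by (rule has_integral_substitution[where c = 0 and d = x])
       (use assms in \<open>auto intro!: continuous_intros derivative_eq_intros mult_left_le\<close>)
  then have "((\<lambda>t. of_real x * cis (x\<^sup>2 * t\<^sup>2)) has_integral fresnel x) {0..1}"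
    by (simp add: fresnel_def scaleR_conv_of_real power_mult_distrib)
  from integral_unique[OF this] show ?thesis
    unfolding integral_mult_right by simp
qed

lemma has_vector_derivative_fresnel:
  assumes "x \<in> {0..X}"
  shows "(fresnel has_vector_derivative cis (x\<^sup>2)) (at x within {0..X})"
  unfolding fresnel_def[abs_def]
  by (rule integral_has_vector_derivative) (use assms in \<open>auto intro!: continuous_intros\<close>)

lemma has_vector_derivative_fresnel_aux:
  assumes "x \<in> {0..X}"
  shows "(fresnel_aux has_vector_derivative
            \<i> * of_real (2 * x) * integral {0..1} (\<lambda>t. cis (x\<^sup>2 * (1 + t\<^sup>2)))) (at x within {0..X})"
proof -
  have nz: "complex_of_real (1 + t\<^sup>2) \<noteq> 0" for t
    using add_pos_nonneg[of 1 "t\<^sup>2"] by (simp only: of_real_eq_0_iff) simp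
  have "((\<lambda>x. integral (cbox 0 1) (\<lambda>t. cis (x\<^sup>2 * (1 + t\<^sup>2)) / of_real (1 + t\<^sup>2)))
      has_vector_derivative
      integral (cbox 0 1) (\<lambda>t. \<i> * of_real (2 * x) * cis (x\<^sup>2 * (1 + t\<^sup>2)))) (at x within {0..X})"
  proof (rule leibniz_rule_vector_derivative[where fx = "\<lambda>x t. \<i> * of_real (2 * x) * cis (x\<^sup>2 * (1 + t\<^sup>2))"])
    fix y t :: real
    have "((\<lambda>y. cis (y\<^sup>2 * (1 + t\<^sup>2))) has_vector_derivative
        (of_real (2 * y * (1 + t\<^sup>2)) * \<i> * cis (y\<^sup>2 * (1 + t\<^sup>2)))) (at y within {0..X})"
      by (rule has_vector_derivative_cis) (auto intro!: derivative_eq_intros)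
    from has_vector_derivative_divide[OF this, of "of_real (1 + t\<^sup>2)"]
    have "((\<lambda>y. cis (y\<^sup>2 * (1 + t\<^sup>2)) / of_real (1 + t\<^sup>2)) has_vector_derivative
        \<i> * of_real (2 * y) * cis (y\<^sup>2 * (1 + t\<^sup>2)) * (of_real (1 + t\<^sup>2) / of_real (1 + t\<^sup>2)))
        (at y within {0..X})"
      by (simp only: of_real_mult mult_ac times_divide_eq_left times_divide_eq_right)
    then show "((\<lambda>y. cis (y\<^sup>2 * (1 + t\<^sup>2)) / of_real (1 + t\<^sup>2)) has_vector_derivative
        \<i> * of_real (2 * y) * cis (y\<^sup>2 * (1 + t\<^sup>2))) (at y within {0..X})"
      unfolding divide_self[OF nz] mult_1_right .
  next
    fix y :: real
    show "(\<lambda>t. cis (y\<^sup>2 * (1 + t\<^sup>2)) / of_real (1 + t\<^sup>2)) integrable_on cbox 0 1"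
      using nz by (intro integrable_continuous continuous_intros) auto
  next
    show "continuous_on ({0..X} \<times> cbox 0 1) (\<lambda>(x, t). \<i> * of_real (2 * x) * cis (x\<^sup>2 * (1 + t\<^sup>2)))"
      by (auto simp: case_prod_beta intro!: continuous_intros)
  qed (use assms in auto)
  then show ?thesis
    by (simp add: fresnel_aux_def[abs_def])
qed

lemma fresnel_aux_0: "fresnel_aux 0 = of_real (pi / 4)"
proof -
  have "((\<lambda>t::real. 1 / (1 + t\<^sup>2)) has_integral (arctan 1 - arctan 0)) {0..1}"
    by (rule fundamental_theorem_of_calculus)
       (auto intro!: derivative_eq_intros simp: has_real_derivative_iff_has_vector_derivative[symmetric]
         inverse_eq_divide)
  from has_integral_of_real[OF this]
  have "((\<lambda>t. complex_of_real (1 / (1 + t\<^sup>2))) has_integral of_real (pi / 4)) {0..1}"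
    by (simp only: arctan_one arctan_zero_zero diff_zero)
  from integral_unique[OF this] show ?thesis
    by (simp add: fresnel_aux_def)
qed

lemma fresnel_square:
  assumes "x \<ge> 0"
  shows "(fresnel x)\<^sup>2 = \<i> * (of_real (pi / 4) - fresnel_aux x)"
proof -
  define h where "h x = fresnel x * fresnel x + \<i> * fresnel_aux x" for x
  have "(h has_vector_derivative 0) (at y within {0..x})" if y: "y \<in> {0..x}" for y
  proof -
    have "cis (y\<^sup>2) * fresnel y
        = of_real y * integral {0..1} (\<lambda>t. cis (y\<^sup>2 * (1 + t\<^sup>2)))"
      using y by (simp add: fresnel_rescale distrib_left cis_mult[symmetric])
    then have "fresnel y * cis (y\<^sup>2) + cis (y\<^sup>2) * fresnel y
        + \<i> * (\<i> * of_real (2 * y) * integral {0..1} (\<lambda>t. cis (y\<^sup>2 * (1 + t\<^sup>2)))) = 0"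
      by (simp add: algebra_simps)
    then show ?thesis
      using has_vector_derivative_add[OF has_vector_derivative_mult[OF has_vector_derivative_fresnel[OF y]
          has_vector_derivative_fresnel[OF y]]
          has_vector_derivative_mult_right[OF has_vector_derivative_fresnel_aux[OF y], of \<i>]]
      by (simp only: h_def[abs_def])
  qed
  then obtain c where c: "\<And>y. y \<in> {0..x} \<Longrightarrow> h y = c"
    using has_vector_derivative_zero_constant[of "{0..x}" h] by blast
  have "h x = h 0"
    using c[of x] c[of 0] assms by simp
  then have "(fresnel x)\<^sup>2 + \<i> * fresnel_aux x = \<i> * of_real (pi / 4)"
    by (simp add: h_def fresnel_aux_0 fresnel_def power2_eq_square)
  then show ?thesis
    unfolding right_diff_distrib by (simp only: eq_diff_eq)
qed

lemma norm_fresnel_le: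
  assumes "x \<ge> 0"
  shows "norm (fresnel x) \<le> 2"
proof -
  have nz: "complex_of_real (1 + t\<^sup>2) \<noteq> 0" for t
    using add_pos_nonneg[of 1 "t\<^sup>2"] by (simp only: of_real_eq_0_iff) simp
  have "norm (fresnel_aux x) \<le> 1 * (1 - 0)"
    unfolding fresnel_aux_def
  proof (rule integral_bound)
    show "continuous_on {0..1} (\<lambda>t. cis (x\<^sup>2 * (1 + t\<^sup>2)) / of_real (1 + t\<^sup>2))"
      using nz by (intro continuous_intros) auto
    show "norm (cis (x\<^sup>2 * (1 + t\<^sup>2)) / of_real (1 + t\<^sup>2)) \<le> 1" for t
    proof -
      have "\<bar>1 + t\<^sup>2\<bar> \<ge> 1" by simp
      then show ?thesis
        unfolding norm_divide norm_of_real norm_cis by (subst divide_le_eq_1) linarith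
    qed
  qed simp
  moreover have "norm ((fresnel x)\<^sup>2) \<le> pi / 4 + norm (fresnel_aux x)"
    unfolding fresnel_square[OF assms] norm_mult
    using norm_triangle_ineq4[of "of_real (pi / 4)" "fresnel_aux x"] by simp
  ultimately have "(norm (fresnel x))\<^sup>2 \<le> 2\<^sup>2"
    using pi_less_4 by (simp add: norm_power)
  then show ?thesis
    by (rule power2_le_imp_le) simp
qed

text \<open>
  \<open>fresnel_aux x\<close> is oscillatory with phase \<open>x\<^sup>2 t\<^sup>2\<close>. Its integrand is \<open>1 / (1 + t\<^sup>2)\<close> times
  the derivative of \<open>fresnel (x t)\<close>, up to the factor \<open>cis (x\<^sup>2) / x\<close>, and integration by parts
  against the bounded primitive \<open>fresnel\<close> gains the factor \<open>1 / x\<close>.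
\<close>

lemma norm_fresnel_aux_le:
  assumes "x > 0"
  shows "norm (fresnel_aux x) \<le> 5 / x"
proof -
  define k :: "real \<Rightarrow> real" where "k t = 1 / (1 + t\<^sup>2)" for t
  define k' :: "real \<Rightarrow> real" where "k' t = - 2 * t / (1 + t\<^sup>2)\<^sup>2" for t
  let ?R = "integral {0..1} (\<lambda>t. k' t *\<^sub>R fresnel (x * t))"
  have nz: "1 + t\<^sup>2 > 0" for t :: real
    by (simp add: add_pos_nonneg)
  have k: "(k has_real_derivative k' t) (at t within {0..1})" for t
    unfolding k_def[abs_def] k'_def using nz[of t]
    by (auto intro!: derivative_eq_intros simp: power2_eq_square divide_simps)
  have F: "((\<lambda>t. fresnel (x * t)) has_vector_derivative x *\<^sub>R cis ((x * t)\<^sup>2)) (at t within {0..1})"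
    if "t \<in> {0..1}" for t
  proof -
    have "(fresnel has_vector_derivative cis ((x * t)\<^sup>2)) (at (x * t) within (\<lambda>t. x * t) ` {0..1})"
      by (rule has_vector_derivative_within_subset[OF has_vector_derivative_fresnel[where X = x]])
         (use that assms in \<open>auto simp: mult_left_le\<close>)
    from vector_diff_chain_within[OF _ this, of x] show ?thesis
      by (auto simp: o_def has_real_derivative_iff_has_vector_derivative[symmetric]
               intro!: derivative_eq_intros)
  qed
  have cF: "continuous_on {0..1} (\<lambda>t. fresnel (x * t))"
    using F by (meson continuous_on_eq_continuous_within has_vector_derivative_continuous)
  have ck: "continuous_on {0..1} k'"
    unfolding k'_def[abs_def] using nz by (intro continuous_intros) (auto simp: less_le)
  have fundamental: "((\<lambda>t. k t *\<^sub>R (x *\<^sub>R cis ((x * t)\<^sup>2)) + k' t *\<^sub>R fresnel (x * t)) has_integral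
      (k 1 *\<^sub>R fresnel (x * 1) - k 0 *\<^sub>R fresnel (x * 0))) {0..1}"
    by (rule fundamental_theorem_of_calculus)
       (use has_vector_derivative_scaleR[OF k F] in \<open>simp_all del: scaleR_scaleR\<close>)
  have rest: "((\<lambda>t. k' t *\<^sub>R fresnel (x * t)) has_integral
      ?R) {0..1}"
    by (intro integrable_integral integrable_continuous_interval continuous_intros cF ck)
  have "((\<lambda>t. k t *\<^sub>R (x *\<^sub>R cis ((x * t)\<^sup>2))) has_integral
      (k 1 *\<^sub>R fresnel x - ?R)) {0..1}"
    using has_integral_diff[OF fundamental rest] by (simp add: fresnel_def del: scaleR_scaleR)
  from has_integral_mult_right[OF this, of "cis (x\<^sup>2)"]
  have "((\<lambda>t. of_real x * (cis (x\<^sup>2 * (1 + t\<^sup>2)) / of_real (1 + t\<^sup>2))) has_integral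
      cis (x\<^sup>2) * (k 1 *\<^sub>R fresnel x - ?R)) {0..1}"
    by (simp add: k_def scaleR_conv_of_real cis_mult[symmetric] distrib_left power_mult_distrib mult_ac)
  then have eq: "of_real x * fresnel_aux x
      = cis (x\<^sup>2) * (k 1 *\<^sub>R fresnel x - ?R)"
    using integral_mult_right[of "{0..1}" "of_real x"
        "\<lambda>t. cis (x\<^sup>2 * (1 + t\<^sup>2)) / of_real (1 + t\<^sup>2)"]
    by (simp add: integral_unique fresnel_aux_def)
  have "norm (?R) \<le> 4 * (1 - 0)"
  proof (rule integral_bound)
    show "norm (k' t *\<^sub>R fresnel (x * t)) \<le> 4" if t: "t \<in> {0..1}" for t
    proof -
      have "1 \<le> (1 + t\<^sup>2)\<^sup>2" by (simp add: one_le_power)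
      then have "\<bar>k' t\<bar> \<le> 2 * 1 / 1"
        unfolding k'_def abs_divide using t by (intro frac_le) auto
      then have "\<bar>k' t\<bar> * norm (fresnel (x * t)) \<le> 2 * 2"
        using t assms by (intro mult_mono norm_fresnel_le) auto
      then show "norm (k' t *\<^sub>R fresnel (x * t)) \<le> 4" by simp
    qed
  qed (simp, intro continuous_intros cF ck)
  moreover have "norm (k 1 *\<^sub>R fresnel x) \<le> 1"
    using norm_fresnel_le[of x] assms by (simp add: k_def)
  ultimately have "norm (of_real x * fresnel_aux x) \<le> 5"
    unfolding eq norm_mult
    using norm_triangle_ineq4[of "k 1 *\<^sub>R fresnel x" "?R"]
    by simp
  then show ?thesis
    using assms by (simp add: norm_mult field_simps)
qed

lemma fresnel_square_asymp:
  assumes "x > 0"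
  shows "norm ((fresnel x)\<^sup>2 - \<i> * of_real (pi / 4)) \<le> 5 / x"
proof -
  have "(fresnel x)\<^sup>2 - \<i> * of_real (pi / 4) = - \<i> * fresnel_aux x"
    using fresnel_square[of x] assms by (simp only: right_diff_distrib) simp
  then show ?thesis
    using norm_fresnel_aux_le[OF assms] by (simp add: norm_mult)
qed

section \<open>Asymptotics of the products of orders 0 and 1\<close>

text \<open>
  Poisson's integrals for \<open>J 0\<close> and \<open>J 1\<close>. They are identified with the power series through the
  first order system \<open>u' = - v\<close>, \<open>r v' = r u - v\<close> that both pairs of functions satisfy.
\<close>

definition poisson_int0 :: "real \<Rightarrow> real" where
  "poisson_int0 r = integral {-(pi/2)..pi/2} (\<lambda>t. cos (r * sin t)) / pi"

definition poisson_int1 :: "real \<Rightarrow> real" where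
  "poisson_int1 r = integral {-(pi/2)..pi/2} (\<lambda>t. sin (r * sin t) * sin t) / pi"

lemma poisson_int0_deriv: "(poisson_int0 has_field_derivative - poisson_int1 r) (at r)"
proof -
  have "((\<lambda>r. integral (cbox (-(pi/2)) (pi/2)) (\<lambda>t. cos (r * sin t))) has_field_derivative
      integral (cbox (-(pi/2)) (pi/2)) (\<lambda>t. - (sin (r * sin t) * sin t))) (at r within UNIV)"
    by (rule leibniz_rule_field_derivative)
       (auto intro!: derivative_eq_intros integrable_continuous_interval continuous_intros simp: case_prod_beta)
  from DERIV_cdivide[OF this, of pi] show ?thesis
    by (simp add: poisson_int0_def[abs_def] poisson_int1_def)
qed

lemma poisson_int1_deriv:
  "(poisson_int1 has_field_derivative
      integral {-(pi/2)..pi/2} (\<lambda>t. cos (r * sin t) * (sin t)\<^sup>2) / pi) (at r)"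
proof -
  have "((\<lambda>r. integral (cbox (-(pi/2)) (pi/2)) (\<lambda>t. sin (r * sin t) * sin t)) has_field_derivative
      integral (cbox (-(pi/2)) (pi/2)) (\<lambda>t. cos (r * sin t) * (sin t)\<^sup>2)) (at r within UNIV)"
    by (rule leibniz_rule_field_derivative)
       (auto intro!: derivative_eq_intros integrable_continuous_interval continuous_intros
         simp: case_prod_beta power2_eq_square)
  from DERIV_cdivide[OF this, of pi] show ?thesis
    by (simp add: poisson_int1_def[abs_def])
qed

lemma poisson_int_relation:
  "r * (integral {-(pi/2)..pi/2} (\<lambda>t. cos (r * sin t) * (sin t)\<^sup>2) / pi)
     = r * poisson_int0 r - poisson_int1 r"
proof -
  let ?I = "{-(pi/2)..pi/2}"
  let ?d = "\<lambda>t. r * (cos (r * sin t) - cos (r * sin t) * (sin t)\<^sup>2) - sin (r * sin t) * sin t"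
  have ftc: "((\<lambda>t. ?d t)
      has_integral (cos (pi/2) * sin (r * sin (pi/2)) - cos (-(pi/2)) * sin (r * sin (-(pi/2))))) ?I"
  proof (rule fundamental_theorem_of_calculus)
    fix t :: real
    have "((\<lambda>t. cos t * sin (r * sin t)) has_real_derivative
        - sin t * sin (r * sin t) + cos (r * sin t) * (r * cos t) * cos t) (at t within ?I)"
      by (auto intro!: derivative_eq_intros)
    also have "- sin t * sin (r * sin t) + cos (r * sin t) * (r * cos t) * cos t
        = ?d t"
      using sin_cos_squared_add[of t] by algebra
    finally show "((\<lambda>t. cos t * sin (r * sin t)) has_vector_derivative
        ?d t) (at t within ?I)"
      by (simp add: has_real_derivative_iff_has_vector_derivative)
  qed (use pi_gt_zero in linarith)
  have i: "f integrable_on ?I" if "continuous_on ?I f" for f :: "real \<Rightarrow> real"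
    using that by (rule integrable_continuous_interval)
  have "0 = integral ?I (\<lambda>t. ?d t)"
    using integral_unique[OF ftc] by simp
  also have "\<dots> = r * (integral ?I (\<lambda>t. cos (r * sin t))
      - integral ?I (\<lambda>t. cos (r * sin t) * (sin t)\<^sup>2)) - integral ?I (\<lambda>t. sin (r * sin t) * sin t)"
    by (simp add: integral_diff i continuous_intros)
  finally show ?thesis
    by (simp add: poisson_int0_def poisson_int1_def field_simps)
qed

lemma J_1_deriv:
  "r * ((J 0 r - J 2 r) / 2) = r * J 0 r - J 1 r"
proof -
  have "r * J 0 r + r * J 2 r = 2 * J 1 r"
    using J_recurrence[of r 0] by (simp add: distrib_left eval_nat_numeral)
  then show ?thesis by (simp add: field_simps)
qed

lemma J_0_0: "J 0 0 = 1" and J_Suc_0: "J (Suc n) 0 = 0"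
proof -
  have "J_cofactor m 0 = 1 / fact m" for m
    unfolding J_cofactor_def powser_zero by simp
  then show "J 0 0 = 1" "J (Suc n) 0 = 0"
    by (simp_all add: J_eq_cofactor)
qed

text \<open>
  The system is singular at 0. Uniqueness comes from the energy \<open>u\<^sup>2 + v\<^sup>2\<close>, whose derivative
  is \<open>- 2 v\<^sup>2 / r\<close>: the difference of the two solutions vanishes at 0, and its energy cannot grow.
\<close>

lemma J_integral:
  assumes "r \<ge> 0"
  shows "J 0 r = poisson_int0 r" and "J 1 r = poisson_int1 r"
proof -
  define d0 where "d0 x = J 0 x - poisson_int0 x" for x
  define d1 where "d1 x = J 1 x - poisson_int1 x" for x
  define e where "e x = d0 x ^ 2 + d1 x ^ 2" for x
  let ?d = "\<lambda>x. (J 0 x - J 2 x) / 2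
    - integral {-(pi/2)..pi/2} (\<lambda>t. cos (x * sin t) * (sin t)\<^sup>2) / pi"
  have D0: "(d0 has_field_derivative - d1 x) (at x)" for x
    unfolding d0_def[abs_def] d1_def
    by (rule DERIV_cong[OF DERIV_diff[OF J_0_deriv poisson_int0_deriv]]) simp
  have D1: "(d1 has_field_derivative ?d x) (at x)" for x
    unfolding d1_def[abs_def]
    using DERIV_diff[OF J_Suc_deriv[of 0] poisson_int1_deriv, of x]
    by (simp add: eval_nat_numeral)
  have eq: "x * ?d x = x * d0 x - d1 x" for x
    using J_1_deriv[of x] poisson_int_relation[of x]
    by (simp add: d0_def d1_def algebra_simps)
  have De: "(e has_field_derivative (2 * d0 x * (- d1 x) + 2 * d1 x * ?d x)) (at x)" for x
    unfolding e_def[abs_def]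
    by (rule DERIV_cong[OF DERIV_add[OF DERIV_power[OF D0] DERIV_power[OF D1]]]) (simp add: mult_ac)
  have "e r \<le> e 0"
  proof (rule DERIV_nonpos_imp_decreasing_open[OF assms])
    fix x assume x: "0 < x" "x < r"
    have "x * (2 * d0 x * (- d1 x) + 2 * d1 x * ?d x) = 2 * d1 x * (x * ?d x) - 2 * x * d0 x * d1 x"
      by (simp only: distrib_left) (simp add: mult_ac)
    also have "\<dots> = - 2 * (d1 x)\<^sup>2"
      unfolding eq by (simp add: algebra_simps power2_eq_square)
    finally have "x * (2 * d0 x * (- d1 x) + 2 * d1 x * ?d x) \<le> 0" by simp
    then have "2 * d0 x * (- d1 x) + 2 * d1 x * ?d x \<le> 0"
      using x by (simp only: mult_le_0_iff) auto
    with De show "\<exists>y. (e has_real_derivative y) (at x) \<and> y \<le> 0" by blast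
  next
    show "continuous_on {0..r} e"
      using De by (meson DERIV_continuous continuous_at_imp_continuous_on)
  qed
  moreover have "e 0 = 0"
    by (simp add: e_def d0_def d1_def poisson_int0_def poisson_int1_def J_0_0 J_Suc_0[of 0, simplified])
  ultimately have "d0 r ^ 2 + d1 r ^ 2 \<le> 0"
    by (simp add: e_def)
  then have "d0 r = 0" "d1 r = 0"
    by (simp_all add: sum_power2_le_zero_iff)
  then show "J 0 r = poisson_int0 r" "J 1 r = poisson_int1 r"
    by (simp_all add: d0_def d1_def)
qed

lemma integral_odd_eq_0:
  fixes f :: "real \<Rightarrow> real"
  assumes "\<And>x. f (- x) = - f x"
  shows "integral {-a..a} f = 0"
proof -
  have "integral {-a..a} (\<lambda>x. f (- x)) = integral {-a..a} f"
    using Henstock_Kurzweil_Integration.integral_reflect_real[of a "-a" f] by simp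
  then show ?thesis by (simp add: assms)
qed

text \<open>
  In \<open>J 0 - \<i> J 1\<close> the amplitude \<open>1 - sin t\<close> kills one of the two stationary points of the phase
  \<open>r sin t\<close>, which leaves a single Fresnel integral. The substitution \<open>t = 2 u - \<pi>/2\<close>
  makes the phase a constant plus a multiple of \<open>(sin u)\<^sup>2\<close>.
\<close>

lemma J_complex_integral:
  assumes "r \<ge> 0"
  shows "Complex (J 0 r) (- J 1 r)
    = of_real (4 / pi) * cis (- r) * integral {0..pi/2} (\<lambda>t. cis (2 * r * (sin t)\<^sup>2) * of_real ((cos t)\<^sup>2))"
proof -
  let ?I = "{-(pi/2)..pi/2}" and ?f = "\<lambda>t. cis (r * sin t) * of_real (1 - sin t)"
  have cf: "continuous_on A ?f" for A by (intro continuous_intros)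
  have i: "(?f has_integral integral ?I ?f) ?I"
    by (intro integrable_integral integrable_continuous_interval cf)
  have Re: "Re (integral ?I ?f) = pi * poisson_int0 r"
  proof -
    have "Re (integral ?I ?f) = integral ?I (\<lambda>t. cos (r * sin t) - cos (r * sin t) * sin t)"
      using integral_unique[OF has_integral_linear[OF i bounded_linear_Re]]
      by (simp add: o_def right_diff_distrib)
    also have "\<dots> = integral ?I (\<lambda>t. cos (r * sin t)) - integral ?I (\<lambda>t. cos (r * sin t) * sin t)"
      by (intro integral_diff integrable_continuous_interval continuous_intros)
    also have "integral ?I (\<lambda>t. cos (r * sin t) * sin t) = 0"
      by (rule integral_odd_eq_0) simp
    finally show ?thesis by (simp add: poisson_int0_def)
  qed
  have Im: "Im (integral ?I ?f) = - pi * poisson_int1 r"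
  proof -
    have "Im (integral ?I ?f) = integral ?I (\<lambda>t. sin (r * sin t) - sin (r * sin t) * sin t)"
      using integral_unique[OF has_integral_linear[OF i bounded_linear_Im]]
      by (simp add: o_def right_diff_distrib)
    also have "\<dots> = integral ?I (\<lambda>t. sin (r * sin t)) - integral ?I (\<lambda>t. sin (r * sin t) * sin t)"
      by (intro integral_diff integrable_continuous_interval continuous_intros)
    also have "integral ?I (\<lambda>t. sin (r * sin t)) = 0"
      by (rule integral_odd_eq_0) simp
    finally show ?thesis by (simp add: poisson_int1_def)
  qed
  have "((\<lambda>t. 2 *\<^sub>R ?f (2 * t - pi / 2)) has_integral integral {2 * 0 - pi / 2..2 * (pi / 2) - pi / 2} ?f) {0..pi/2}"
    by (rule has_integral_substitution[where c = "-(pi/2)" and d = "pi/2"])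
       (auto intro!: continuous_intros derivative_eq_intros)
  also have "(\<lambda>t. 2 *\<^sub>R ?f (2 * t - pi / 2))
      = (\<lambda>t. 4 * cis (- r) * (cis (2 * r * (sin t)\<^sup>2) * of_real ((cos t)\<^sup>2)))"
  proof
    fix t
    have s: "sin (2 * t - pi / 2) = 2 * (sin t)\<^sup>2 - 1"
      by (simp add: sin_diff cos_double_sin)
    have c: "1 - sin (2 * t - pi / 2) = 2 * (cos t)\<^sup>2"
      unfolding s by (simp add: cos_squared_eq)
    have "cis (r * sin (2 * t - pi / 2)) = cis (- r) * cis (2 * r * (sin t)\<^sup>2)"
      unfolding s cis_mult by (simp add: algebra_simps)
    then show "2 *\<^sub>R ?f (2 * t - pi / 2)
        = 4 * cis (- r) * (cis (2 * r * (sin t)\<^sup>2) * of_real ((cos t)\<^sup>2))"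
      unfolding c by (simp add: scaleR_conv_of_real)
  qed
  finally have sub: "((\<lambda>t. 4 * cis (- r) * (cis (2 * r * (sin t)\<^sup>2) * of_real ((cos t)\<^sup>2))) has_integral
      integral ?I ?f) {0..pi/2}" by simp
  have "integral ?I ?f
      = 4 * cis (- r) * integral {0..pi/2} (\<lambda>t. cis (2 * r * (sin t)\<^sup>2) * of_real ((cos t)\<^sup>2))"
    using integral_unique[OF sub] unfolding integral_mult_right by simp
  moreover have "integral ?I ?f = of_real pi * Complex (J 0 r) (- J 1 r)"
    by (rule complex_eqI) (simp_all only: Re Im J_integral[OF assms], simp_all)
  ultimately show ?thesis by (simp add: field_simps)
qed

text \<open>
  With \<open>(cos t)\<^sup>2 = cos t - cos t (1 - cos t)\<close> the first part is a rescaled Fresnel integral in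
  the variable \<open>sin t\<close>, and the second has an amplitude that vanishes at the stationary point
  \<open>t = 0\<close>, hence is smaller by a factor \<open>r powr (- 1 / 2)\<close>.
\<close>

definition half_circle_int :: "real \<Rightarrow> complex" where
  "half_circle_int r = integral {0..pi/2} (\<lambda>t. cis (2 * r * (sin t)\<^sup>2) * of_real ((cos t)\<^sup>2))"

lemma half_circle_fresnel:
  assumes "r > 0"
  shows "((\<lambda>t. cis (2 * r * (sin t)\<^sup>2) * of_real (cos t))
           has_integral fresnel (sqrt (2 * r)) / of_real (sqrt (2 * r))) {0..pi/2}"
proof -
  define q where "q = sqrt (2 * r)"
  have q: "q > 0" "q\<^sup>2 = 2 * r" using assms by (simp_all add: q_def)
  have "((\<lambda>t. (q * cos t) *\<^sub>R cis ((q * sin t)\<^sup>2)) has_integral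
      integral {q * sin 0..q * sin (pi / 2)} (\<lambda>u. cis (u\<^sup>2))) {0..pi/2}"
    by (rule has_integral_substitution[where c = 0 and d = q])
       (use q pi_gt_zero in \<open>auto intro!: continuous_intros derivative_eq_intros mult_nonneg_nonneg
          sin_ge_zero simp: mult_le_cancel_left2\<close>)
  then have "((\<lambda>t. of_real q * (cis (2 * r * (sin t)\<^sup>2) * of_real (cos t))) has_integral fresnel q) {0..pi/2}"
    by (simp add: fresnel_def power_mult_distrib q scaleR_conv_of_real mult_ac)
  from has_integral_divide[OF this, of "of_real q"] show ?thesis
    using q by (simp add: q_def)
qed

lemma half_circle_remainder:
  assumes "r > 0"
  shows "norm (integral {0..pi/2} (\<lambda>t. cis (2 * r * (sin t)\<^sup>2) * of_real (cos t * (1 - cos t)))) \<le> 1 / r"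
proof -
  let ?I = "{0..pi/2}"
  let ?e = "\<lambda>t. cis (2 * r * (sin t)\<^sup>2)"
  let ?f = "\<lambda>t. ?e t * of_real (cos t * (1 - cos t))"
  let ?k = "\<lambda>t. (1 + (tan (t / 2))\<^sup>2) / 2"
  let ?K = "integral ?I (\<lambda>t. ?k t *\<^sub>R ?e t)"
  let ?d = "\<lambda>t. tan (t / 2) *\<^sub>R (of_real (2 * r * (2 * sin t * cos t)) * \<i> * ?e t)
        + ?k t *\<^sub>R ?e t"
  have c: "cos (t / 2) \<noteq> 0" if "t \<in> ?I" for t
  proof -
    have "0 < cos (t / 2)"
      using that pi_gt_zero unfolding atLeastAtMost_iff by (intro cos_gt_zero_pi; linarith)
    then show ?thesis by simp
  qed
  \<comment> \<open>By parts: the derivative of \<open>?e t\<close> is \<open>4 \<i> r sin t cos t * ?e t\<close>, and \<open>(1 - cos t) / sin t = tan (t / 2)\<close> is smooth on the whole interval.\<close>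
  have tan_le: "0 \<le> tan (t / 2) \<and> tan (t / 2) \<le> 1" if "t \<in> ?I" for t
  proof -
    have "tan (t / 2) \<le> tan (pi / 4)"
      using that pi_gt_zero unfolding atLeastAtMost_iff by (intro tan_mono_le; linarith)
    moreover have "tan 0 \<le> tan (t / 2)"
      using that pi_gt_zero unfolding atLeastAtMost_iff by (intro tan_mono_le; linarith)
    ultimately show ?thesis by (simp add: tan_45)
  qed
  have "((\<lambda>t. ?d t)
      has_integral (tan (pi / 2 / 2) *\<^sub>R cis (2 * r * (sin (pi / 2))\<^sup>2) - tan (0 / 2) *\<^sub>R cis (2 * r * (sin 0)\<^sup>2))) ?I"
  proof (rule fundamental_theorem_of_calculus)
    fix t :: real assume t: "t \<in> ?I"
    show "((\<lambda>t. tan (t / 2) *\<^sub>R ?e t) has_vector_derivative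
        ?d t) (at t within ?I)"
    proof (intro has_vector_derivative_scaleR has_vector_derivative_cis)
      show "((\<lambda>t. tan (t / 2)) has_real_derivative ?k t) (at t within ?I)"
        using c[OF t] by (auto intro!: derivative_eq_intros simp: tan_def field_simps)
           (simp add: power2_eq_square[symmetric] sin_squared_eq)
    qed (auto intro!: derivative_eq_intros)
  qed (use pi_gt_zero in linarith)
  also have "(\<lambda>t. ?d t)
     = (\<lambda>t. of_real (4 * r) * \<i> * (?e t * of_real (cos t * (tan (t / 2) * sin t)))
        + ?k t *\<^sub>R ?e t)"
    by (simp add: fun_eq_iff scaleR_conv_of_real mult_ac)
  finally have ftc: "((\<lambda>t. of_real (4 * r) * \<i> * (?e t * of_real (cos t * (tan (t / 2) * sin t)))
        + ?k t *\<^sub>R ?e t) has_integral cis (2 * r)) ?I"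
    by (simp add: tan_45)
  have ck: "continuous_on ?I (\<lambda>t. ?k t *\<^sub>R ?e t)"
    using c by (intro continuous_intros) auto
  then have rest: "((\<lambda>t. ?k t *\<^sub>R ?e t) has_integral
      ?K) ?I"
    by (intro integrable_integral integrable_continuous_interval)
  have "((\<lambda>t. of_real (4 * r) * \<i> * (?e t * of_real (cos t * (tan (t / 2) * sin t))))
      has_integral cis (2 * r) - ?K) ?I"
    using has_integral_diff[OF ftc rest] by (simp only: add_diff_cancel_right')
  moreover have half_angle: "tan (t / 2) * sin t = 1 - cos t" if "t \<in> ?I" for t
    using c[OF that] sin_double[of "t / 2"] cos_double_sin[of "t / 2"]
    by (simp add: tan_def power2_eq_square)
  ultimately have "((\<lambda>t. of_real (4 * r) * \<i> * ?f t)
      has_integral cis (2 * r) - ?K) ?I"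
    by (elim has_integral_eq[rotated]) (simp only: half_angle)
  from integral_unique[OF this]
  have "of_real (4 * r) * \<i> * integral ?I ?f
      = cis (2 * r) - ?K"
    unfolding integral_mult_right .
  from arg_cong[OF this, of norm]
  have "4 * r * norm (integral ?I ?f) = norm (cis (2 * r) - ?K)"
    unfolding norm_mult norm_of_real using assms by simp
  also have "\<dots> \<le> norm (cis (2 * r)) + norm (?K)"
    by (rule norm_triangle_ineq4)
  also have "norm (cis (2 * r)) = 1" by simp
  also have "norm (?K) \<le> 1 * (pi / 2 - 0)"
  proof (rule integral_bound[OF _ ck])
    fix t assume t: "t \<in> ?I"
    have "(tan (t / 2))\<^sup>2 \<le> 1"
      using tan_le[OF t] by (simp add: power_le_one)
    then show "norm (?k t *\<^sub>R ?e t) \<le> 1" by simp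
  qed (use pi_gt_zero in linarith)
  finally have "4 * r * norm (integral ?I ?f) \<le> 4"
    using pi_less_4 by simp
  then show ?thesis
    using assms by (simp add: field_simps)
qed

lemma half_circle_int_asymp:
  assumes "r \<ge> 1"
  shows "norm (of_real (2 * r) * (half_circle_int r)\<^sup>2 - \<i> * of_real (pi / 4)) \<le> 17 / sqrt r"
proof -
  define q where "q = sqrt (2 * r)"
  define R where "R = integral {0..pi/2} (\<lambda>t. cis (2 * r * (sin t)\<^sup>2) * of_real (cos t * (1 - cos t)))"
  have q: "q > 0" "q\<^sup>2 = 2 * r" using assms by (simp_all add: q_def)
  have "((\<lambda>t. cis (2 * r * (sin t)\<^sup>2) * of_real (cos t * (1 - cos t))) has_integral R) {0..pi/2}"
    unfolding R_def by (intro integrable_integral integrable_continuous_interval continuous_intros)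
  from has_integral_diff[OF half_circle_fresnel[of r] this]
  have "half_circle_int r = fresnel q / of_real q - R"
    unfolding half_circle_int_def q_def using assms
    by (intro integral_unique) (simp add: algebra_simps power2_eq_square)
  then have G: "of_real q * half_circle_int r = fresnel q - of_real q * R"
    using q by (simp add: right_diff_distrib)
  define d where "d = of_real q * R"
  have "norm d \<le> sqrt (2 * r) * (1 / r)"
    unfolding d_def norm_mult R_def using half_circle_remainder[of r] assms q
    by (intro mult_mono) (auto simp: q_def)
  also have "\<dots> = sqrt 2 / sqrt r"
    using assms by (simp add: real_sqrt_mult real_div_sqrt field_simps)
  also have "\<dots> \<le> 2 / sqrt r"
    using assms sqrt2_less_2 by (intro divide_right_mono) auto
  finally have d: "norm d \<le> 2 / sqrt r" .
  also have "\<dots> \<le> 2" using assms by (simp add: field_simps)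
  finally have d2: "norm d \<le> 2" .
  have "of_real (2 * r) * (half_circle_int r)\<^sup>2 = (of_real q * half_circle_int r)\<^sup>2"
    unfolding power_mult_distrib of_real_power[symmetric] q(2) ..
  also have "\<dots> = (fresnel q)\<^sup>2 - d * (2 * fresnel q - d)"
    unfolding G d_def by (simp add: power2_eq_square algebra_simps)
  finally have "of_real (2 * r) * (half_circle_int r)\<^sup>2 - \<i> * of_real (pi / 4)
      = ((fresnel q)\<^sup>2 - \<i> * of_real (pi / 4)) - d * (2 * fresnel q - d)" by simp
  also have "norm \<dots> \<le> norm ((fresnel q)\<^sup>2 - \<i> * of_real (pi / 4)) + norm d * norm (2 * fresnel q - d)"
    unfolding norm_mult[symmetric] by (rule norm_triangle_ineq4)
  also have "norm (2 * fresnel q - d) \<le> 6"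
    using norm_triangle_ineq4[of "2 * fresnel q" d] norm_fresnel_le[of q] q d2 by (simp add: norm_mult)
  also have "norm ((fresnel q)\<^sup>2 - \<i> * of_real (pi / 4)) \<le> 5 / q"
    by (rule fresnel_square_asymp) (rule q)
  also have "5 / q \<le> 5 / sqrt r"
    using assms by (intro divide_left_mono) (auto simp: q_def)
  finally have "norm (of_real (2 * r) * (half_circle_int r)\<^sup>2 - \<i> * of_real (pi / 4))
      \<le> 5 / sqrt r + norm d * 6" by (simp add: mult_left_mono)
  with d show ?thesis by (simp add: add_divide_distrib[symmetric])
qed

text \<open>
  The sums contain products of two Bessel functions, so the natural quantity is the square of
  \<open>J 0 - \<i> J 1\<close>, to which the value of \<open>(fresnel x)\<^sup>2\<close> applies directly. Its modulus and argument
  are the amplitude and the phase.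
\<close>

lemma J_01_square_asymp:
  assumes "r \<ge> 1"
  shows "norm (of_real r * (Complex (J 0 r) (- J 1 r))\<^sup>2 - of_real (2 / pi) * \<i> * cis (- 2 * r))
           \<le> 17 / sqrt r"
proof -
  have "(4 / pi)\<^sup>2 * r = 8 / pi\<^sup>2 * (2 * r)" by (simp add: power_divide)
  moreover have "(cis (- r))\<^sup>2 = cis (- 2 * r)" by (simp add: power2_eq_square cis_mult)
  ultimately have "of_real r * (Complex (J 0 r) (- J 1 r))\<^sup>2
      = of_real (8 / pi\<^sup>2) * cis (- 2 * r) * (of_real (2 * r) * (half_circle_int r)\<^sup>2)"
    unfolding J_complex_integral[OF order_trans[OF zero_le_one assms]] half_circle_int_def[symmetric]
    by (simp add: power_mult_distrib mult_ac power_divide)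
  moreover have "of_real (2 / pi) * \<i> * cis (- 2 * r)
      = of_real (8 / pi\<^sup>2) * cis (- 2 * r) * (\<i> * of_real (pi / 4))"
    by (simp add: power2_eq_square)
  ultimately have "norm (of_real r * (Complex (J 0 r) (- J 1 r))\<^sup>2
        - of_real (2 / pi) * \<i> * cis (- 2 * r))
      = 8 / pi\<^sup>2 * norm (of_real (2 * r) * (half_circle_int r)\<^sup>2 - \<i> * of_real (pi / 4))"
    by (simp only: right_diff_distrib[symmetric] norm_mult norm_cis norm_of_real) simp
  also have "\<dots> \<le> 1 * (17 / sqrt r)"
  proof (intro mult_mono half_circle_int_asymp assms)
    have "3\<^sup>2 \<le> pi\<^sup>2" using pi_gt3 by (intro power_mono) auto
    then show "8 / pi\<^sup>2 \<le> 1" by simp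
  qed auto
  finally show ?thesis by simp
qed

lemma J_01_asymp:
  assumes "r \<ge> 1"
  shows "\<bar>r * ((J 0 r)\<^sup>2 - (J 1 r)\<^sup>2) - 2 / pi * sin (2 * r)\<bar> \<le> 17 / sqrt r"
    and "\<bar>2 * r * (J 0 r * J 1 r) + 2 / pi * cos (2 * r)\<bar> \<le> 17 / sqrt r"
    and "\<bar>r * ((J 0 r)\<^sup>2 + (J 1 r)\<^sup>2) - 2 / pi\<bar> \<le> 17 / sqrt r"
proof -
  let ?z = "Complex (J 0 r) (- J 1 r)" and ?w = "of_real (2 / pi) * \<i> * cis (- 2 * r)"
  note a = J_01_square_asymp[OF assms]
  have "\<bar>Re (of_real r * ?z\<^sup>2 - ?w)\<bar> \<le> 17 / sqrt r"
    using abs_Re_le_cmod a by (rule order_trans)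
  also have "Re (of_real r * ?z\<^sup>2 - ?w) = r * ((J 0 r)\<^sup>2 - (J 1 r)\<^sup>2) - 2 / pi * sin (2 * r)"
    by (simp add: power2_eq_square)
  finally show "\<bar>r * ((J 0 r)\<^sup>2 - (J 1 r)\<^sup>2) - 2 / pi * sin (2 * r)\<bar> \<le> 17 / sqrt r" .
  have "\<bar>Im (of_real r * ?z\<^sup>2 - ?w)\<bar> \<le> 17 / sqrt r"
    using abs_Im_le_cmod a by (rule order_trans)
  also have "Im (of_real r * ?z\<^sup>2 - ?w) = - (2 * r * (J 0 r * J 1 r) + 2 / pi * cos (2 * r))"
    by (simp add: power2_eq_square)
  finally show "\<bar>2 * r * (J 0 r * J 1 r) + 2 / pi * cos (2 * r)\<bar> \<le> 17 / sqrt r"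
    by (simp only: abs_minus_cancel)
  have "\<bar>norm (of_real r * ?z\<^sup>2) - norm ?w\<bar> \<le> 17 / sqrt r"
    using norm_triangle_ineq3 a by (rule order_trans)
  also have "norm (of_real r * ?z\<^sup>2) = r * ((J 0 r)\<^sup>2 + (J 1 r)\<^sup>2)"
    using assms by (simp add: norm_mult norm_power cmod_power2)
  also have "norm ?w = 2 / pi" by (simp add: norm_mult norm_divide)
  finally show "\<bar>r * ((J 0 r)\<^sup>2 + (J 1 r)\<^sup>2) - 2 / pi\<bar> \<le> 17 / sqrt r" .
qed

section \<open>Orthonormality and moments in the order\<close>

text \<open>
  Orders in the integers, with \<open>J (- n) = (- 1)^n J n\<close>. Over the integers the recurrences have no
  boundary case, and a shift of the summation index leaves no boundary terms.
\<close>

definition Jz :: "int \<Rightarrow> real \<Rightarrow> real" where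
  "Jz n r = (if 0 \<le> n then J (nat n) r else (-1) ^ nat (- n) * J (nat (- n)) r)"

lemma Jz_int [simp]: "Jz (int n) r = J n r"
  by (simp add: Jz_def)

lemma Jz_minus_int [simp]: "Jz (- int n) r = (-1) ^ n * J n r"
  by (cases n) (auto simp: Jz_def nat_add_distrib)

lemma int_sign_cases:
  obtains k where "n = int k + 1" | "n = 0" | k where "n = - (int k + 1)"
proof (cases n "0::int" rule: linorder_cases)
  case less
  then have "n = - (int (nat (- n - 1)) + 1)" by simp
  with that(3) show ?thesis by blast
next
  case greater
  then have "n = int (nat (n - 1)) + 1" by simp
  with that(1) show ?thesis by blast
qed (use that(2) in blast)

lemma Jz_shifts:
  "Jz (int k + 1) r = J (k + 1) r" "Jz (int k + 1 - 1) r = J k r"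
  "Jz (int k + 1 + 1) r = J (k + 2) r"
  "Jz (- (int k + 1)) r = - ((-1) ^ k * J (k + 1) r)"
  "Jz (- (int k + 1) - 1) r = (-1) ^ k * J (k + 2) r"
  "Jz (- (int k + 1) + 1) r = (-1) ^ k * J k r"
  using Jz_int[of "k + 1" r] Jz_int[of k r] Jz_int[of "k + 2" r]
    Jz_minus_int[of "k + 1" r] Jz_minus_int[of k r] Jz_minus_int[of "k + 2" r]
  by (simp_all add: algebra_simps)

lemma Jz_0_shifts:
  "Jz (0 - 1) r = - J 1 r" "Jz 0 r = J 0 r" "Jz (0 + 1) r = J 1 r"
  using Jz_minus_int[of 1 r] Jz_int[of 1 r] Jz_int[of 0 r] by simp_all

lemma Jz_recurrence:
  "r * (Jz (n - 1) r + Jz (n + 1) r) = 2 * of_int n * Jz n r"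
proof (cases n rule: int_sign_cases)
  case (1 k)
  show ?thesis unfolding 1 Jz_shifts using J_recurrence[of r k] by simp
next
  case 2
  show ?thesis unfolding 2 Jz_0_shifts by simp
next
  case (3 k)
  have "r * ((-1) ^ k * J (k + 2) r + (-1) ^ k * J k r)
      = (-1) ^ k * (r * (J k r + J (k + 2) r))"
    by (simp add: algebra_simps)
  then show ?thesis unfolding 3 Jz_shifts J_recurrence by (simp add: algebra_simps)
qed

lemma Jz_deriv:
  "(Jz n has_field_derivative (Jz (n - 1) r - Jz (n + 1) r) / 2) (at r)"
proof (cases n rule: int_sign_cases)
  case (1 k)
  have "Jz n = J (Suc k)" unfolding 1 by (rule ext) (simp add: Jz_shifts)
  then show ?thesis unfolding 1 Jz_shifts using J_Suc_deriv[of k r] by simp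
next
  case 2
  have "Jz n = J 0" unfolding 2 by (rule ext) (simp add: Jz_0_shifts)
  then show ?thesis unfolding 2 Jz_0_shifts using J_0_deriv[of r] by simp
next
  case (3 k)
  have e: "Jz n = (\<lambda>r. - ((-1) ^ k) * J (Suc k) r)"
    unfolding 3 by (rule ext) (simp only: Jz_shifts, simp)
  have "((\<lambda>r. - ((-1) ^ k) * J (Suc k) r) has_field_derivative
      - ((-1) ^ k) * ((J k r - J (k + 2) r) / 2)) (at r)"
    by (rule DERIV_cmult[OF J_Suc_deriv])
  then show ?thesis
    unfolding e 3 Jz_shifts by (simp add: algebra_simps diff_divide_distrib)
qed

lemma Jz_bound:
  assumes "\<bar>r\<bar> \<le> R"
  shows "\<bar>Jz n r\<bar> \<le> exp (R + R\<^sup>2 / 4) * (1 / 2) ^ nat \<bar>n\<bar>"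
proof -
  have "r\<^sup>2 \<le> R\<^sup>2" using assms by (meson abs_le_square_iff abs_ge_self order_trans)
  then have "exp (\<bar>r\<bar> + r\<^sup>2 / 4) \<le> exp (R + R\<^sup>2 / 4)" using assms by simp
  then have "exp (\<bar>r\<bar> + r\<^sup>2 / 4) * (1 / 2) ^ nat \<bar>n\<bar> \<le> exp (R + R\<^sup>2 / 4) * (1 / 2) ^ nat \<bar>n\<bar>"
    by (rule mult_right_mono) simp
  moreover have "\<bar>Jz n r\<bar> = \<bar>J (nat \<bar>n\<bar>) r\<bar>"
    by (simp add: Jz_def abs_mult power_abs)
  ultimately show ?thesis
    using J_geometric_bound[of "nat \<bar>n\<bar>" r] by linarith
qed

text \<open>
  Partial sums of \<open>\<Sum> J l r * J (l + b) r\<close> over all integers \<open>l\<close>. Their derivative in \<open>r\<close> telescopes to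
  boundary terms at \<open>l = \<plusminus>N\<close>, which tend to 0 geometrically, so the full sum keeps the value that
  it has at \<open>r = 0\<close>. This is the orthonormality of the shifts of the sequence \<open>J l r\<close>.
\<close>

definition J_corr :: "nat \<Rightarrow> int \<Rightarrow> real \<Rightarrow> real" where
  "J_corr N b r = (\<Sum>l\<in>{- int N..int N}. Jz l r * Jz (l + b) r)"

lemma sum_int_telescope:
  fixes G :: "int \<Rightarrow> real"
  shows "(\<Sum>l\<in>{- int N..int N}. G l - G (l + 1)) = G (- int N) - G (int N + 1)"
proof (induction N)
  case (Suc N)
  have "{- int (Suc N)..int (Suc N)} = insert (- int (Suc N)) (insert (int (Suc N)) {- int N..int N})"
    by auto
  then have "(\<Sum>l\<in>{- int (Suc N)..int (Suc N)}. G l - G (l + 1))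
      = (G (- int (Suc N)) - G (- int (Suc N) + 1)) + ((G (int (Suc N)) - G (int (Suc N) + 1))
        + (\<Sum>l\<in>{- int N..int N}. G l - G (l + 1)))"
    by (simp del: of_nat_Suc)
  also have "G (- int (Suc N) + 1) = G (- int N)" by (rule arg_cong[of _ _ G]) simp
  also have "(\<Sum>l\<in>{- int N..int N}. G l - G (l + 1)) = G (- int N) - G (int (Suc N))"
    using Suc by (simp add: add.commute)
  finally show ?case by simp
qed simp

lemma J_corr_deriv:
  fixes G defines "G \<equiv> \<lambda>b r l. Jz (l - 1) r * Jz (l + b) r + Jz l r * Jz (l + b - 1) r"
  shows "(J_corr N b has_field_derivative (G b r (- int N) - G b r (int N + 1)) / 2) (at r)"
proof -
  have "(J_corr N b has_field_derivative
      (\<Sum>l\<in>{- int N..int N}. (Jz (l - 1) r - Jz (l + 1) r) / 2 * Jz (l + b) r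
        + (Jz (l + b - 1) r - Jz (l + b + 1) r) / 2 * Jz l r)) (at r)"
    unfolding J_corr_def[abs_def] by (intro DERIV_sum DERIV_mult Jz_deriv)
  also have "(\<Sum>l\<in>{- int N..int N}. (Jz (l - 1) r - Jz (l + 1) r) / 2 * Jz (l + b) r
        + (Jz (l + b - 1) r - Jz (l + b + 1) r) / 2 * Jz l r)
      = (\<Sum>l\<in>{- int N..int N}. G b r l / 2 - G b r (l + 1) / 2)"
    by (rule sum.cong) (simp_all add: G_def field_simps)
  also have "\<dots> = G b r (- int N) / 2 - G b r (int N + 1) / 2"
    by (rule sum_int_telescope)
  finally show ?thesis by (simp add: diff_divide_distrib)
qed

lemma J_corr_0: "J_corr N b 0 = (if b = 0 then 1 else 0)"
proof -
  have J0: "Jz l 0 = (if l = 0 then 1 else 0)" for l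
    using J_0_0 J_Suc_0[of "nat \<bar>l\<bar> - 1"] by (auto simp: Jz_def)
  have "J_corr N b 0 = (\<Sum>l\<in>{- int N..int N}. if l = 0 then Jz b 0 else 0)"
    unfolding J_corr_def by (rule sum.cong) (auto simp: J0)
  also have "\<dots> = Jz b 0" by (subst sum.delta) auto
  finally show ?thesis by (simp add: J0)
qed

lemma J_corr_tendsto:
  assumes "r \<ge> 0"
  shows "(\<lambda>N. J_corr N b r) \<longlonglongrightarrow> (if b = 0 then 1 else 0)"
proof -
  let ?G = "\<lambda>x l. Jz (l - 1) x * Jz (l + b) x + Jz l x * Jz (l + b - 1) x"
  define C where "C = exp (r + r\<^sup>2 / 4)"
  have C: "C > 0" by (simp add: C_def)
  have JJ: "\<bar>Jz m x * Jz n x\<bar> \<le> C\<^sup>2 * (1 / 2) ^ K"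
    if "K \<le> nat \<bar>m\<bar> \<or> K \<le> nat \<bar>n\<bar>" "0 \<le> x" "x \<le> r" for m n x K
  proof -
    have b: "\<bar>Jz m x\<bar> \<le> C * (1 / 2) ^ nat \<bar>m\<bar>" for m
      unfolding C_def using that by (intro Jz_bound) auto
    have "\<bar>Jz m x\<bar> * \<bar>Jz n x\<bar> \<le> (C * (1 / 2) ^ nat \<bar>m\<bar>) * (C * (1 / 2) ^ nat \<bar>n\<bar>)"
      using C by (intro mult_mono b) auto
    also have "\<dots> = C\<^sup>2 * (1 / 2) ^ (nat \<bar>m\<bar> + nat \<bar>n\<bar>)"
      by (simp add: power_add power2_eq_square)
    also have "\<dots> \<le> C\<^sup>2 * (1 / 2) ^ K"
      using that(1) by (intro mult_left_mono power_decreasing) auto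
    finally show ?thesis by (simp add: abs_mult)
  qed
  have abs_half_le: "\<bar>((a + b) - (c + d)) / 2\<bar> \<le> 2 * M"
    if "\<bar>a\<bar> \<le> M" "\<bar>b\<bar> \<le> M" "\<bar>c\<bar> \<le> M" "\<bar>d\<bar> \<le> M" for a b c d M :: real
    using that by (simp add: abs_le_iff)
  have bound: "\<bar>J_corr N b r - (if b = 0 then 1 else 0)\<bar> \<le> 2 * C\<^sup>2 * r * (1 / 2) ^ N" for N
  proof -
    have "norm (J_corr N b r - J_corr N b 0) \<le> 2 * C\<^sup>2 * (1 / 2) ^ N * norm (r - 0)"
    proof (rule field_differentiable_bound[where S = "{0..r}"])
      fix x assume "x \<in> {0..r}"
      show "(J_corr N b has_field_derivative
         (?G x (- int N) - ?G x (int N + 1)) / 2)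
        (at x within {0..r})"
        using J_corr_deriv by (rule has_field_derivative_at_within)
      have JJN: "\<bar>Jz (- int N - 1) x * Jz (- int N + b) x\<bar> \<le> C\<^sup>2 * (1 / 2) ^ N"
        "\<bar>Jz (- int N) x * Jz (- int N + b - 1) x\<bar> \<le> C\<^sup>2 * (1 / 2) ^ N"
        "\<bar>Jz (int N + 1 - 1) x * Jz (int N + 1 + b) x\<bar> \<le> C\<^sup>2 * (1 / 2) ^ N"
        "\<bar>Jz (int N + 1) x * Jz (int N + 1 + b - 1) x\<bar> \<le> C\<^sup>2 * (1 / 2) ^ N"
        using \<open>x \<in> {0..r}\<close> by (auto intro!: JJ simp del: Jz_int Jz_minus_int)
      from JJN show "norm ((?G x (- int N) - ?G x (int N + 1)) / 2)
        \<le> 2 * C\<^sup>2 * (1 / 2) ^ N"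
        unfolding real_norm_def mult.assoc by (rule abs_half_le)
    qed (use assms in auto)
    then show ?thesis using assms by (simp add: J_corr_0 mult_ac)
  qed
  have "(\<lambda>N. 2 * C\<^sup>2 * r * (1 / 2) ^ N) \<longlonglongrightarrow> 2 * C\<^sup>2 * r * 0"
    by (intro tendsto_mult_left LIMSEQ_power_zero) simp
  then have lim: "(\<lambda>N. 2 * C\<^sup>2 * r * (1 / 2) ^ N) \<longlonglongrightarrow> 0"
    by (simp only: mult_zero_right)
  have "(\<lambda>N. J_corr N b r - (if b = 0 then 1 else 0)) \<longlonglongrightarrow> 0"
  proof (rule Lim_null_comparison[OF _ lim])
    show "\<forall>\<^sub>F N in sequentially. norm (J_corr N b r - (if b = 0 then 1 else 0)) \<le> 2 * C\<^sup>2 * r * (1 / 2) ^ N"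
      unfolding real_norm_def by (rule always_eventually, rule allI, rule bound)
  qed
  then show ?thesis by (simp only: LIM_zero_iff)
qed

lemma summable_on_int_poly_geometric:
  "(\<lambda>l::int. \<bar>of_int l\<bar> ^ k * (1 / 2 :: real) ^ nat \<bar>l\<bar>) summable_on UNIV"
proof -
  let ?f = "\<lambda>l::int. \<bar>of_int l\<bar> ^ k * (1 / 2 :: real) ^ nat \<bar>l\<bar>"
  have "summable (\<lambda>n. real n ^ k * (1 / 2) ^ n)"
  proof (rule root_test_convergence)
    have "eventually (\<lambda>n. root n (real n) ^ k * (1 / 2) = root n (norm (real n ^ k * (1 / 2) ^ n))) sequentially"
      using eventually_gt_at_top[of 0]
      by eventually_elim (simp add: real_root_mult real_root_power[symmetric] real_root_power_cancel)
    moreover have "(\<lambda>n. root n (real n) ^ k * (1 / 2)) \<longlonglongrightarrow> 1 ^ k * (1 / 2)"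
      by (intro tendsto_intros LIMSEQ_root)
    ultimately show "(\<lambda>n. root n (norm (real n ^ k * (1 / 2) ^ n))) \<longlonglongrightarrow> 1 ^ k * (1 / 2)"
      by (rule Lim_transform_eventually[rotated])
  qed simp
  then have nat: "(\<lambda>n. real n ^ k * (1 / 2) ^ n) summable_on UNIV"
    by (subst summable_on_UNIV_nonneg_real_iff) auto
  have "(?f \<circ> int) summable_on UNIV" "(?f \<circ> (\<lambda>n. - int n)) summable_on UNIV"
    using nat by (simp_all add: o_def)
  then have "?f summable_on range int" "?f summable_on range (\<lambda>n. - int n)"
    by (simp_all add: summable_on_reindex inj_on_def)
  then have "?f summable_on (range int \<union> range (\<lambda>n. - int n))"
    by (rule summable_on_union)
  moreover have "range int \<union> range (\<lambda>n. - int n) = UNIV"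
  proof -
    have "x \<in> range int \<union> range (\<lambda>n. - int n)" for x
      by (cases x rule: int_cases2) auto
    then show ?thesis by blast
  qed
  ultimately show ?thesis by simp
qed

lemma Jz_summable:
  "(\<lambda>l::int. of_int l ^ k * (Jz l r * Jz (l + b) r)) summable_on UNIV"
proof -
  define C where "C = exp (\<bar>r\<bar> + r\<^sup>2 / 4)"
  have C: "C > 0" by (simp add: C_def)
  have b: "\<bar>Jz m r\<bar> \<le> C * (1 / 2) ^ nat \<bar>m\<bar>" for m
    using Jz_bound[of r "\<bar>r\<bar>" m] by (simp add: C_def)
  have b1: "\<bar>Jz m r\<bar> \<le> C" for m
  proof -
    have "(1 / 2 :: real) ^ nat \<bar>m\<bar> \<le> 1" by (simp add: power_le_one)
    from mult_left_mono[OF this, of C] show ?thesis using b[of m] C by linarith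
  qed
  have "(\<lambda>l::int. C\<^sup>2 * (\<bar>of_int l\<bar> ^ k * (1 / 2 :: real) ^ nat \<bar>l\<bar>)) summable_on UNIV"
    by (intro summable_on_cmult_right summable_on_int_poly_geometric)
  then have "(\<lambda>l::int. norm (of_int l ^ k * (Jz l r * Jz (l + b) r))) summable_on UNIV"
  proof (rule summable_on_comparison_test)
    fix l :: int
    have "\<bar>Jz l r\<bar> * \<bar>Jz (l + b) r\<bar> \<le> (C * (1 / 2) ^ nat \<bar>l\<bar>) * C"
      using C by (intro mult_mono b b1) auto
    then have "\<bar>of_int l :: real\<bar> ^ k * (\<bar>Jz l r\<bar> * \<bar>Jz (l + b) r\<bar>)
        \<le> \<bar>of_int l\<bar> ^ k * ((C * (1 / 2) ^ nat \<bar>l\<bar>) * C)"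
      by (intro mult_left_mono) auto
    then show "norm (of_int l ^ k * (Jz l r * Jz (l + b) r))
        \<le> C\<^sup>2 * (\<bar>of_int l\<bar> ^ k * (1 / 2) ^ nat \<bar>l\<bar>)"
      by (simp add: abs_mult power_abs power2_eq_square mult_ac)
  qed auto
  then show ?thesis
    by (rule abs_summable_summable)
qed

text \<open>
  Since \<open>l * J (l + b)\<close> is, up to lower order, \<open>r / 2\<close> times the sum of the two neighbours of \<open>J (l + b)\<close>, a
  factor \<open>l / r\<close> acts on these correlations as one step of the simple random walk acts on the
  displacement \<open>b\<close>. Together with the orthonormality this determines all limits.
\<close>

definition J_moment :: "nat \<Rightarrow> int \<Rightarrow> real \<Rightarrow> real" where
  "J_moment k b r = (\<Sum>\<^sub>\<infinity>l::int. of_int l ^ k * (Jz l r * Jz (l + b) r))"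

lemma filterlim_int_intervals: "filterlim (\<lambda>N. {- int N..int N}) (finite_subsets_at_top UNIV) sequentially"
proof (subst filterlim_iff, intro allI impI)
  fix P assume "eventually P (finite_subsets_at_top (UNIV :: int set))"
  then obtain X where X: "finite X" "\<And>Y. finite Y \<Longrightarrow> X \<subseteq> Y \<Longrightarrow> P Y"
    by (auto simp: eventually_finite_subsets_at_top)
  have "finite ((\<lambda>x. nat \<bar>x\<bar>) ` X)" using X(1) by simp
  then obtain K where K: "\<And>x. x \<in> X \<Longrightarrow> nat \<bar>x\<bar> \<le> K"
    by (metis finite_nat_set_iff_bounded_le imageI)
  show "\<forall>\<^sub>F N in sequentially. P {- int N..int N}"
  proof (rule eventually_sequentiallyI[of K])
    fix N assume "K \<le> N"
    then have "X \<subseteq> {- int N..int N}" using K by fastforce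
    then show "P {- int N..int N}" by (intro X(2)) auto
  qed
qed

lemma J_moment_0:
  assumes "r \<ge> 0"
  shows "J_moment 0 b r = (if b = 0 then 1 else 0)"
proof -
  have "((\<lambda>l. Jz l r * Jz (l + b) r) has_sum J_moment 0 b r) UNIV"
    using has_sum_infsum[OF Jz_summable[of 0 r b]] by (simp add: J_moment_def)
  then have "(sum (\<lambda>l. Jz l r * Jz (l + b) r) \<longlongrightarrow> J_moment 0 b r) (finite_subsets_at_top UNIV)"
    by (simp add: has_sum_def)
  from filterlim_compose[OF this filterlim_int_intervals]
  have "(\<lambda>N. J_corr N b r) \<longlonglongrightarrow> J_moment 0 b r"
    by (simp add: J_corr_def)
  with J_corr_tendsto[OF assms] show ?thesis
    using LIMSEQ_unique by blast
qed

lemma J_moment_Suc: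
  "2 * J_moment (Suc k) b r
     = r * (J_moment k (b - 1) r + J_moment k (b + 1) r) - 2 * of_int b * J_moment k b r"
proof -
  let ?T = "\<lambda>k b (l::int). of_int l ^ k * (Jz l r * Jz (l + b) r)"
  have s: "(?T k b has_sum J_moment k b r) UNIV" for k b
    unfolding J_moment_def by (rule has_sum_infsum[OF Jz_summable])
  have "((\<lambda>l::int. r * (?T k (b - 1) l
        + ?T k (b + 1) l)
        + (- 2 * of_int b) * ?T k b l) has_sum
      r * (J_moment k (b - 1) r + J_moment k (b + 1) r) + (- 2 * of_int b) * J_moment k b r) UNIV"
    by (intro has_sum_cmult_right has_sum_add s)
  also have "(\<lambda>l::int. r * (?T k (b - 1) l
        + ?T k (b + 1) l)
        + (- 2 * of_int b) * ?T k b l)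
      = (\<lambda>l. 2 * ?T (Suc k) b l)"
  proof
    fix l :: int
    have "r * (?T k (b - 1) l
        + ?T k (b + 1) l)
      = of_int l ^ k * Jz l r * (r * (Jz (l + b - 1) r + Jz (l + b + 1) r))"
      by (simp add: algebra_simps)
    also have "\<dots> = of_int l ^ k * Jz l r * (2 * of_int (l + b) * Jz (l + b) r)"
      unfolding Jz_recurrence ..
    finally show "r * (?T k (b - 1) l
        + ?T k (b + 1) l)
        + (- 2 * of_int b) * ?T k b l
      = 2 * ?T (Suc k) b l"
      by (simp add: algebra_simps)
  qed
  finally show ?thesis
    using has_sum_unique[OF has_sum_cmult_right[OF s[of "Suc k" b], of 2]] by simp
qed

fun walk_prob :: "nat \<Rightarrow> int \<Rightarrow> real" where
  "walk_prob 0 b = (if b = 0 then 1 else 0)"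
| "walk_prob (Suc k) b = (walk_prob k (b - 1) + walk_prob k (b + 1)) / 2"

lemma walk_prob_outside: "b < - int k \<Longrightarrow> walk_prob k b = 0"
  by (induction k arbitrary: b) auto

lemma walk_prob_binomial: "walk_prob k (2 * int j - int k) = real (k choose j) / 2 ^ k"
proof (induction k arbitrary: j)
  case 0
  then show ?case by (cases j) auto
next
  case (Suc k)
  show ?case
  proof (cases j)
    case 0
    have "walk_prob k (- 2 - int k) = 0" by (rule walk_prob_outside) simp
    then show ?thesis using Suc[of 0] 0 by simp
  next
    case (Suc i)
    have "2 * int j - int (Suc k) - 1 = 2 * int i - int k" "2 * int j - int (Suc k) + 1 = 2 * int j - int k"
      using Suc by auto
    then have "walk_prob (Suc k) (2 * int j - int (Suc k))
        = (walk_prob k (2 * int i - int k) + walk_prob k (2 * int j - int k)) / 2"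
      by (simp only: walk_prob.simps)
    also have "\<dots> = (real (k choose i) + real (k choose j)) / 2 ^ Suc k"
      unfolding Suc.IH by (simp add: add_divide_distrib)
    finally show ?thesis by (simp only: Suc binomial_Suc_Suc of_nat_add)
  qed
qed

lemma J_moment_tendsto:
  "((\<lambda>r. J_moment k b r / r ^ k) \<longlongrightarrow> walk_prob k b) at_top"
proof (induction k arbitrary: b)
  case 0
  have "eventually (\<lambda>r. walk_prob 0 b = J_moment 0 b r / r ^ 0) at_top"
    using eventually_ge_at_top[of 0] by eventually_elim (simp add: J_moment_0)
  then show ?case by (rule Lim_transform_eventually[rotated]) simp
next
  case (Suc k)
  let ?d = "\<lambda>r. (J_moment k (b - 1) r / r ^ k + J_moment k (b + 1) r / r ^ k) / 2
        - of_int b / r * (J_moment k b r / r ^ k)"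
  have "((\<lambda>r. ?d r) \<longlongrightarrow>
      (walk_prob k (b - 1) + walk_prob k (b + 1)) / 2 - 0 * walk_prob k b) at_top"
    by (intro tendsto_intros Suc tendsto_divide_0[OF tendsto_const] filterlim_at_top_imp_at_infinity filterlim_ident) auto
  then have "((\<lambda>r. ?d r) \<longlongrightarrow> walk_prob (Suc k) b) at_top" by simp
  moreover have "eventually (\<lambda>r. ?d r = J_moment (Suc k) b r / r ^ Suc k) at_top"
    using eventually_gt_at_top[of 0]
  proof eventually_elim
    case (elim r)
    have eq: "J_moment (Suc k) b r = (r * (J_moment k (b - 1) r + J_moment k (b + 1) r) - 2 * of_int b * J_moment k b r) / 2"
      using J_moment_Suc[of k b r] by simp
    have alg: "(a / p + c / p) / 2 - of_int b / r * (m / p) = (r * (a + c) - 2 * of_int b * m) / 2 / (r * p)"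
      if "p > 0" for a c m p :: real
      using elim that by (simp add: field_simps)
    show ?case
      unfolding alg[OF zero_less_power[OF elim]] power_Suc eq ..
  qed
  ultimately show ?case by (rule Lim_transform_eventually)
qed

text \<open>
  Even moments with \<open>b = 0\<close> are symmetric in \<open>l\<close>, so they reduce to the positive half-line. The factor
  \<open>0 ^ k\<close> keeps the term \<open>l = 0\<close> for the total mass \<open>k = 0\<close> only.
\<close>

lemma J_even_moment_split:
  shows "summable (\<lambda>n. real (Suc n) ^ (2 * k) * (J (Suc n) r)\<^sup>2)"
    and "J_moment (2 * k) 0 r
      = 0 ^ k * (J 0 r)\<^sup>2 + 2 * (\<Sum>n. real (Suc n) ^ (2 * k) * (J (Suc n) r)\<^sup>2)"
proof -
  let ?f = "\<lambda>l::int. of_int l ^ (2 * k) * (Jz l r * Jz (l + 0) r)"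
  let ?g = "\<lambda>n. real (Suc n) ^ (2 * k) * (J (Suc n) r)\<^sup>2"
  let ?A = "range (\<lambda>n. int (Suc n))" and ?B = "range (\<lambda>n. - int (Suc n))"
  have sf: "?f summable_on X" for X
    using Jz_summable[of "2 * k" r 0] by (rule summable_on_subset) simp
  have g1: "?f \<circ> (\<lambda>n. int (Suc n)) = ?g"
    by (rule ext) (simp only: o_def add_0_right Jz_int power2_eq_square of_int_of_nat_eq)
  have g2: "?f \<circ> (\<lambda>n. - int (Suc n)) = ?g"
    by (rule ext) (simp add: o_def power2_eq_square Jz_minus_int[of "Suc _", simplified] del: of_nat_Suc)
  have sg: "?g summable_on UNIV"
  proof -
    have "inj_on (\<lambda>n. int (Suc n)) UNIV" by (simp add: inj_on_def)
    from summable_on_reindex[OF this, of ?f] show ?thesis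
      using sf[of ?A] unfolding g1 by blast
  qed
  then have hg: "(?g has_sum infsum ?g UNIV) UNIV" by simp
  then have sums: "?g sums infsum ?g UNIV" by (rule has_sum_imp_sums)
  then show "summable ?g" by (rule sums_summable)
  have iA: "infsum ?f ?A = suminf ?g"
    using infsum_reindex[of "\<lambda>n. int (Suc n)" UNIV ?f] sums_unique[OF sums] unfolding g1 by (auto simp: inj_on_def)
  have iB: "infsum ?f ?B = suminf ?g"
    using infsum_reindex[of "\<lambda>n. - int (Suc n)" UNIV ?f] sums_unique[OF sums] unfolding g2 by (auto simp: inj_on_def)
  have U: "UNIV = insert 0 (?A \<union> ?B)"
  proof -
    have "x \<in> insert 0 (?A \<union> ?B)" for x
      by (cases x rule: int_sign_cases) (auto simp: image_iff add.commute)
    then show ?thesis by blast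
  qed
  have "infsum ?f UNIV = infsum ?f ({0} \<union> (?A \<union> ?B))" using U by simp
  also have "\<dots> = infsum ?f {0} + infsum ?f (?A \<union> ?B)"
    by (rule infsum_Un_disjoint, rule sf, rule sf, auto)
  also have "infsum ?f (?A \<union> ?B) = infsum ?f ?A + infsum ?f ?B"
    by (rule infsum_Un_disjoint, rule sf, rule sf, auto)
  finally show "J_moment (2 * k) 0 r = 0 ^ k * (J 0 r)\<^sup>2 + 2 * suminf ?g"
    unfolding J_moment_def iA iB
    using Jz_0_shifts(2)[of r] by (simp add: power2_eq_square power_mult)
qed

section \<open>Limit moments, the energy bound and a priori estimates\<close>

lemma J_0_1_sq_le:
  assumes "r \<ge> 1"
  shows "(J 0 r)\<^sup>2 + (J 1 r)\<^sup>2 \<le> 18 / r"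
proof -
  have "17 / sqrt r \<le> 17" using assms by (simp add: field_simps)
  moreover have "2 / pi \<le> 1" using pi_ge_two by simp
  ultimately have "r * ((J 0 r)\<^sup>2 + (J 1 r)\<^sup>2) \<le> 18"
    using J_01_asymp(3)[OF assms] by linarith
  then show ?thesis using assms by (simp add: field_simps)
qed

lemma J_tendsto_0: "(J n \<longlongrightarrow> 0) at_top"
proof (induction n rule: induct_nat_012)
  have sq: "((\<lambda>r. (J 0 r)\<^sup>2 + (J 1 r)\<^sup>2) \<longlongrightarrow> 0) at_top"
  proof (rule Lim_null_comparison[of _ "\<lambda>r. 18 / r"])
    show "\<forall>\<^sub>F r in at_top. norm ((J 0 r)\<^sup>2 + (J 1 r)\<^sup>2) \<le> 18 / r"
      using eventually_ge_at_top[of 1] by eventually_elim (use J_0_1_sq_le in simp)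
    show "((\<lambda>r::real. 18 / r) \<longlongrightarrow> 0) at_top"
      by (intro tendsto_divide_0[OF tendsto_const] filterlim_at_top_imp_at_infinity filterlim_ident)
  qed
  have lim: "(f \<longlongrightarrow> 0) at_top" if "\<And>r. (f r)\<^sup>2 \<le> (J 0 r)\<^sup>2 + (J 1 r)\<^sup>2" for f :: "real \<Rightarrow> real"
  proof -
    have "((\<lambda>r. (f r)\<^sup>2) \<longlongrightarrow> 0) at_top"
      by (rule Lim_null_comparison[OF _ sq]) (use that in auto)
    then show ?thesis by simp
  qed
  show "(J 0 \<longlongrightarrow> 0) at_top" "(J (Suc 0) \<longlongrightarrow> 0) at_top" by (auto intro!: lim)
next
  case (ge2 n)
  have "((\<lambda>r. 2 * real (n + 1) / r * J (Suc n) r - J n r) \<longlongrightarrow> 0 * 0 - 0) at_top"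
    by (intro tendsto_intros ge2 tendsto_divide_0[OF tendsto_const] filterlim_at_top_imp_at_infinity filterlim_ident)
  moreover have "\<forall>\<^sub>F r in at_top. 2 * real (n + 1) / r * J (Suc n) r - J n r = J (Suc (Suc n)) r"
    using eventually_gt_at_top[of 0]
  proof eventually_elim
    case (elim r)
    then show ?case using J_recurrence[of r n] by (simp add: field_simps)
  qed
  ultimately show ?case by (simp add: Lim_transform_eventually)
qed

text \<open>
  The even moments of the measure that gives mass \<open>(J l r)\<^sup>2\<close> to the point \<open>l / r\<close>, \<open>l \<ge> 1\<close>. By
  the method of moments this measure converges to one half of the arcsine law. The bound by 1 also
  controls the tails \<open>l > r\<close>, as it holds for every \<open>k\<close>.
\<close>

definition J_mass :: "nat \<Rightarrow> real \<Rightarrow> real" where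
  "J_mass k r = (\<Sum>n. (real (Suc n) / r) ^ (2 * k) * (J (Suc n) r)\<^sup>2)"

lemma J_mass_summable: "summable (\<lambda>n. (real (Suc n) / r) ^ (2 * k) * (J (Suc n) r)\<^sup>2)"
  using summable_divide[OF J_even_moment_split(1)[of k r], of "r ^ (2 * k)"]
  by (simp add: power_divide)

lemma J_mass_tendsto: "(J_mass k \<longlongrightarrow> real (2 * k choose k) / 4 ^ k / 2) at_top"
proof -
  have w: "walk_prob (2 * k) 0 = real (2 * k choose k) / 4 ^ k"
    using walk_prob_binomial[of "2 * k" k] by (simp add: power_mult)
  have "((\<lambda>r. 0 ^ k * (J 0 r)\<^sup>2 / r ^ (2 * k)) \<longlongrightarrow> 0) at_top"
    using tendsto_power[OF J_tendsto_0[of 0], of 2] by (cases k) auto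
  from tendsto_diff[OF J_moment_tendsto[of "2 * k" 0] this]
  have "((\<lambda>r. (J_moment (2 * k) 0 r / r ^ (2 * k) - 0 ^ k * (J 0 r)\<^sup>2 / r ^ (2 * k)) / 2)
     \<longlongrightarrow> real (2 * k choose k) / 4 ^ k / 2) at_top"
    unfolding w by (intro tendsto_divide) auto
  also have "(\<lambda>r. (J_moment (2 * k) 0 r / r ^ (2 * k) - 0 ^ k * (J 0 r)\<^sup>2 / r ^ (2 * k)) / 2) = J_mass k"
  proof
    fix r
    have "J_mass k r = (\<Sum>n. real (Suc n) ^ (2 * k) * (J (Suc n) r)\<^sup>2 / r ^ (2 * k))"
      by (simp add: J_mass_def power_divide)
    also have "\<dots> = (\<Sum>n. real (Suc n) ^ (2 * k) * (J (Suc n) r)\<^sup>2) / r ^ (2 * k)"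
      by (rule suminf_divide[OF J_even_moment_split(1)])
    finally show "(J_moment (2 * k) 0 r / r ^ (2 * k) - 0 ^ k * (J 0 r)\<^sup>2 / r ^ (2 * k)) / 2 = J_mass k r"
      by (simp only: J_even_moment_split(2)) (simp add: add_divide_distrib)
  qed
  finally show ?thesis .
qed

lemma J_mass_le_1: "\<forall>\<^sub>F r in at_top. J_mass k r \<le> 1"
proof -
  have "real (2 * k choose k) \<le> real (2 ^ (2 * k))"
    by (simp only: of_nat_le_iff binomial_le_pow2)
  also have "\<dots> = 4 ^ k" by (simp add: power_mult)
  finally have "real (2 * k choose k) / 4 ^ k \<le> 1" by simp
  moreover have "x / 2 < 1" if "x \<le> 1" for x :: real using that by simp
  ultimately have "real (2 * k choose k) / 4 ^ k / 2 < 1" by blast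
  from order_tendstoD(2)[OF J_mass_tendsto this] show ?thesis
    by eventually_elim simp
qed

text \<open>
  The recurrence \<open>J (l+1) = 2 (l/r) J l - J (l-1)\<close> with the coefficient \<open>l / r\<close> frozen is a rotation,
  and this quadratic form is its invariant. The coefficient moves by only \<open>1 / r\<close> per
  step, so over the \<open>r / 2\<close> steps where the form stays uniformly definite the energy changes by at most a
  constant factor.
\<close>

definition J_energy :: "nat \<Rightarrow> real \<Rightarrow> real" where
  "J_energy l r = (J l r)\<^sup>2 + (J (Suc l) r)\<^sup>2
     - 2 * (real l / r) * (J l r * J (Suc l) r)"

lemma J_energy_Suc:
  assumes "r > 0"
  shows "J_energy (Suc l) r = J_energy l r - 2 / r * (J l r * J (Suc l) r)"
proof -
  have inv: "y\<^sup>2 + z\<^sup>2 - 2 * a * (y * z) = x\<^sup>2 + y\<^sup>2 - 2 * a * (x * y)"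
    if "z = 2 * a * y - x" for a x y z :: real
    unfolding that by (simp add: power2_eq_square algebra_simps)
  have "J (Suc (Suc l)) r = 2 * (real (Suc l) / r) * J (Suc l) r - J l r"
    using J_recurrence[of r l] assms by (simp add: field_simps)
  from inv[OF this]
  have "J_energy (Suc l) r = (J l r)\<^sup>2 + (J (Suc l) r)\<^sup>2
      - 2 * (real (Suc l) / r) * (J l r * J (Suc l) r)"
    by (simp only: J_energy_def)
  also have "2 * (real (Suc l) / r) = 2 * (real l / r) + 2 / r"
    by (simp add: add_divide_distrib)
  finally show ?thesis
    unfolding J_energy_def by (simp only: distrib_right diff_diff_add)
qed

lemma J_energy_lower:
  assumes "r > 0" "real l \<le> r / 2"
  shows "((J l r)\<^sup>2 + (J (Suc l) r)\<^sup>2) / 2 \<le> J_energy l r"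
proof -
  let ?x = "J l r" and ?y = "J (Suc l) r"
  have "2 * (real l / r) \<le> 1" using assms by (simp add: field_simps)
  have "2 * (real l / r) * (?x * ?y) \<le> 2 * (real l / r) * \<bar>?x * ?y\<bar>"
    using assms by (intro mult_left_mono) auto
  also have "\<dots> \<le> 1 * \<bar>?x * ?y\<bar>"
    by (intro mult_right_mono) (fact, simp)
  also have "\<dots> \<le> (?x\<^sup>2 + ?y\<^sup>2) / 2"
    using sum_squares_bound[of "\<bar>?x\<bar>" "\<bar>?y\<bar>"] by (simp add: abs_mult)
  finally show ?thesis by (simp add: J_energy_def)
qed

lemma J_mult_le: "\<bar>J a r * J b r\<bar> \<le> ((J a r)\<^sup>2 + (J b r)\<^sup>2) / 2"
  using sum_squares_bound[of "\<bar>J a r\<bar>" "\<bar>J b r\<bar>"] by (simp add: abs_mult)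

lemma J_energy_upper:
  assumes "r > 0" "real l \<le> r / 2"
  shows "J_energy l r \<le> exp (2 * real l / r) * J_energy 0 r"
  using assms(2)
proof (induction l)
  case (Suc l)
  then have l: "real l \<le> r / 2" by simp
  have E0: "0 \<le> J_energy l r"
    by (rule order_trans[OF _ J_energy_lower[OF assms(1) l]]) simp
  have "J_energy (Suc l) r \<le> J_energy l r + 2 / r * \<bar>J l r * J (Suc l) r\<bar>"
    unfolding J_energy_Suc[OF assms(1)]
    using mult_left_mono[OF abs_ge_minus_self[of "J l r * J (Suc l) r"], of "2 / r"] assms(1)
    by simp
  also have "\<dots> \<le> J_energy l r + 2 / r * J_energy l r"
    using order_trans[OF J_mult_le[of l r "Suc l"] J_energy_lower[OF assms(1) l]] assms(1)
    by (intro add_left_mono mult_left_mono) auto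
  also have "\<dots> = (1 + 2 / r) * J_energy l r" by (simp add: algebra_simps)
  also have "\<dots> \<le> exp (2 / r) * J_energy l r"
    using E0 by (intro mult_right_mono exp_ge_add_one_self)
  also have "\<dots> \<le> exp (2 / r) * (exp (2 * real l / r) * J_energy 0 r)"
    by (intro mult_left_mono Suc.IH l) auto
  also have "\<dots> = exp (2 / r + 2 * real l / r) * J_energy 0 r" by (simp add: exp_add)
  also have "2 / r + 2 * real l / r = 2 * real (Suc l) / r"
    by (simp add: add_divide_distrib[symmetric] algebra_simps)
  finally show ?case .
qed simp

text \<open>
  The energy at \<open>l = 0\<close> is \<open>(J 0)\<^sup>2 + (J 1)\<^sup>2\<close>, of order \<open>1 / r\<close> by the Fresnel asymptotics, and it
  dominates all later ones up to \<open>l = r / 2\<close>.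
\<close>

lemma J_sq_bound:
  assumes "r \<ge> 1" "real l \<le> r / 2"
  shows "(J l r)\<^sup>2 \<le> 108 / r"
proof -
  have r: "r > 0" using assms by simp
  have "(J l r)\<^sup>2 \<le> 2 * J_energy l r"
    using J_energy_lower[OF r assms(2)] zero_le_power2[of "J (Suc l) r"] by argo
  also have "\<dots> \<le> 2 * (exp (2 * real l / r) * J_energy 0 r)"
    using J_energy_upper[OF r assms(2)] by simp
  also have "exp (2 * real l / r) * J_energy 0 r \<le> 3 * (18 / r)"
  proof (intro mult_mono)
    show "J_energy 0 r \<le> 18 / r" "0 \<le> J_energy 0 r"
      using J_0_1_sq_le[OF assms(1)] by (simp_all add: J_energy_def)
    have "exp (2 * real l / r) \<le> exp 1" using assms by (simp add: field_simps)
    also have "exp (1::real) \<le> 3" by (rule exp_le)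
    finally show "exp (2 * real l / r) \<le> 3" .
  qed simp
  finally show ?thesis by simp
qed

lemma J_mult_bound:
  assumes "r \<ge> 1" "real a \<le> r / 2" "real b \<le> r / 2"
  shows "\<bar>J a r * J b r\<bar> \<le> 108 / r"
proof -
  have "((J a r)\<^sup>2 + (J b r)\<^sup>2) / 2 \<le> (108 / r + 108 / r) / 2"
    using assms by (intro divide_right_mono add_mono J_sq_bound) auto
  with J_mult_le[of a r b] have "\<bar>J a r * J b r\<bar> \<le> (108 / r + 108 / r) / 2"
    by (rule order_trans)
  then show ?thesis by simp
qed

text \<open>
  For \<open>s > 0\<close>, concavity of \<open>x powr (1 - 2 s)\<close>, in the form of Young's inequality, bounds each term by a
  multiple of the increment of that function, and the sum telescopes.
\<close>

lemma sum_powr_le: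
  assumes "s < 1 / 2"
  obtains C where "C > 0" "\<And>N. (\<Sum>n<N. weight s n) \<le> C * real N powr (1 - 2 * s)"
proof (cases "s \<le> 0")
  case True
  have "(\<Sum>n<N. weight s n) \<le> 1 * real N powr (1 - 2 * s)" for N
  proof -
    have "(\<Sum>n<N. weight s n) \<le> (\<Sum>n<N. real N powr (- 2 * s))"
      using True by (intro sum_mono powr_mono2) auto
    also have "\<dots> = real N powr (1 - 2 * s)"
      by (cases "N = 0") (simp_all add: powr_diff powr_minus field_simps)
    finally show ?thesis by simp
  qed
  then show ?thesis using that[of 1] by simp
next
  case False
  define p where "p = 1 - 2 * s"
  have p: "0 < p" "p < 1" using False assms by (simp_all add: p_def)
  have step: "p * weight s n \<le> real (Suc n) powr p - real n powr p" for n
  proof (cases "n = 0")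
    case False
    have "real n powr p * real (Suc n) powr (1 - p) \<le> p * real n + (1 - p) * real (Suc n)"
      using False p by (intro Youngs_inequality_0) auto
    also have "\<dots> = real (Suc n) - p" by (simp add: algebra_simps)
    finally have "real n powr p * real (Suc n) powr (1 - p) * real (Suc n) powr (p - 1)
        \<le> (real (Suc n) - p) * real (Suc n) powr (p - 1)"
      by (rule mult_right_mono) simp
    moreover have "real n powr p * real (Suc n) powr (1 - p) * real (Suc n) powr (p - 1) = real n powr p"
      by (simp add: mult.assoc powr_add[symmetric])
    moreover have "real (Suc n) * real (Suc n) powr (p - 1) = real (Suc n) powr p"
      by (simp add: powr_diff)
    moreover have "p - 1 = - 2 * s" by (simp add: p_def)
    ultimately show ?thesis by (simp only: left_diff_distrib)
  qed (use p in simp)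
  have "(\<Sum>n<N. weight s n) \<le> 1 / p * real N powr p" for N
  proof -
    have "p * (\<Sum>n<N. weight s n) \<le> (\<Sum>n<N. real (Suc n) powr p - real n powr p)"
      unfolding sum_distrib_left by (intro sum_mono step)
    also have "\<dots> = real N powr p"
      using p by (subst sum_lessThan_telescope[of "\<lambda>n. real n powr p"]) simp
    finally show ?thesis using p by (simp add: field_simps)
  qed
  then show ?thesis using that[of "1 / p"] p by (simp add: p_def)
qed

text \<open>
  The pointwise bound serves for \<open>l \<le> r / 4\<close>, and for \<open>l > r / 4\<close> the weight is traded for an even moment:
  there \<open>l powr (- 2 s)\<close> is at most a constant times \<open>r powr (- 2 s) * (l / r) ^ (2 K)\<close>. The threshold
  \<open>r / 4\<close> leaves room for the shift by \<open>m\<close> below \<open>r / 2\<close>.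
\<close>

lemma bessel_sum_term_bound:
  assumes K: "real K \<ge> \<bar>s\<bar>" and r: "r \<ge> 1" "r \<ge> 4 * real m"
  shows "weight s n * (J (Suc n + m) r)\<^sup>2
    \<le> 108 / r * (if n < nat \<lfloor>r / 4\<rfloor> then weight s n else 0)
      + 4 ^ (4 * K) * r powr (- 2 * s) * ((real (Suc n + m) / r) ^ (2 * K) * (J (Suc n + m) r)\<^sup>2)"
proof (cases "n < nat \<lfloor>r / 4\<rfloor>")
  case True
  then have "real (Suc n) \<le> r / 4" by linarith
  then have "real (Suc n + m) \<le> r / 2" using r by simp
  from mult_left_mono[OF J_sq_bound[OF r(1) this], of "weight s n"]
  have "weight s n * (J (Suc n + m) r)\<^sup>2 \<le> 108 / r * weight s n"
    by (simp add: mult.commute)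
  moreover have "0 \<le> 4 ^ (4 * K) * r powr (- 2 * s) * ((real (Suc n + m) / r) ^ (2 * K) * (J (Suc n + m) r)\<^sup>2)"
    by (intro mult_nonneg_nonneg) simp_all
  ultimately show ?thesis unfolding if_P[OF True] by linarith
next
  case False
  define x where "x = real (Suc n) / r"
  have r0: "r > 0" using r by simp
  have "\<lfloor>r / 4\<rfloor> \<le> int n" using False by linarith
  then have "r / 4 \<le> real (Suc n)" by linarith
  then have x: "1 / 4 \<le> x" "x > 0" using r0 by (simp_all add: x_def field_simps)
  have quarter: "(1 / 4 :: real) powr (- z) = 4 powr z" for z
    by (simp add: powr_divide powr_minus)
  have "x powr (- 2 * s) = x powr (2 * K) * x powr (- (2 * K + 2 * s))"
    using x by (simp add: powr_add[symmetric])
  also have "x powr (- (2 * K + 2 * s)) \<le> (1 / 4) powr (- (2 * K + 2 * s))"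
    using x K by (intro powr_mono2') auto
  also have "(1 / 4) powr (- (2 * K + 2 * s)) = (4::real) powr (2 * K + 2 * s)"
    using quarter[of "2 * K + 2 * s"] by simp
  also have "\<dots> \<le> 4 powr real (4 * K)"
    using K by (intro powr_mono) auto
  also have "\<dots> = 4 ^ (4 * K)" by (rule powr_realpow) simp
  finally have "x powr (- 2 * s) \<le> x powr (2 * K) * 4 ^ (4 * K)"
    using x by (simp add: mult_left_mono)
  also have "x powr (2 * K) = x ^ (2 * K)"
    using powr_realpow[OF x(2), of "2 * K"] by simp
  also have "x ^ (2 * K) \<le> (real (Suc n + m) / r) ^ (2 * K)"
    unfolding x_def using r0 by (intro power_mono divide_right_mono) auto
  finally have "x powr (- 2 * s) \<le> (real (Suc n + m) / r) ^ (2 * K) * 4 ^ (4 * K)"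
    by (simp add: mult_right_mono)
  from mult_left_mono[OF this, of "r powr (- 2 * s)"]
  have "weight s n \<le> 4 ^ (4 * K) * r powr (- 2 * s) * (real (Suc n + m) / r) ^ (2 * K)"
    using r0 by (simp add: x_def powr_divide mult_ac)
  from mult_right_mono[OF this, of "(J (Suc n + m) r)\<^sup>2"] show ?thesis
    using False by (simp add: mult_ac)
qed

lemma bessel_sum_bound:
  "\<forall>\<^sub>F r in at_top. bessel_sum s m m r
      \<le> 108 / r * (\<Sum>n<nat \<lfloor>r / 4\<rfloor>. weight s n) + 4 ^ (4 * nat \<lceil>\<bar>s\<bar>\<rceil>) * r powr (- 2 * s)"
  using J_mass_le_1[of "nat \<lceil>\<bar>s\<bar>\<rceil>"] eventually_ge_at_top[of 1] eventually_ge_at_top[of "4 * real m"]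
proof eventually_elim
  case (elim r)
  define K where "K = nat \<lceil>\<bar>s\<bar>\<rceil>"
  have K: "real K \<ge> \<bar>s\<bar>" unfolding K_def by linarith
  let ?N = "nat \<lfloor>r / 4\<rfloor>"
  let ?g = "\<lambda>n. (real (Suc n) / r) ^ (2 * K) * (J (Suc n) r)\<^sup>2"
  let ?h = "\<lambda>n. (real (Suc n + m) / r) ^ (2 * K) * (J (Suc n + m) r)\<^sup>2"
  have f1: "(\<lambda>n. if n < ?N then weight s n else 0) sums (\<Sum>n<?N. weight s n)"
    using sums_If_finite_set[of "{..<?N}" "\<lambda>n. weight s n"] by simp
  have sg: "summable ?g" by (rule J_mass_summable)
  then have "summable (\<lambda>n. ?g (n + m))" by (rule summable_ignore_initial_segment)
  then have sg': "summable (\<lambda>n. ?h n)" by simp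
  have g0: "?g n \<ge> 0" for n
    by (intro mult_nonneg_nonneg) simp_all
  have "(\<Sum>n. ?g (n + m)) \<le> suminf ?g"
    using suminf_split_initial_segment[OF sg, of m] sum_nonneg[of "{..<m}" ?g] g0 by simp
  also have "\<dots> \<le> 1" using elim(1) by (simp add: J_mass_def K_def)
  finally have g1: "(\<Sum>n. ?h n) \<le> 1" by simp
  have "bessel_sum s m m r = (\<Sum>n. weight s n * (J (Suc n + m) r)\<^sup>2)"
    by (simp add: bessel_sum_def power2_eq_square mult.assoc)
  also have "\<dots> \<le> (\<Sum>n. 108 / r * (if n < ?N then weight s n else 0)
      + 4 ^ (4 * K) * r powr (- 2 * s) * (?h n))"
  proof (rule suminf_le)
    show "summable (\<lambda>n. weight s n * (J (Suc n + m) r)\<^sup>2)"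
      using bessel_sum_summable[of s m r m] by (simp add: power2_eq_square mult.assoc)
    show "summable (\<lambda>n. 108 / r * (if n < ?N then weight s n else 0)
      + 4 ^ (4 * K) * r powr (- 2 * s) * (?h n))"
      by (intro summable_add summable_mult sg' sums_summable[OF f1])
  qed (use bessel_sum_term_bound[OF K elim(2,3)] in blast)
  also have "\<dots> = 108 / r * (\<Sum>n<?N. weight s n)
      + 4 ^ (4 * K) * r powr (- 2 * s) * (\<Sum>n. ?h n)"
    by (intro sums_unique[symmetric] sums_add sums_mult f1 summable_sums sg')
  also have "\<dots> \<le> 108 / r * (\<Sum>n<?N. weight s n) + 4 ^ (4 * K) * r powr (- 2 * s) * 1"
    using g1 by (intro add_left_mono mult_left_mono) auto
  finally show ?case by (simp add: K_def)
qed

lemma bessel_sum_diag_O: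
  assumes "s < 1 / 2"
  shows "bessel_sum s m m \<in> O[at_top](\<lambda>r. r powr (- 2 * s))"
proof -
  obtain C where C: "C > 0" "\<And>N. (\<Sum>n<N. weight s n) \<le> C * real N powr (1 - 2 * s)"
    using sum_powr_le[OF assms] by blast
  show ?thesis
  proof (rule bigoI)
    show "\<forall>\<^sub>F r in at_top. norm (bessel_sum s m m r) \<le> (108 * C + 4 ^ (4 * nat \<lceil>\<bar>s\<bar>\<rceil>)) * norm (r powr (- 2 * s))"
      using bessel_sum_bound[of s m] eventually_ge_at_top[of 1]
    proof eventually_elim
      case (elim r)
      have "0 \<le> bessel_sum s m m r"
        unfolding bessel_sum_def using bessel_sum_summable by (rule suminf_nonneg) (simp add: mult.assoc)
      moreover have "(\<Sum>n<nat \<lfloor>r / 4\<rfloor>. weight s n) \<le> C * r powr (1 - 2 * s)"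
      proof (rule order_trans[OF C(2)])
        have "real (nat \<lfloor>r / 4\<rfloor>) \<le> r" using elim by linarith
        then show "C * real (nat \<lfloor>r / 4\<rfloor>) powr (1 - 2 * s) \<le> C * r powr (1 - 2 * s)"
          using C(1) assms by (intro mult_left_mono powr_mono2) auto
      qed
      then have "108 / r * (\<Sum>n<nat \<lfloor>r / 4\<rfloor>. weight s n) \<le> 108 / r * (C * r powr (1 - 2 * s))"
        using elim by (intro mult_left_mono) auto
      moreover have "108 / r * (C * r powr (1 - 2 * s)) = 108 * C * r powr (- 2 * s)"
        using elim by (simp add: powr_diff powr_minus field_simps)
      ultimately show ?case using elim by (simp add: distrib_right)
    qed
  qed
qed

lemma bessel_sum_diag_O_inverse:
  assumes "s > 1 / 2"
  shows "bessel_sum s m m \<in> O[at_top](\<lambda>r. 1 / r)"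
proof (rule bigoI)
  have sz: "summable (\<lambda>n. weight s n)"
    using zeta_real_summable[of "2 * s"] assms by simp
  show "\<forall>\<^sub>F r in at_top. norm (bessel_sum s m m r)
      \<le> (108 * (\<Sum>n. weight s n) + 4 ^ (4 * nat \<lceil>\<bar>s\<bar>\<rceil>)) * norm (1 / r)"
    using bessel_sum_bound[of s m] eventually_ge_at_top[of 1]
  proof eventually_elim
    case (elim r)
    have "0 \<le> bessel_sum s m m r"
      unfolding bessel_sum_def using bessel_sum_summable by (rule suminf_nonneg) (simp add: mult.assoc)
    moreover have "108 / r * (\<Sum>n<nat \<lfloor>r / 4\<rfloor>. weight s n)
        \<le> 108 / r * (\<Sum>n. weight s n)"
      using elim by (intro mult_left_mono sum_le_suminf sz) auto
    moreover have "4 ^ (4 * nat \<lceil>\<bar>s\<bar>\<rceil>) * r powr (- 2 * s) \<le> 4 ^ (4 * nat \<lceil>\<bar>s\<bar>\<rceil>) * (1 / r)"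
    proof (intro mult_left_mono)
      have "r powr (- 2 * s) \<le> r powr (- 1)"
        using elim assms by (intro powr_mono) auto
      then show "r powr (- 2 * s) \<le> 1 / r" using elim by (simp add: powr_minus_divide)
    qed simp
    ultimately show ?case using elim by (simp add: distrib_right add_divide_distrib)
  qed
qed

section \<open>The arcsine law and the diagonal sums below the critical exponent\<close>

text \<open>
  The even moments of the arcsine law in the variable \<open>u = x\<^sup>2\<close>, where it has density
  \<open>u powr (- 1/2) * (1 - u) powr (- 1/2) / \<pi>\<close>.
\<close>

lemma central_binomial_eq_Beta: "real (2 * k choose k) / 4 ^ k = Beta (real k + 1 / 2) (1 / 2) / pi"
proof (induction k)
  case 0
  show ?case by (simp add: Beta_def Gamma_one_half_real)
next
  case (Suc k)
  have "Suc k * (2 * Suc k choose Suc k) = Suc (2 * k + 1) * (2 * k + 1 choose k)"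
    using Suc_times_binomial_eq[of "2 * k + 1" k] by (simp add: mult.commute)
  also have "(2 * k + 1 choose k) = (2 * k + 1 choose Suc k)"
    using binomial_symmetric[of k "2 * k + 1"] by simp
  finally have "Suc k * (Suc k * (2 * Suc k choose Suc k)) = Suc (2 * k + 1) * (Suc k * (2 * k + 1 choose Suc k))"
    by (simp only: mult_ac)
  also have "Suc k * (2 * k + 1 choose Suc k) = (2 * k + 1) * (2 * k choose k)"
    using Suc_times_binomial_eq[of "2 * k" k] by (simp add: mult.commute)
  also have "Suc (2 * k + 1) = 2 * Suc k" by simp
  finally have "Suc k * (Suc k * (2 * Suc k choose Suc k)) = 2 * Suc k * ((2 * k + 1) * (2 * k choose k))" .
  from arg_cong[OF this, of real]
  have "real (Suc k) * (real (Suc k) * real (2 * Suc k choose Suc k))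
      = 2 * real (Suc k) * (real (2 * k + 1) * real (2 * k choose k))"
    by (simp only: of_nat_mult of_nat_numeral)
  then have "real (Suc k) * real (2 * Suc k choose Suc k) = 2 * (real (2 * k + 1) * real (2 * k choose k))"
    by (simp del: of_nat_Suc)
  then have b: "real (2 * Suc k choose Suc k) = 2 * (real (2 * k + 1) * real (2 * k choose k)) / real (Suc k)"
    by (simp add: field_simps del: of_nat_Suc)
  have "(real k + 1 / 2 + 1 / 2) * Beta (real k + 1 / 2 + 1) (1 / 2) = (real k + 1 / 2) * Beta (real k + 1 / 2) (1 / 2)"
    by (rule Beta_plus1_left) (auto elim!: nonpos_Ints_cases)
  then have "Beta (real (Suc k) + 1 / 2) (1 / 2) = (real k + 1 / 2) / real (Suc k) * Beta (real k + 1 / 2) (1 / 2)"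
    by (simp add: field_simps)
  also have "Beta (real k + 1 / 2) (1 / 2) = pi * (real (2 * k choose k) / 4 ^ k)"
    using Suc by simp
  finally have eq: "Beta (real (Suc k) + 1 / 2) (1 / 2) / pi
      = (real k + 1 / 2) / real (Suc k) * (real (2 * k choose k) / 4 ^ k)"
    by simp
  have k: "real k + 1 / 2 = real (2 * k + 1) / 2" by simp
  have "2 * (c * y) / d / (4 * z) = c / 2 / d * (y / z)" for c d y z :: real
    by simp
  then show ?case unfolding eq b k power_Suc .
qed

lemma has_integral_powr_arcsine:
  fixes s :: real
  assumes "s < 1 / 2"
  shows "((\<lambda>u. u powr (- s) * (u powr (- 1 / 2) * (1 - u) powr (- 1 / 2))) has_integral Beta (1 / 2 - s) (1 / 2)) {0..1}"
proof (rule has_integral_eq[rotated])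
  show "((\<lambda>u. u powr ((1 / 2 - s) - 1) * (1 - u) powr (1 / 2 - 1)) has_integral Beta (1 / 2 - s) (1 / 2)) {0..1}"
    using assms by (intro has_integral_Beta_real) auto
  show "u powr ((1 / 2 - s) - 1) * (1 - u) powr (1 / 2 - 1) = u powr (- s) * (u powr (- 1 / 2) * (1 - u) powr (- 1 / 2))" for u
  proof -
    have e: "(1 / 2 - s) - 1 = - s + (- 1 / 2)" by simp
    show ?thesis unfolding e powr_add by simp
  qed
qed

lemma has_integral_power_arcsine:
  "((\<lambda>u. u ^ k * (u powr (- 1 / 2) * (1 - u) powr (- 1 / 2))) has_integral pi * (real (2 * k choose k) / 4 ^ k)) {0..1}"
proof (rule has_integral_eq[rotated])
  show "((\<lambda>u. u powr (- (- real k)) * (u powr (- 1 / 2) * (1 - u) powr (- 1 / 2))) has_integral pi * (real (2 * k choose k) / 4 ^ k)) {0..1}"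
    using has_integral_powr_arcsine[of "- real k"] by (simp add: central_binomial_eq_Beta add.commute)
  show "u powr (- (- real k)) * (u powr (- 1 / 2) * (1 - u) powr (- 1 / 2))
      = u ^ k * (u powr (- 1 / 2) * (1 - u) powr (- 1 / 2))" if "u \<in> {0..1}" for u :: real
    using that by (cases "u = 0") (auto simp: powr_realpow)
qed

text \<open>
  A Weierstrass theorem on \<open>(0, \<infinity>)\<close> that absorbs both the singularity at 0 and the unbounded range. With
  \<open>\<sigma> > s\<close> the cut-off \<open>max u \<delta> powr (- s)\<close> differs from \<open>u powr (- s)\<close> by a small multiple of
  \<open>u powr (- \<sigma>)\<close>. A polynomial approximates the cut-off on \<open>[0, 4]\<close>. For \<open>u > 4\<close> everything
  grows at most like a fixed power, and a large factor \<open>u ^ j \<ge> 4 ^ j\<close> makes its constant small.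
\<close>

lemma powr_weighted_approx:
  fixes s \<sigma> \<epsilon> :: real
  assumes \<sigma>: "s < \<sigma>" "0 < \<sigma>" and \<epsilon>: "\<epsilon> > 0"
  obtains a :: "nat \<Rightarrow> real" and N M :: nat
  where "\<And>u. u > 0 \<Longrightarrow> \<bar>u powr (- s) - (\<Sum>i\<le>N. a i * u ^ i)\<bar> \<le> \<epsilon> * (u powr (- \<sigma>) + u ^ M)"
proof -
  define \<delta> where "\<delta> = (\<epsilon> / 2) powr (1 / (\<sigma> - s))"
  have \<delta>: "\<delta> > 0" "\<delta> powr (\<sigma> - s) = \<epsilon> / 2"
    using \<epsilon> \<sigma> by (simp_all add: \<delta>_def powr_powr)
  have "continuous_on {0..4} (\<lambda>u::real. max u \<delta> powr (- s))"
    using \<delta>(1) by (intro continuous_intros) auto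
  then obtain g where g: "real_polynomial_function g"
      "\<And>u. u \<in> {0..4} \<Longrightarrow> \<bar>max u \<delta> powr (- s) - g u\<bar> < \<epsilon> / 2 * 4 powr (- \<sigma>)"
    using Stone_Weierstrass_real_polynomial_function[of "{0..4::real}" "\<lambda>u. max u \<delta> powr (- s)" "\<epsilon> / 2 * 4 powr (- \<sigma>)"] \<epsilon>
    by auto
  then obtain a N where gs: "g = (\<lambda>u. \<Sum>i\<le>N. a i * u ^ i)"
    by (auto simp: real_polynomial_function_iff_sum)
  define A where "A = 1 + (\<Sum>i\<le>N. \<bar>a i\<bar>)"
  have A: "A \<ge> 1" by (simp add: A_def sum_nonneg)
  define Q where "Q = max N (nat \<lceil>\<bar>s\<bar>\<rceil>)"
  obtain j where j: "A / \<epsilon> < 4 ^ j"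
    using real_arch_pow[of 4 "A / \<epsilon>"] by auto
  have "\<bar>u powr (- s) - (\<Sum>i\<le>N. a i * u ^ i)\<bar> \<le> \<epsilon> * (u powr (- \<sigma>) + u ^ (Q + j))" if u: "u > 0" for u
  proof (cases "u \<le> 4")
    case True
    have "4 powr (- \<sigma>) \<le> u powr (- \<sigma>)" using True u \<sigma> by (intro powr_mono2') auto
    then have "\<epsilon> / 2 * 4 powr (- \<sigma>) \<le> \<epsilon> / 2 * u powr (- \<sigma>)" using \<epsilon> by (intro mult_left_mono) auto
    then have 1: "\<bar>max u \<delta> powr (- s) - g u\<bar> \<le> \<epsilon> / 2 * u powr (- \<sigma>)"
      using g(2)[of u] True u by simp
    have 2: "\<bar>u powr (- s) - max u \<delta> powr (- s)\<bar> \<le> \<epsilon> / 2 * u powr (- \<sigma>)"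
    proof (cases "u < \<delta>")
      case True
      have "u powr (- s) = u powr (\<sigma> - s) * u powr (- \<sigma>)" by (simp add: powr_add[symmetric])
      also have "\<dots> \<le> \<delta> powr (\<sigma> - s) * u powr (- \<sigma>)"
        using True u \<sigma> by (intro mult_right_mono powr_mono2) auto
      finally have a: "u powr (- s) \<le> \<epsilon> / 2 * u powr (- \<sigma>)" using \<delta>(2) by simp
      have "\<delta> powr (- s) = \<delta> powr (\<sigma> - s) * \<delta> powr (- \<sigma>)" by (simp add: powr_add[symmetric])
      also have "\<dots> \<le> \<delta> powr (\<sigma> - s) * u powr (- \<sigma>)"
        using True u \<sigma> by (intro mult_left_mono powr_mono2') auto
      finally have b: "\<delta> powr (- s) \<le> \<epsilon> / 2 * u powr (- \<sigma>)" using \<delta>(2) by simp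
      have "u powr (- s) \<ge> 0" "\<delta> powr (- s) \<ge> 0" by simp_all
      with a b have "\<bar>u powr (- s) - \<delta> powr (- s)\<bar> \<le> \<epsilon> / 2 * u powr (- \<sigma>)" by linarith
      then show ?thesis using True by (simp add: max_def)
    qed (use \<epsilon> in \<open>simp add: max_def\<close>)
    have "\<bar>u powr (- s) - g u\<bar> \<le> \<epsilon> / 2 * u powr (- \<sigma>) + \<epsilon> / 2 * u powr (- \<sigma>)"
      using 1 2 by linarith
    also have "\<dots> \<le> \<epsilon> * (u powr (- \<sigma>) + u ^ (Q + j))"
      using \<epsilon> u by (simp add: distrib_left)
    finally show ?thesis by (simp add: gs)
  next
    case False
    then have u1: "u \<ge> 1" by simp
    have "u powr (- s) \<le> u powr (real Q)"
      using u1 by (intro powr_mono) (auto simp: Q_def, linarith)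
    then have p: "u powr (- s) \<le> 1 * u ^ Q" using u by (simp add: powr_realpow)
    have "\<bar>\<Sum>i\<le>N. a i * u ^ i\<bar> \<le> (\<Sum>i\<le>N. \<bar>a i\<bar> * u ^ Q)"
    proof (intro order_trans[OF sum_abs] sum_mono)
      fix i assume "i \<in> {..N}"
      then have "u ^ i \<le> u ^ Q" using u1 by (intro power_increasing) (auto simp: Q_def)
      then show "\<bar>a i * u ^ i\<bar> \<le> \<bar>a i\<bar> * u ^ Q"
        using u by (simp add: abs_mult mult_left_mono)
    qed
    then have "\<bar>\<Sum>i\<le>N. a i * u ^ i\<bar> \<le> (\<Sum>i\<le>N. \<bar>a i\<bar>) * u ^ Q"
      by (simp add: sum_distrib_right)
    then have "\<bar>u powr (- s) - (\<Sum>i\<le>N. a i * u ^ i)\<bar> \<le> 1 * u ^ Q + (\<Sum>i\<le>N. \<bar>a i\<bar>) * u ^ Q"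
      using p powr_ge_zero[of u "- s"] by linarith
    also have "\<dots> = A * u ^ Q" by (simp add: A_def distrib_right)
    also have "\<dots> \<le> (\<epsilon> * 4 ^ j) * u ^ Q"
      using j \<epsilon> u by (intro mult_right_mono) (auto simp: field_simps)
    also have "\<dots> \<le> (\<epsilon> * u ^ j) * u ^ Q"
      using False \<epsilon> u by (intro mult_right_mono mult_left_mono power_mono) auto
    also have "\<dots> \<le> \<epsilon> * (u powr (- \<sigma>) + u ^ (Q + j))"
      using \<epsilon> by (simp add: distrib_left power_add mult_ac)
    finally show ?thesis .
  qed
  then show thesis by (rule that)
qed

lemma scaled_bessel_sum_eq:
  assumes "r > 0"
  shows "r powr (2 * s) * bessel_sum s 0 0 r = (\<Sum>n. ((real (Suc n) / r)\<^sup>2) powr (- s) * (J (Suc n) r)\<^sup>2)"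
    and "summable (\<lambda>n. ((real (Suc n) / r)\<^sup>2) powr (- s) * (J (Suc n) r)\<^sup>2)"
proof -
  let ?t = "\<lambda>n. ((real (Suc n) / r)\<^sup>2) powr (- s) * (J (Suc n) r)\<^sup>2"
  have e: "r powr (2 * s) * (weight s n * J (Suc n + 0) r * J (Suc n + 0) r)
      = ?t n" for n
  proof -
    have "((real (Suc n) / r)\<^sup>2) powr (- s) = (real (Suc n) / r) powr (2 * (- s))"
      using assms by (simp add: powr_numeral[symmetric] powr_powr del: powr_numeral of_nat_Suc)
    also have "\<dots> = weight s n * r powr (2 * s)"
      using assms by (simp add: powr_divide powr_minus_divide del: of_nat_Suc)
    finally show ?thesis by (simp add: power2_eq_square del: of_nat_Suc)
  qed
  show "summable (\<lambda>n. ?t n)"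
    using summable_mult[OF bessel_sum_summable[of s 0 r 0], of "r powr (2 * s)"] unfolding e .
  show "r powr (2 * s) * bessel_sum s 0 0 r = (\<Sum>n. ?t n)"
    unfolding bessel_sum_def suminf_mult[OF bessel_sum_summable[of s 0 r 0], symmetric] e ..
qed

text \<open>
  Legendre's duplication formula at \<open>1/2 - s\<close>.
\<close>

lemma Beta_eq_c1:
  assumes "s < 1 / 2"
  shows "Beta (1 / 2 - s) (1 / 2) / (2 * pi) = c1 s 0"
proof -
  define x where "x = 1 / 2 - s"
  have x: "x > 0" using assms by (simp add: x_def)
  have "Gamma (complex_of_real x) * Gamma (complex_of_real x + 1 / 2)
      = exp ((1 - 2 * complex_of_real x) * of_real (ln 2)) * of_real (sqrt pi) * Gamma (2 * complex_of_real x)"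
    using x by (intro Gamma_legendre_duplication) (auto elim!: nonpos_Ints_cases simp: complex_eq_iff)
  also have "complex_of_real x + 1 / 2 = of_real (x + 1 / 2)" by simp
  also have "2 * complex_of_real x = of_real (2 * x)" by simp
  also have "1 - complex_of_real (2 * x) = of_real (1 - 2 * x)" by simp
  finally have "Gamma x * Gamma (x + 1 / 2) = exp ((1 - 2 * x) * ln 2) * sqrt pi * Gamma (2 * x)"
    unfolding Gamma_complex_of_real of_real_mult[symmetric] exp_of_real of_real_eq_iff .
  then have "Gamma x * Gamma (1 - s) = 2 powr (2 * s) * sqrt pi * Gamma (1 - 2 * s)"
    by (simp add: x_def powr_def)
  moreover have G: "Gamma (1 - s) > 0" using assms by simp
  ultimately have "Gamma x = 2 powr (2 * s) * sqrt pi * Gamma (1 - 2 * s) / Gamma (1 - s)"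
    by (simp add: field_simps)
  then have "Beta x (1 / 2) = pi * (2 powr (2 * s) * Gamma (1 - 2 * s)) / (Gamma (1 - s))\<^sup>2"
    unfolding Beta_def Gamma_one_half_real
    by (simp add: x_def power2_eq_square)
  then show ?thesis
    unfolding x_def c1_def by (simp add: rGamma_inverse_Gamma powr_diff power2_eq_square field_simps)
qed

text \<open>
  After scaling, the sum is the integral of \<open>u powr (- s)\<close>, \<open>u = (l/r)\<^sup>2\<close>, against the measure with
  moments \<open>J_mass\<close>. Both this integral and the one against the limit law change by \<open>O(\<epsilon>)\<close> when
  the power is replaced by a polynomial. For the former this uses the a priori bound for the exponent
  \<open>\<sigma> < 1/2\<close> and the boundedness of the moments.
\<close>

lemma bessel_sum_diag_base:
  assumes s: "s < 1 / 2"
  shows "((\<lambda>r. r powr (2 * s) * bessel_sum s 0 0 r) \<longlongrightarrow> c1 s 0) at_top"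
proof -
  define w :: "real \<Rightarrow> real" where "w u = u powr (- 1 / 2) * (1 - u) powr (- 1 / 2)" for u
  define mom :: "nat \<Rightarrow> real" where "mom k = real (2 * k choose k) / 4 ^ k / 2" for k
  \<comment> \<open>Any exponent strictly between \<open>max s 0\<close> and \<open>1/2\<close> works.\<close>
  define \<sigma> where "\<sigma> = (max s 0 + 1 / 2) / 2"
  have \<sigma>: "s < \<sigma>" "0 < \<sigma>" "\<sigma> < 1 / 2" using s by (auto simp: \<sigma>_def max_def)
  have "(\<lambda>r. r powr (2 * \<sigma>) * bessel_sum \<sigma> 0 0 r) \<in> O[at_top](\<lambda>r. r powr (2 * \<sigma>) * r powr (- 2 * \<sigma>))"
    by (intro landau_o.big.mult bessel_sum_diag_O \<sigma>) simp
  then obtain C where C: "C > 0" "\<forall>\<^sub>F r in at_top. norm (r powr (2 * \<sigma>) * bessel_sum \<sigma> 0 0 r)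
      \<le> C * norm (r powr (2 * \<sigma>) * r powr (- 2 * \<sigma>))"
    by (elim landau_o.bigE)
  define B where "B = Beta (1 / 2 - \<sigma>) (1 / 2) / (2 * pi)"
  define L where "L = Beta (1 / 2 - s) (1 / 2) / (2 * pi)"
  have B: "B \<ge> 0" unfolding B_def Beta_def using \<sigma> by (intro divide_nonneg_nonneg mult_nonneg_nonneg) (auto intro!: less_imp_le[OF Gamma_real_pos])
  have "((\<lambda>r. r powr (2 * s) * bessel_sum s 0 0 r) \<longlongrightarrow> L) at_top"
  proof (rule tendstoI)
    fix e :: real assume e: "e > 0"
    define \<epsilon> where "\<epsilon> = e / (C + B + 4)"
    have \<epsilon>: "\<epsilon> > 0" using e C(1) B by (simp add: \<epsilon>_def)
    obtain a N M where app: "\<And>u. u > 0 \<Longrightarrow> \<bar>u powr (- s) - (\<Sum>i\<le>N. a i * u ^ i)\<bar> \<le> \<epsilon> * (u powr (- \<sigma>) + u ^ M)"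
      using powr_weighted_approx[OF \<sigma>(1,2) \<epsilon>] by blast
    define Lp where "Lp = (\<Sum>i\<le>N. a i * mom i)"
    have mom1: "mom M \<le> 1"
      using tendsto_upperbound[OF J_mass_tendsto J_mass_le_1] by (simp add: mom_def)
    have cont: "\<bar>L - Lp\<bar> \<le> \<epsilon> * (B + 1)"
    proof -
      have i1: "((\<lambda>u. u powr (- s) * w u) has_integral 2 * pi * L) {0..1}"
        using has_integral_powr_arcsine[OF s] by (simp add: w_def L_def)
      have i2: "((\<lambda>u. u powr (- \<sigma>) * w u) has_integral 2 * pi * B) {0..1}"
        using has_integral_powr_arcsine[OF \<sigma>(3)] by (simp add: w_def B_def)
      have i3: "((\<lambda>u. u ^ k * w u) has_integral 2 * pi * mom k) {0..1}" for k
        using has_integral_power_arcsine[of k] by (simp add: w_def mom_def)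
      have "((\<lambda>u. \<Sum>i\<le>N. a i * (u ^ i * w u)) has_integral (\<Sum>i\<le>N. a i * (2 * pi * mom i))) {0..1}"
        by (intro has_integral_sum has_integral_mult_right i3) simp
      from has_integral_diff[OF i1 this]
      have d: "((\<lambda>u. (u powr (- s) - (\<Sum>i\<le>N. a i * u ^ i)) * w u) has_integral 2 * pi * (L - Lp)) {0..1}"
        by (simp add: left_diff_distrib sum_distrib_right sum_distrib_left right_diff_distrib Lp_def mult_ac)
      have b: "((\<lambda>u. \<epsilon> * (u powr (- \<sigma>) + u ^ M) * w u) has_integral 2 * pi * (\<epsilon> * (B + mom M))) {0..1}"
        using has_integral_mult_right[OF has_integral_add[OF i2 i3[of M]], of \<epsilon>]
        by (simp add: algebra_simps)
      have le: "\<bar>(u powr (- s) - (\<Sum>i\<le>N. a i * u ^ i)) * w u\<bar> \<le> \<epsilon> * (u powr (- \<sigma>) + u ^ M) * w u"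
        if "u \<in> {0..1}" for u
      proof (cases "u = 0")
        case False
        with that app[of u] show ?thesis by (simp add: abs_mult w_def mult_right_mono)
      qed (simp add: w_def)
      have "2 * pi * (L - Lp) \<le> 2 * pi * (\<epsilon> * (B + mom M))"
        using le by (intro has_integral_le[OF d b]) (auto simp: abs_le_iff)
      moreover have "- (2 * pi * (L - Lp)) \<le> 2 * pi * (\<epsilon> * (B + mom M))"
        using le by (intro has_integral_le[OF has_integral_neg[OF d] b]) (auto simp: abs_le_iff)
      ultimately have "\<bar>2 * pi * (L - Lp)\<bar> \<le> 2 * pi * (\<epsilon> * (B + mom M))" by (rule abs_leI)
      then have "\<bar>L - Lp\<bar> \<le> \<epsilon> * (B + mom M)" by (simp add: abs_mult)
      also have "\<dots> \<le> \<epsilon> * (B + 1)" using \<epsilon> mom1 by (intro mult_left_mono) auto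
      finally show ?thesis .
    qed
    have "((\<lambda>r. \<Sum>i\<le>N. a i * J_mass i r) \<longlongrightarrow> Lp) at_top"
      unfolding Lp_def mom_def by (intro tendsto_intros J_mass_tendsto)
    from tendstoD[OF this \<epsilon>]
    show "\<forall>\<^sub>F r in at_top. dist (r powr (2 * s) * bessel_sum s 0 0 r) L < e"
      using C(2) J_mass_le_1[of M] eventually_gt_at_top[of 0]
    proof eventually_elim
      case (elim r)
      let ?J = "\<lambda>n. (J (Suc n) r)\<^sup>2" and ?x = "\<lambda>n. (real (Suc n) / r)\<^sup>2"
      have x: "?x n > 0" for n using elim(4) by simp
      have pw: "?x n ^ k = (real (Suc n) / r) ^ (2 * k)" for n k by (simp only: power_mult)
      have m: "(\<lambda>n. ?x n ^ k * ?J n) sums J_mass k r" for k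
        unfolding pw J_mass_def by (rule summable_sums[OF J_mass_summable])
      have f: "(\<lambda>n. ?x n powr (- t) * ?J n) sums (r powr (2 * t) * bessel_sum t 0 0 r)" for t
        unfolding scaled_bessel_sum_eq(1)[OF elim(4)] by (rule summable_sums[OF scaled_bessel_sum_eq(2)[OF elim(4)]])
      have "(\<lambda>n. \<Sum>i\<le>N. a i * (?x n ^ i * ?J n)) sums (\<Sum>i\<le>N. a i * J_mass i r)"
        by (intro sums_sum sums_mult m)
      from sums_diff[OF f[of s] this]
      have d: "(\<lambda>n. (?x n powr (- s) - (\<Sum>i\<le>N. a i * ?x n ^ i)) * ?J n)
          sums (r powr (2 * s) * bessel_sum s 0 0 r - (\<Sum>i\<le>N. a i * J_mass i r))"
        by (simp only: left_diff_distrib sum_distrib_right mult.assoc)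
      have b: "(\<lambda>n. \<epsilon> * (?x n powr (- \<sigma>) + ?x n ^ M) * ?J n)
          sums (\<epsilon> * (r powr (2 * \<sigma>) * bessel_sum \<sigma> 0 0 r + J_mass M r))"
        using sums_mult[OF sums_add[OF f[of \<sigma>] m[of M]], of \<epsilon>] by (simp only: distrib_right mult.assoc)
      have le: "norm ((?x n powr (- s) - (\<Sum>i\<le>N. a i * ?x n ^ i)) * ?J n) \<le> \<epsilon> * (?x n powr (- \<sigma>) + ?x n ^ M) * ?J n" for n
        unfolding real_norm_def abs_mult abs_power2 by (intro mult_right_mono app x) simp
      have "\<bar>r powr (2 * s) * bessel_sum s 0 0 r - (\<Sum>i\<le>N. a i * J_mass i r)\<bar>
          \<le> \<epsilon> * (r powr (2 * \<sigma>) * bessel_sum \<sigma> 0 0 r + J_mass M r)"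
        using norm_suminf_le[OF le sums_summable[OF b]] sums_unique[OF d] sums_unique[OF b] by simp
      also have "\<dots> \<le> \<epsilon> * (C + 1)"
      proof (intro mult_left_mono add_mono)
        show "r powr (2 * \<sigma>) * bessel_sum \<sigma> 0 0 r \<le> C"
          using elim(2) elim(4) by (simp add: powr_add[symmetric])
      qed (use elim \<epsilon> in auto)
      finally have "dist (r powr (2 * s) * bessel_sum s 0 0 r) L < \<epsilon> * (C + 1) + \<epsilon> + \<epsilon> * (B + 1)"
        using elim(1) cont by (simp add: dist_real_def)
      also have "\<dots> \<le> \<epsilon> * (C + B + 4)" using \<epsilon> by (simp add: algebra_simps)
      also have "\<dots> = e" using C(1) B by (simp add: \<epsilon>_def)
      finally show ?case .
    qed
  qed
  then show ?thesis using Beta_eq_c1[OF s] by (simp add: L_def)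
qed

section \<open>Exponents below one half\<close>

text \<open>
  The sums with absolute values, which dominate every error term below. By the arithmetic-geometric mean
  inequality they are bounded by diagonal sums.
\<close>

definition abs_sum :: "real \<Rightarrow> nat \<Rightarrow> nat \<Rightarrow> real \<Rightarrow> real" where
  "abs_sum s m m' r =
     (\<Sum>l. weight s l * \<bar>J (Suc l + m) r * J (Suc l + m') r\<bar>)"

lemma bessel_sum_diag_sums:
  "(\<lambda>l. weight s l * (J (Suc l + m) r)\<^sup>2) sums bessel_sum s m m r"
  using summable_sums[OF bessel_sum_summable[of s m r m]]
  by (simp only: bessel_sum_def power2_eq_square mult.assoc)

lemma abs_term_le:
  "weight s l * \<bar>J (Suc l + m) r * J (Suc l + m') r\<bar>
     \<le> (weight s l * (J (Suc l + m) r)\<^sup>2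
        + weight s l * (J (Suc l + m') r)\<^sup>2) / 2"
  using mult_left_mono[OF J_mult_le[of "Suc l + m" r "Suc l + m'"], of "weight s l"]
  by (simp add: distrib_left)

lemma abs_sum_summable:
  "summable (\<lambda>l. weight s l * \<bar>J (Suc l + m) r * J (Suc l + m') r\<bar>)"
proof (rule summable_comparison_test')
  show "summable (\<lambda>l. (weight s l * (J (Suc l + m) r)\<^sup>2
        + weight s l * (J (Suc l + m') r)\<^sup>2) / 2)"
    by (intro summable_divide summable_add sums_summable[OF bessel_sum_diag_sums])
  fix n :: nat
  have "norm (weight s n * \<bar>J (Suc n + m) r * J (Suc n + m') r\<bar>)
      = weight s n * \<bar>J (Suc n + m) r * J (Suc n + m') r\<bar>"
    by (simp add: abs_mult)
  also note abs_term_le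
  finally show "norm (weight s n * \<bar>J (Suc n + m) r * J (Suc n + m') r\<bar>)
     \<le> (weight s n * (J (Suc n + m) r)\<^sup>2
        + weight s n * (J (Suc n + m') r)\<^sup>2) / 2" .
qed

lemma abs_sum_nonneg: "0 \<le> abs_sum s m m' r"
  unfolding abs_sum_def by (rule suminf_nonneg[OF abs_sum_summable]) simp

lemma abs_bessel_sum_le: "\<bar>bessel_sum s m m' r\<bar> \<le> abs_sum s m m' r"
  unfolding bessel_sum_def abs_sum_def real_norm_def[symmetric]
  by (rule norm_suminf_le[OF _ abs_sum_summable[unfolded real_norm_def[symmetric]]])
     (simp add: abs_mult mult.assoc)

lemma abs_sum_le_diag: "abs_sum s m m' r \<le> (bessel_sum s m m r + bessel_sum s m' m' r) / 2"
proof -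
  have D: "(\<lambda>l. (weight s l * (J (Suc l + m) r)\<^sup>2
        + weight s l * (J (Suc l + m') r)\<^sup>2) / 2)
      sums ((bessel_sum s m m r + bessel_sum s m' m' r) / 2)"
    by (intro sums_divide sums_add bessel_sum_diag_sums)
  show ?thesis
    unfolding abs_sum_def sums_unique[OF D]
    by (rule suminf_le[OF abs_term_le abs_sum_summable sums_summable[OF D]])
qed

lemma abs_sum_antimono:
  assumes "s \<le> t"
  shows "abs_sum t m m' r \<le> abs_sum s m m' r"
  unfolding abs_sum_def
  using assms by (intro suminf_le abs_sum_summable mult_right_mono powr_mono) auto

lemma abs_sum_bigo_diag:
  assumes "\<And>m. bessel_sum s m m \<in> O[at_top](g)"
  shows "abs_sum s m m' \<in> O[at_top](g)"
proof -
  have "abs_sum s m m' \<in> O[at_top](\<lambda>r. bessel_sum s m m r + bessel_sum s m' m' r)"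
  proof (rule bigoI[of _ 1], rule always_eventually, rule allI)
    fix r
    show "norm (abs_sum s m m' r) \<le> 1 * norm (bessel_sum s m m r + bessel_sum s m' m' r)"
      using abs_sum_le_diag[of s m m' r] abs_sum_nonneg[of s m m' r] by simp
  qed
  also have "(\<lambda>r. bessel_sum s m m r + bessel_sum s m' m' r) \<in> O[at_top](g)"
    by (intro sum_in_bigo assms)
  finally show ?thesis .
qed

lemmas abs_sum_O = abs_sum_bigo_diag[OF bessel_sum_diag_O]
  and abs_sum_O_inverse = abs_sum_bigo_diag[OF bessel_sum_diag_O_inverse]

lemma bessel_sum_le_abs_bigo:
  assumes "abs_sum s m m' \<in> O[at_top](g)"
  shows "bessel_sum s m m' \<in> O[at_top](g)"
  using assms by (rule landau_o.big_trans[rotated])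
    (intro bigoI[of _ 1] always_eventually, use abs_bessel_sum_le abs_sum_nonneg in auto)

lemma powr_smallo:
  assumes "a < b"
  shows "(\<lambda>r::real. r powr a) \<in> o[at_top](\<lambda>r. r powr b)"
  using assms by (simp add: powr_smallo_iff filterlim_ident)

lemma inverse_bigo_powr: "(\<lambda>r::real. 1 / r) \<in> O[at_top](\<lambda>r. r powr (- 1))"
proof (rule bigoI[of _ 1])
  show "\<forall>\<^sub>F r::real in at_top. norm (1 / r) \<le> 1 * norm (r powr (- 1))"
    using eventually_gt_at_top[of 0] by eventually_elim (simp add: powr_minus_divide)
qed

text \<open>
  The sums decrease in the exponent, so an exponent beyond the critical value \<open>1/2\<close> can be lowered to some
  \<open>\<sigma> < 1/2\<close>. As \<open>\<sigma> > s\<close> this loses less than is available.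
\<close>

lemma abs_sum_smallo:
  assumes "s < 1 / 2" "t \<ge> s + 1 / 2"
  shows "abs_sum t m m' \<in> o[at_top](\<lambda>r. r powr (- 2 * s))"
proof -
  define \<sigma> where "\<sigma> = (s + min (s + 1 / 2) (1 / 2)) / 2"
  have \<sigma>: "s < \<sigma>" "\<sigma> < 1 / 2" "\<sigma> \<le> t" using assms by (auto simp: \<sigma>_def min_def)
  have "abs_sum t m m' \<in> O[at_top](abs_sum \<sigma> m m')"
    using abs_sum_antimono[OF \<sigma>(3)] abs_sum_nonneg
    by (intro bigoI[of _ 1] always_eventually) auto
  also have "abs_sum \<sigma> m m' \<in> O[at_top](\<lambda>r. r powr (- 2 * \<sigma>))"
    by (rule abs_sum_O[OF \<sigma>(2)])
  also have "(\<lambda>r. r powr (- 2 * \<sigma>)) \<in> o[at_top](\<lambda>r. r powr (- 2 * s))"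
    using \<sigma> by (intro powr_smallo) simp
  finally show ?thesis .
qed

lemma J_mult_bigo: "(\<lambda>r. J a r * J b r) \<in> O[at_top](\<lambda>r. 1 / r)"
proof (rule bigoI)
  show "\<forall>\<^sub>F r in at_top. norm (J a r * J b r) \<le> 108 * norm (1 / r)"
    using eventually_ge_at_top[of 1] eventually_ge_at_top[of "2 * real a"] eventually_ge_at_top[of "2 * real b"]
    by eventually_elim (use J_mult_bound in simp)
qed

lemma powr_diff_bound:
  fixes p :: real
  shows "\<bar>real (Suc n) powr p - real (Suc (Suc n)) powr p\<bar> \<le> \<bar>p\<bar> * 2 powr \<bar>p - 1\<bar> * real (Suc n) powr (p - 1)"
proof -
  let ?l = "real (Suc n)"
  have "\<exists>z>?l. z < ?l + 1 \<and> (?l + 1) powr p - ?l powr p = (?l + 1 - ?l) * (p * z powr (p - 1))"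
    by (rule MVT2) (auto intro!: derivative_eq_intros)
  then obtain z where z: "?l < z" "z < ?l + 1" "(?l + 1) powr p - ?l powr p = p * z powr (p - 1)"
    by auto
  have "z powr (p - 1) = ?l powr (p - 1) * (z / ?l) powr (p - 1)"
    using z(1) by (simp add: powr_divide)
  also have "(z / ?l) powr (p - 1) \<le> (z / ?l) powr \<bar>p - 1\<bar>"
    using z(1) by (intro powr_mono) auto
  also have "\<dots> \<le> 2 powr \<bar>p - 1\<bar>"
    using z by (intro powr_mono2) (auto simp: field_simps)
  finally have "z powr (p - 1) \<le> ?l powr (p - 1) * 2 powr \<bar>p - 1\<bar>" by (simp add: mult_left_mono)
  then have "\<bar>p\<bar> * z powr (p - 1) \<le> \<bar>p\<bar> * (?l powr (p - 1) * 2 powr \<bar>p - 1\<bar>)" by (rule mult_left_mono) simp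
  moreover have "\<bar>(?l + 1) powr p - ?l powr p\<bar> = \<bar>p\<bar> * z powr (p - 1)"
    unfolding z(3) by (simp add: abs_mult)
  moreover have "real (Suc (Suc n)) = ?l + 1" by simp
  ultimately show ?thesis
    by (simp only: abs_minus_commute[of "?l powr p"]) (simp only: mult_ac)
qed

lemma bessel_sum_shift_sums:
  "(\<lambda>n. (weight s n - weight s (Suc n))
        * (J (Suc n + Suc m) r * J (Suc n + Suc m') r)) sums
     (bessel_sum s (Suc m) (Suc m') r - bessel_sum s m m' r + J (Suc m) r * J (Suc m') r)"
proof -
  let ?P = "\<lambda>n. J (Suc n + Suc m) r * J (Suc n + Suc m') r"
  let ?f = "\<lambda>l. weight s l * J (Suc l + m) r * J (Suc l + m') r"
  have s1: "(\<lambda>n. weight s n * ?P n) sums bessel_sum s (Suc m) (Suc m') r"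
    using summable_sums[OF bessel_sum_summable[of s "Suc m" r "Suc m'"]]
    by (simp only: bessel_sum_def mult.assoc)
  have "(\<lambda>n. ?f (Suc n)) sums (bessel_sum s m m' r - ?f 0)"
    using summable_sums[OF bessel_sum_summable[of s m r m']] unfolding bessel_sum_def[symmetric]
    by (subst sums_Suc_iff) simp
  then have s2: "(\<lambda>n. weight s (Suc n) * ?P n) sums
      (bessel_sum s m m' r - J (Suc m) r * J (Suc m') r)"
    by (simp add: mult.assoc)
  have "bessel_sum s (Suc m) (Suc m') r - (bessel_sum s m m' r - J (Suc m) r * J (Suc m') r)
      = bessel_sum s (Suc m) (Suc m') r - bessel_sum s m m' r + J (Suc m) r * J (Suc m') r"
    by simp
  with sums_diff[OF s1 s2] show ?thesis by (simp only: left_diff_distrib)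
qed

text \<open>
  Re-indexing turns the difference into a sum with the weights \<open>l powr (- 2 s) - (l + 1) powr (- 2 s)\<close>, which are
  smaller by one power of \<open>l\<close>, so the exponent \<open>s\<close> improves to \<open>s + 1/2\<close>.
\<close>

lemma bessel_sum_shift_bigo:
  "(\<lambda>r. bessel_sum s (Suc m) (Suc m') r - bessel_sum s m m' r)
     \<in> O[at_top](\<lambda>r. abs_sum (s + 1 / 2) (Suc m) (Suc m') r + \<bar>J (Suc m) r * J (Suc m') r\<bar>)"
proof (rule bigoI, rule always_eventually, rule allI)
  fix r
  define C where "C = \<bar>- 2 * s\<bar> * 2 powr \<bar>- 2 * s - 1\<bar>"
  let ?P = "\<lambda>n. J (Suc n + Suc m) r * J (Suc n + Suc m') r"
  let ?A = "abs_sum (s + 1 / 2) (Suc m) (Suc m') r" and ?B = "\<bar>J (Suc m) r * J (Suc m') r\<bar>"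
  have C: "C \<ge> 0" by (simp add: C_def)
  have b: "(\<lambda>n. C * (weight (s + 1 / 2) n * \<bar>?P n\<bar>)) sums (C * ?A)"
    unfolding abs_sum_def by (intro sums_mult summable_sums abs_sum_summable)
  have le: "norm ((weight s n - weight s (Suc n)) * ?P n)
      \<le> C * (weight (s + 1 / 2) n * \<bar>?P n\<bar>)" for n
  proof -
    have e: "- 2 * (s + 1 / 2) = - 2 * s - 1" by simp
    have "\<bar>weight s n - weight s (Suc n)\<bar> * \<bar>?P n\<bar>
        \<le> (C * weight (s + 1 / 2) n) * \<bar>?P n\<bar>"
      unfolding C_def e by (intro mult_right_mono powr_diff_bound) simp
    then show ?thesis by (simp only: real_norm_def abs_mult mult.assoc)
  qed
  have "\<bar>bessel_sum s (Suc m) (Suc m') r - bessel_sum s m m' r + J (Suc m) r * J (Suc m') r\<bar> \<le> C * ?A"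
    using norm_suminf_le[OF le sums_summable[OF b]] sums_unique[OF bessel_sum_shift_sums[of s m r m']] sums_unique[OF b]
    by simp
  moreover have "0 \<le> C * ?B" using C by simp
  moreover have "(C + 1) * (?A + ?B) = C * ?A + C * ?B + ?A + ?B" by (simp add: algebra_simps)
  moreover have A: "0 \<le> ?A" by (rule abs_sum_nonneg)
  ultimately have "\<bar>bessel_sum s (Suc m) (Suc m') r - bessel_sum s m m' r\<bar> \<le> (C + 1) * (?A + ?B)"
    by linarith
  then show "norm (bessel_sum s (Suc m) (Suc m') r - bessel_sum s m m' r)
      \<le> (\<bar>- 2 * s\<bar> * 2 powr \<bar>- 2 * s - 1\<bar> + 1) * norm (?A + ?B)"
    using abs_of_nonneg[OF add_nonneg_nonneg[OF A abs_ge_zero[of "J (Suc m) r * J (Suc m') r"]]]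
    by (simp only: real_norm_def C_def)
qed

lemma inverse_smallo_powr:
  assumes "s < 1 / 2"
  shows "(\<lambda>r::real. 1 / r) \<in> o[at_top](\<lambda>r. r powr (- 2 * s))"
  using landau_o.big_small_trans[OF inverse_bigo_powr powr_smallo[of "- 1" "- 2 * s"]] assms by simp

lemma bessel_sum_shift_smallo:
  assumes "s < 1 / 2"
  shows "(\<lambda>r. bessel_sum s (Suc m) (Suc m') r - bessel_sum s m m' r) \<in> o[at_top](\<lambda>r. r powr (- 2 * s))"
proof (rule landau_o.big_small_trans[OF bessel_sum_shift_bigo sum_in_smallo(1)])
  show "abs_sum (s + 1 / 2) (Suc m) (Suc m') \<in> o[at_top](\<lambda>r. r powr (- 2 * s))"
    using assms by (intro abs_sum_smallo) auto
  show "(\<lambda>r. \<bar>J (Suc m) r * J (Suc m') r\<bar>) \<in> o[at_top](\<lambda>r. r powr (- 2 * s))"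
    using landau_o.big_small_trans[OF J_mult_bigo inverse_smallo_powr[OF assms]] by simp
qed

lemma bessel_sum_shift_half:
  "(\<lambda>r. bessel_sum (1 / 2) (Suc m) (Suc m') r - bessel_sum (1 / 2) m m' r) \<in> O[at_top](\<lambda>r. 1 / r)"
proof (rule landau_o.big_trans[OF bessel_sum_shift_bigo sum_in_bigo(1)])
  show "abs_sum (1 / 2 + 1 / 2) (Suc m) (Suc m') \<in> O[at_top](\<lambda>r. 1 / r)"
    by (rule abs_sum_O_inverse) simp
  show "(\<lambda>r. \<bar>J (Suc m) r * J (Suc m') r\<bar>) \<in> O[at_top](\<lambda>r. 1 / r)"
    using J_mult_bigo by simp
qed

lemma bessel_sum_commute: "bessel_sum s m m' = bessel_sum s m' m"
  unfolding bessel_sum_def by (intro ext) (simp only: mult_ac)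

text \<open>
  The recurrence of \<open>J\<close> in its second factor. The factor \<open>l\<close> that it produces lowers the exponent by
  \<open>1/2\<close>, and the leading constants \<open>c1\<close> obey the same relation.
\<close>

lemma bessel_sum_recurrence:
  assumes "r > 0"
  shows "bessel_sum s m (m' + 2) r = - bessel_sum s m m' r
    + 2 / r * bessel_sum (s - 1 / 2) m (m' + 1) r + 2 * real (m' + 1) / r * bessel_sum s m (m' + 1) r"
proof -
  let ?T = "\<lambda>t k l. weight t l * J (Suc l + m) r * J (Suc l + k) r"
  have f: "?T t k sums bessel_sum t m k r" for t k
    unfolding bessel_sum_def by (rule summable_sums[OF bessel_sum_summable])
  have "(\<lambda>l. - ?T s m' l
      + 2 / r * ?T (s - 1 / 2) (m' + 1) l
      + 2 * real (m' + 1) / r * ?T s (m' + 1) l)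
    sums (- bessel_sum s m m' r
    + 2 / r * bessel_sum (s - 1 / 2) m (m' + 1) r + 2 * real (m' + 1) / r * bessel_sum s m (m' + 1) r)"
    by (intro sums_add sums_mult sums_minus f)
  also have "(\<lambda>l. - ?T s m' l
      + 2 / r * ?T (s - 1 / 2) (m' + 1) l
      + 2 * real (m' + 1) / r * ?T s (m' + 1) l)
    = (\<lambda>l. ?T s (m' + 2) l)"
  proof
    fix l
    let ?a = "J (Suc l + m') r" and ?b = "J (Suc l + (m' + 1)) r" and ?c = "J (Suc l + (m' + 2)) r"
    have "r * (?a + ?c) = 2 * real (Suc l + m' + 1) * ?b"
      using J_recurrence[of r "Suc l + m'"] by (simp only: add.assoc)
    then have "?a + ?c = 2 * real (Suc l + m' + 1) * ?b / r"
      using assms by (simp add: nonzero_eq_divide_eq mult.commute)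
    also have "\<dots> = 2 / r * real (Suc l) * ?b + 2 * real (m' + 1) / r * ?b"
      by (simp add: add_divide_distrib algebra_simps)
    finally have c: "?c = - ?a + 2 / r * real (Suc l) * ?b + 2 * real (m' + 1) / r * ?b"
      by linarith
    have "- 2 * (s - 1 / 2) = - 2 * s + 1" by simp
    then have p: "weight (s - 1 / 2) l = weight s l * real (Suc l)"
      by (simp only: powr_add powr_one of_nat_0_le_iff)
    show "- (weight s l * J (Suc l + m) r * ?a)
      + 2 / r * (weight (s - 1 / 2) l * J (Suc l + m) r * ?b)
      + 2 * real (m' + 1) / r * (weight s l * J (Suc l + m) r * ?b)
      = weight s l * J (Suc l + m) r * ?c"
      unfolding p c by (simp only: distrib_left mult_minus_right mult_ac)
  qed
  finally show ?thesis using sums_unique2[OF f] by blast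
qed

lemma c1_commute: "c1 s (- \<nu>) = c1 s \<nu>"
  by (simp add: c1_def mult_ac)

text \<open>
  Both terms on the left reduce to \<open>rGamma (p + 1) * rGamma (q + 1)\<close>, where \<open>p + q = 1 - 2 s\<close> supplies the
  factor that shifts \<open>Gamma\<close>.
\<close>

lemma c1_recurrence:
  assumes "s < 1 / 2"
  shows "c1 s (\<nu> + 1) + c1 s (\<nu> - 1) = 2 * c1 (s - 1 / 2) \<nu>"
proof -
  define p q where "p = 1 / 2 - s - of_int \<nu> / 2" and "q = 1 / 2 - s + of_int \<nu> / 2"
  have G: "Gamma (2 - 2 * s) = (1 - 2 * s) * Gamma (1 - 2 * s)"
    using Gamma_plus1[of "1 - 2 * s"] nonpos_Ints_nonpos[of "1 - 2 * s"] assms by force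
  have rG: "rGamma p = p * rGamma (p + 1)" "rGamma q = q * rGamma (q + 1)"
    by (simp_all add: rGamma_plus1)
  have a: "1 - s - of_int (\<nu> + 1) / 2 = p" "1 - s + of_int (\<nu> + 1) / 2 = q + 1"
    "1 - s - of_int (\<nu> - 1) / 2 = p + 1" "1 - s + of_int (\<nu> - 1) / 2 = q"
    "1 - (s - 1 / 2) - of_int \<nu> / 2 = p + 1" "1 - (s - 1 / 2) + of_int \<nu> / 2 = q + 1"
    by (simp_all add: p_def q_def field_simps)
  have e: "2 * (s - 1 / 2) - 1 = (2 * s - 1) - 1" "1 - 2 * (s - 1 / 2) = 2 - 2 * s" by simp_all
  have "c1 s (\<nu> + 1) + c1 s (\<nu> - 1)
      = 2 powr (2 * s - 1) * Gamma (1 - 2 * s) * ((p + q) * (rGamma (p + 1) * rGamma (q + 1)))"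
    unfolding c1_def a rG by (simp add: algebra_simps)
  also have "p + q = 1 - 2 * s" by (simp add: p_def q_def)
  also have "2 powr (2 * s - 1) * Gamma (1 - 2 * s) * ((1 - 2 * s) * (rGamma (p + 1) * rGamma (q + 1)))
      = 2 * c1 (s - 1 / 2) \<nu>"
    unfolding c1_def a e G by (simp add: powr_diff)
  finally show ?thesis .
qed

lemma powr_over_bigo: "(\<lambda>r::real. k / r * r powr (1 - 2 * s)) \<in> O[at_top](\<lambda>r. r powr (- 2 * s))"
proof (rule bigoI[of _ "\<bar>k\<bar>"])
  show "\<forall>\<^sub>F r in at_top. norm (k / r * r powr (1 - 2 * s)) \<le> \<bar>k\<bar> * norm (r powr (- 2 * s))"
    using eventually_gt_at_top[of 0]
    by eventually_elim (simp add: abs_mult powr_diff powr_minus field_simps)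
qed

lemma bessel_sum_over_r_smallo:
  assumes "s < 1 / 2"
  shows "(\<lambda>r. k / r * bessel_sum s m m' r) \<in> o[at_top](\<lambda>r. r powr (- 2 * s))"
proof -
  have "(\<lambda>r. k / r) \<in> o[at_top](\<lambda>r. 1 :: real)"
    by (intro smalloI_tendsto) (auto intro!: tendsto_divide_0[OF tendsto_const] filterlim_at_top_imp_at_infinity filterlim_ident)
  from landau_o.small_big_mult[OF this bessel_sum_le_abs_bigo[OF abs_sum_O[OF assms]]]
  show ?thesis by simp
qed

text \<open>
  The exponent of the remainder moves along with \<open>s\<close>, so that the induction over \<open>m' - m\<close> can pass
  from \<open>s\<close> to \<open>s - 1/2\<close>.
\<close>

definition bessel_sum_leading :: "real \<Rightarrow> nat \<Rightarrow> nat \<Rightarrow> real \<Rightarrow> bool" where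
  "bessel_sum_leading s m m' c \<longleftrightarrow>
     (\<lambda>r. bessel_sum s m m' r - c * r powr (- 2 * s)) \<in> o[at_top](\<lambda>r. r powr (- 2 * s))"

lemma bessel_sum_leading_over_r:
  assumes "bessel_sum_leading (s - 1 / 2) m m' c"
  shows "(\<lambda>r. 2 / r * bessel_sum (s - 1 / 2) m m' r - 2 * c * r powr (- 2 * s)) \<in> o[at_top](\<lambda>r. r powr (- 2 * s))"
proof -
  have e: "- 2 * (s - 1 / 2) = 1 - 2 * s" by simp
  have "(\<lambda>r. 2 / r * (bessel_sum (s - 1 / 2) m m' r - c * r powr (1 - 2 * s)))
      \<in> o[at_top](\<lambda>r. 2 / r * r powr (1 - 2 * s))"
    using assms unfolding bessel_sum_leading_def e by (intro landau_o.big_small_mult) auto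
  also note powr_over_bigo
  also have "(\<lambda>r. 2 / r * (bessel_sum (s - 1 / 2) m m' r - c * r powr (1 - 2 * s))) \<in> o[at_top](\<lambda>r. r powr (- 2 * s)) \<longleftrightarrow> ?thesis"
  proof (rule landau_o.small.in_cong)
    show "\<forall>\<^sub>F r in at_top. 2 / r * (bessel_sum (s - 1 / 2) m m' r - c * r powr (1 - 2 * s))
        = 2 / r * bessel_sum (s - 1 / 2) m m' r - 2 * c * r powr (- 2 * s)"
      using eventually_gt_at_top[of 0]
      by eventually_elim (simp add: powr_diff powr_minus field_simps)
  qed
  finally show ?thesis .
qed

lemma bessel_sum_leading_step:
  assumes s: "s < 1 / 2" and "bessel_sum_leading s m m' c" and "bessel_sum_leading (s - 1 / 2) m (m' + 1) d"
  shows "bessel_sum_leading s m (m' + 2) (2 * d - c)"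
proof -
  let ?d = "\<lambda>r. - (bessel_sum s m m' r - c * r powr (- 2 * s))
      + (2 / r * bessel_sum (s - 1 / 2) m (m' + 1) r - 2 * d * r powr (- 2 * s))
      + 2 * real (m' + 1) / r * bessel_sum s m (m' + 1) r"
  have "(\<lambda>r. ?d r) \<in> o[at_top](\<lambda>r. r powr (- 2 * s))"
    using assms(2) unfolding bessel_sum_leading_def
    by (intro sum_in_smallo bessel_sum_leading_over_r assms(3) bessel_sum_over_r_smallo s)
       (simp only: landau_o.small.uminus_in_iff)
  also have "?this \<longleftrightarrow> ?thesis"
    unfolding bessel_sum_leading_def
  proof (rule landau_o.small.in_cong)
    show "\<forall>\<^sub>F r in at_top. ?d r
      = bessel_sum s m (m' + 2) r - (2 * d - c) * r powr (- 2 * s)"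
      using eventually_gt_at_top[of 0]
      by eventually_elim (simp only: bessel_sum_recurrence, simp add: algebra_simps)
  qed
  finally show ?thesis .
qed

lemma bessel_sum_leading_shift:
  assumes "s < 1 / 2"
  shows "bessel_sum_leading s (Suc m) (Suc m') c \<longleftrightarrow> bessel_sum_leading s m m' c"
  unfolding bessel_sum_leading_def
  using sum_in_smallo(1)[OF bessel_sum_shift_smallo[OF assms, of m m'], of "\<lambda>r. bessel_sum s m m' r - c * r powr (- 2 * s)"]
    sum_in_smallo(2)[OF _ bessel_sum_shift_smallo[OF assms, of m m'], of "\<lambda>r. bessel_sum s (Suc m) (Suc m') r - c * r powr (- 2 * s)"]
  by auto

lemma bessel_sum_leading_diag:
  assumes "s < 1 / 2"
  shows "bessel_sum_leading s m m (c1 s 0)"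
proof (induction m)
  case 0
  show ?case unfolding bessel_sum_leading_def
  proof (rule smalloI_tendsto)
    have "((\<lambda>r. r powr (2 * s) * bessel_sum s 0 0 r - c1 s 0) \<longlongrightarrow> 0) at_top"
      using bessel_sum_diag_base[OF assms] by (simp add: LIM_zero)
    moreover have "\<forall>\<^sub>F r in at_top. r powr (2 * s) * bessel_sum s 0 0 r - c1 s 0
        = (bessel_sum s 0 0 r - c1 s 0 * r powr (- 2 * s)) / r powr (- 2 * s)"
      using eventually_gt_at_top[of 0]
      by eventually_elim (simp add: powr_minus field_simps)
    ultimately show "((\<lambda>r. (bessel_sum s 0 0 r - c1 s 0 * r powr (- 2 * s)) / r powr (- 2 * s)) \<longlongrightarrow> 0) at_top"
      by (rule Lim_transform_eventually)
    show "\<forall>\<^sub>F r in at_top. r powr (- 2 * s) \<noteq> 0"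
      using eventually_gt_at_top[of 0] by eventually_elim simp
  qed
qed (simp add: bessel_sum_leading_shift[OF assms])

text \<open>
  Induction on the distance \<open>d\<close> of the two orders. For \<open>d = 1\<close> the recurrence around the pair
  \<open>(m + 1, m + 1)\<close> involves the two neighbours \<open>(m + 1, m + 2)\<close> and \<open>(m + 1, m)\<close>, which
  have the same leading term by the shift, so each carries half of the right-hand side.
\<close>

lemma bessel_sum_leading_up:
  assumes "s < 1 / 2"
  shows "bessel_sum_leading s m (m + d) (c1 s (int d))"
  using assms
proof (induction d arbitrary: s m rule: induct_nat_012)
  case 0
  then show ?case using bessel_sum_leading_diag by simp
next
  case 1
  let ?c = "c1 (s - 1 / 2) 0"
  let ?d = "\<lambda>r. (2 / r * bessel_sum (s - 1 / 2) (Suc m) (m + 1) r - 2 * ?c * r powr (- 2 * s))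
      + 2 * real (m + 1) / r * bessel_sum s (Suc m) (m + 1) r
      - (bessel_sum s (Suc m) (Suc (Suc m)) r - bessel_sum s m (Suc m) r)"
  have c: "c1 s 1 = ?c"
    using c1_recurrence[OF 1, of 0] c1_commute[of s 1] by simp
  have "(\<lambda>r. ?d r) \<in> o[at_top](\<lambda>r. r powr (- 2 * s))"
    using bessel_sum_leading_diag[of "s - 1 / 2" "Suc m"] 1
    by (intro sum_in_smallo bessel_sum_leading_over_r bessel_sum_over_r_smallo bessel_sum_shift_smallo) auto
  also have "?this \<longleftrightarrow> (\<lambda>r. 2 * (bessel_sum s m (Suc m) r - ?c * r powr (- 2 * s))) \<in> o[at_top](\<lambda>r. r powr (- 2 * s))"
  proof (rule landau_o.small.in_cong)
    show "\<forall>\<^sub>F r in at_top. ?d r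
      = 2 * (bessel_sum s m (Suc m) r - ?c * r powr (- 2 * s))"
      using eventually_gt_at_top[of 0]
    proof eventually_elim
      case (elim r)
      then show ?case
        using bessel_sum_recurrence[OF elim, of s "Suc m" m] fun_cong[OF bessel_sum_commute[of s "Suc m" m], of r]
        by (simp add: algebra_simps)
    qed
  qed
  finally have "(\<lambda>r. bessel_sum s m (Suc m) r - ?c * r powr (- 2 * s)) \<in> o[at_top](\<lambda>r. r powr (- 2 * s))"
    by (subst (asm) landau_o.small.cmult_in_iff) simp_all
  then show ?case by (simp add: bessel_sum_leading_def c)
next
  case (ge2 d)
  have "2 * c1 (s - 1 / 2) (int (Suc d)) - c1 s (int d) = c1 s (int (Suc (Suc d)))"
    using c1_recurrence[OF ge2.prems, of "int (Suc d)"] by simp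
  moreover have "bessel_sum_leading s m (m + d + 2) (2 * c1 (s - 1 / 2) (int (Suc d)) - c1 s (int d))"
    using ge2.IH(1)[OF ge2.prems, of m] ge2.IH(2)[of "s - 1 / 2" m] ge2.prems
    by (intro bessel_sum_leading_step) auto
  ultimately show ?case by simp
qed

lemma bessel_sum_leading_general:
  assumes "s < 1 / 2"
  shows "bessel_sum_leading s m m' (c1 s (int m - int m'))"
proof (cases "m \<le> m'")
  case True
  then show ?thesis
    using bessel_sum_leading_up[OF assms, of m "m' - m"] c1_commute[of s "int m - int m'"]
    by (simp add: of_nat_diff)
next
  case False
  then show ?thesis
    using bessel_sum_leading_up[OF assms, of m' "m - m'"]
    by (simp add: of_nat_diff bessel_sum_leading_def bessel_sum_commute[of s m m'])
qed

section \<open>Fixed orders and exponents above one half\<close>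

text \<open>
  The limit of \<open>r * J a r * J b r\<close>. It is \<open>(2/\<pi>) cos (r - \<pi> a/2 - \<pi>/4) cos (r - \<pi> b/2 - \<pi>/4)\<close>, written as a sum.
\<close>

definition J_phase :: "nat \<Rightarrow> nat \<Rightarrow> real \<Rightarrow> real" where
  "J_phase a b r = (cos (pi * (real a - real b) / 2) + sin (2 * r - pi * (real a + real b) / 2)) / pi"

lemma J_phase_bound: "\<bar>J_phase a b r\<bar> \<le> 1"
proof -
  have "\<bar>cos (pi * (real a - real b) / 2) + sin (2 * r - pi * (real a + real b) / 2)\<bar> \<le> 2"
    using abs_cos_le_one[of "pi * (real a - real b) / 2"] abs_sin_le_one[of "2 * r - pi * (real a + real b) / 2"]
    by linarith
  also have "2 \<le> pi" by (rule pi_ge_two)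
  finally show ?thesis by (simp add: J_phase_def)
qed

definition J_phase_limit :: "nat \<Rightarrow> nat \<Rightarrow> bool" where
  "J_phase_limit a b \<longleftrightarrow> ((\<lambda>r. r * (J a r * J b r) - J_phase a b r) \<longlongrightarrow> 0) at_top"

lemma J_phase_commute: "J_phase a b = J_phase b a"
proof
  fix r
  have "pi * (real b - real a) / 2 = - (pi * (real a - real b) / 2)" by (simp add: field_simps)
  then have "cos (pi * (real b - real a) / 2) = cos (pi * (real a - real b) / 2)" by (simp only: cos_minus)
  then show "J_phase a b r = J_phase b a r" by (simp add: J_phase_def add.commute)
qed

lemma J_phase_limit_commute: "J_phase_limit a b \<longleftrightarrow> J_phase_limit b a"
  unfolding J_phase_limit_def J_phase_commute[of a b] by (simp only: mult.commute)

lemma J_phase_add_2: "J_phase a (b + 2) r = - J_phase a b r"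
proof -
  have c: "pi * (real a - real (b + 2)) / 2 = pi * (real a - real b) / 2 - pi"
    and s: "2 * r - pi * (real a + real (b + 2)) / 2 = (2 * r - pi * (real a + real b) / 2) - pi"
    by (simp_all add: field_simps)
  show ?thesis unfolding J_phase_def c s cos_diff sin_diff by (simp add: field_simps)
qed

lemma J_phase_limit_add_2:
  assumes "J_phase_limit a b"
  shows "J_phase_limit a (b + 2)"
proof -
  have "((\<lambda>r. 2 * real (b + 1) * (J a r * J (b + 1) r)
      - (r * (J a r * J b r) - J_phase a b r)) \<longlongrightarrow> 2 * real (b + 1) * (0 * 0) - 0) at_top"
    using assms unfolding J_phase_limit_def by (intro tendsto_intros J_tendsto_0)
  moreover have "2 * real (b + 1) * (J a r * J (b + 1) r)
      - (r * (J a r * J b r) - J_phase a b r)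
      = r * (J a r * J (b + 2) r) - J_phase a (b + 2) r" for r
  proof -
    have "2 * real (b + 1) * (J a r * J (b + 1) r)
        = J a r * (r * (J b r + J (b + 2) r))"
      unfolding J_recurrence by (simp only: mult_ac)
    then show ?thesis unfolding J_phase_add_2 by (simp add: algebra_simps)
  qed
  ultimately show ?thesis unfolding J_phase_limit_def by simp
qed

lemma tendsto_0_cong:
  assumes "(f \<longlongrightarrow> c) F" "\<And>r. f r = g r" "c = (0 :: real)"
  shows "(g \<longlongrightarrow> 0) F"
proof -
  have "f = g" by (rule ext) (rule assms(2))
  with assms(1,3) show ?thesis by simp
qed

lemma sqrt_error_tendsto_0:
  fixes f :: "real \<Rightarrow> real"
  assumes "\<And>r. r \<ge> 1 \<Longrightarrow> \<bar>f r\<bar> \<le> K / sqrt r"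
  shows "(f \<longlongrightarrow> 0) at_top"
proof (rule Lim_null_comparison)
  show "\<forall>\<^sub>F r in at_top. norm (f r) \<le> K / sqrt r"
    using eventually_ge_at_top[of 1] by eventually_elim (simp add: assms)
  show "((\<lambda>r. K / sqrt r) \<longlongrightarrow> 0) at_top"
    by (intro tendsto_divide_0[OF tendsto_const] filterlim_at_top_imp_at_infinity sqrt_at_top)
qed

lemma J_phase_limit_base:
  shows "J_phase_limit 0 0" "J_phase_limit 0 1" "J_phase_limit 1 1"
proof -
  let ?d = "\<lambda>r. r * ((J 0 r)\<^sup>2 - (J 1 r)\<^sup>2) - 2 / pi * sin (2 * r)"
  let ?p = "\<lambda>r. 2 * r * (J 0 r * J 1 r) + 2 / pi * cos (2 * r)"
  let ?s = "\<lambda>r. r * ((J 0 r)\<^sup>2 + (J 1 r)\<^sup>2) - 2 / pi"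
  have d: "(?d \<longlongrightarrow> 0) at_top" and p: "(?p \<longlongrightarrow> 0) at_top" and s: "(?s \<longlongrightarrow> 0) at_top"
    by (rule sqrt_error_tendsto_0, rule J_01_asymp, assumption)+
  have sp: "sin (2 * r - pi) = - sin (2 * r)" "sin (2 * r - pi / 2) = - cos (2 * r)" for r :: real
    by (simp_all add: sin_diff)
  have "((\<lambda>r. (?s r + ?d r) / 2) \<longlongrightarrow> (0 + 0) / 2) at_top" by (intro tendsto_intros d s) simp
  moreover have "(?s r + ?d r) / 2 = r * (J 0 r * J 0 r) - J_phase 0 0 r" for r
    by (simp add: J_phase_def power2_eq_square field_simps)
  ultimately show "J_phase_limit 0 0" unfolding J_phase_limit_def by (rule tendsto_0_cong) simp
  have "((\<lambda>r. (?s r - ?d r) / 2) \<longlongrightarrow> (0 - 0) / 2) at_top" by (intro tendsto_intros d s) simp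
  moreover have "(?s r - ?d r) / 2 = r * (J 1 r * J 1 r) - J_phase 1 1 r" for r
    by (simp add: J_phase_def power2_eq_square sp field_simps)
  ultimately show "J_phase_limit 1 1" unfolding J_phase_limit_def by (rule tendsto_0_cong) simp
  have "((\<lambda>r. ?p r / 2) \<longlongrightarrow> 0 / 2) at_top" by (intro tendsto_intros p) simp
  moreover have "?p r / 2 = r * (J 0 r * J 1 r) - J_phase 0 1 r" for r
    by (simp add: J_phase_def sp)
  ultimately show "J_phase_limit 0 1" unfolding J_phase_limit_def by (rule tendsto_0_cong) simp
qed

text \<open>
  The recurrence in either index, from the three products of \<open>J 0\<close> and \<open>J 1\<close>.
\<close>

lemma J_phase_limit: "J_phase_limit a b"
proof -
  have 0: "J_phase_limit 0 b" for b
    by (induction b rule: induct_nat_012)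
       (use J_phase_limit_base J_phase_limit_add_2 in \<open>auto simp: numeral_2_eq_2\<close>)
  have 1: "J_phase_limit 1 b" for b
  proof (induction b rule: induct_nat_012)
    case 0
    show ?case using J_phase_limit_base(2) J_phase_limit_commute by simp
  qed (use J_phase_limit_base J_phase_limit_add_2 in \<open>auto simp: numeral_2_eq_2\<close>)
  have "J_phase_limit b a"
    by (induction a rule: induct_nat_012)
       (use 0[of b] 1[of b] J_phase_limit_commute[of b] J_phase_limit_add_2 in \<open>auto simp: numeral_2_eq_2\<close>)
  then show ?thesis using J_phase_limit_commute by blast
qed

text \<open>
  Dominated convergence. Terms with \<open>l \<le> r / 4\<close> are bounded uniformly by \<open>108 + 1\<close> times the summable weight
  and converge by the asymptotics at fixed order. The rest carries a weight of at most
  \<open>(r / 4) powr (- 2 s)\<close>, while the sum of the products stays bounded, so that after the factor \<open>r\<close> it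
  still tends to 0 as \<open>s > 1/2\<close>.
\<close>

lemma bessel_weighted_sum_asymp:
  assumes s: "s > 1 / 2" and w: "\<And>n. \<bar>w n\<bar> \<le> weight s n"
  shows "((\<lambda>r. r * (\<Sum>n. w n * (J (Suc n + m) r * J (Suc n + m') r))
            - (\<Sum>n. w n * J_phase (Suc n + m) (Suc n + m') r)) \<longlongrightarrow> 0) at_top"
proof -
  let ?JJ = "\<lambda>n r. J (Suc n + m) r * J (Suc n + m') r"
  let ?ph = "\<lambda>n r. J_phase (Suc n + m) (Suc n + m') r"
  define near where "near n r \<longleftrightarrow> n < nat \<lfloor>r / 4\<rfloor>" for n :: nat and r :: real
  define a where "a n r = w n * ((if near n r then r * ?JJ n r else 0) - ?ph n r)" for n r
  have sp: "summable (\<lambda>n. weight s n)"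
    using zeta_real_summable[of "2 * s"] s by simp
  have lim: "((\<lambda>r. a n r) \<longlongrightarrow> 0) at_top" for n
  proof -
    have "((\<lambda>r. w n * (r * ?JJ n r - ?ph n r)) \<longlongrightarrow> w n * 0) at_top"
      using J_phase_limit[of "Suc n + m" "Suc n + m'"] unfolding J_phase_limit_def
      by (rule tendsto_mult_left)
    moreover have "\<forall>\<^sub>F r in at_top. w n * (r * ?JJ n r - ?ph n r) = a n r"
      using eventually_ge_at_top[of "4 * real (Suc n)"]
    proof eventually_elim
      case (elim r)
      then have "real_of_int (int (Suc n)) \<le> r / 4" by simp
      then have "int (Suc n) \<le> \<lfloor>r / 4\<rfloor>" by (simp only: le_floor_iff)
      then have "near n r" unfolding near_def by linarith
      then show ?case by (simp add: a_def)
    qed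
    ultimately show ?thesis by (simp add: Lim_transform_eventually)
  qed
  have near_bound: "\<bar>r * ?JJ n r\<bar> \<le> 108" if "near n r" "r \<ge> 1" "r \<ge> 4 * real m" "r \<ge> 4 * real m'" for n r
  proof -
    have n: "real (Suc n) \<le> r / 4" using that(1) unfolding near_def by linarith
    have "\<bar>?JJ n r\<bar> \<le> 108 / r"
      using n that by (intro J_mult_bound) auto
    then show ?thesis using that(2) by (simp add: abs_mult field_simps)
  qed
  have a_bound: "norm (a n r) \<le> 109 * weight s n"
    if "r \<ge> 1" "r \<ge> 4 * real m" "r \<ge> 4 * real m'" for n r
  proof -
    have "\<bar>(if near n r then r * ?JJ n r else 0) - ?ph n r\<bar> \<le> 109"
      using near_bound[of n r] that J_phase_bound[of "Suc n + m" "Suc n + m'" r] by (auto split: if_splits)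
    then have "\<bar>w n\<bar> * \<bar>(if near n r then r * ?JJ n r else 0) - ?ph n r\<bar> \<le> weight s n * 109"
      by (intro mult_mono w) auto
    then show ?thesis by (simp only: a_def real_norm_def abs_mult mult.commute)
  qed
  have ev: "\<forall>\<^sub>F r in at_top. r \<ge> 1 \<and> r \<ge> 4 * real m \<and> r \<ge> 4 * real m'"
    by (intro eventually_conj eventually_ge_at_top)
  have "\<forall>\<^sub>F (n, r) in at_top \<times>\<^sub>F at_top. norm (a n r) \<le> 109 * weight s n"
    unfolding eventually_prod_filter case_prod_beta fst_conv snd_conv
    using ev a_bound by (intro exI[of _ "\<lambda>_. True"] exI[of _ "\<lambda>r. r \<ge> 1 \<and> r \<ge> 4 * real m \<and> r \<ge> 4 * real m'"]) simp
  then have "((\<lambda>r. \<Sum>n. a n r) \<longlongrightarrow> (\<Sum>n. 0)) at_top"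
    using tannerys_theorem[of a "\<lambda>_. 0" at_top "\<lambda>n. 109 * weight s n"] lim summable_mult[OF sp] by auto
  then have lim_near: "((\<lambda>r. \<Sum>n. a n r) \<longlongrightarrow> 0) at_top" by simp
  define far where "far r = (\<Sum>n. w n * (if near n r then 0 else r * ?JJ n r))" for r
  have far_bound: "norm (w n * (if near n r then 0 else r * ?JJ n r))
      \<le> r * (r / 4) powr (- 2 * s) * (weight 0 n * \<bar>?JJ n r\<bar>)" if "r > 0" for n r
  proof (cases "near n r")
    case False
    then have "\<lfloor>r / 4\<rfloor> \<le> int n" unfolding near_def by linarith
    then have "r / 4 \<le> real (Suc n)" by linarith
    then have "weight s n \<le> (r / 4) powr (- 2 * s)"
      using s that by (intro powr_mono2') auto
    with w[of n] have "\<bar>w n\<bar> * (r * \<bar>?JJ n r\<bar>) \<le> (r / 4) powr (- 2 * s) * (r * \<bar>?JJ n r\<bar>)"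
      using that by (intro mult_right_mono) auto
    then show ?thesis using False that by (simp add: abs_mult mult_ac)
  qed (use that in simp)
  have "abs_sum 0 m m' \<in> O[at_top](\<lambda>r. r powr (- 2 * 0))"
    by (rule abs_sum_O) simp
  then obtain D where D: "D > 0" "\<forall>\<^sub>F r in at_top. norm (abs_sum 0 m m' r) \<le> D * norm (r powr (- 2 * 0))"
    by (elim landau_o.bigE)
  have far0: "(far \<longlongrightarrow> 0) at_top"
  proof (rule Lim_null_comparison)
    show "\<forall>\<^sub>F r in at_top. norm (far r) \<le> r * (r / 4) powr (- 2 * s) * D"
      using D(2) eventually_gt_at_top[of 0]
    proof eventually_elim
      case (elim r)
      have "norm (far r) \<le> (\<Sum>n. r * (r / 4) powr (- 2 * s) * (weight 0 n * \<bar>?JJ n r\<bar>))"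
        unfolding far_def using far_bound[OF elim(2)] summable_mult[OF abs_sum_summable]
        by (rule norm_suminf_le)
      also have "\<dots> = r * (r / 4) powr (- 2 * s) * abs_sum 0 m m' r"
        unfolding abs_sum_def by (rule suminf_mult[OF abs_sum_summable])
      also have "\<dots> \<le> r * (r / 4) powr (- 2 * s) * D"
        using elim by (intro mult_left_mono) auto
      finally show ?case .
    qed
    have "((\<lambda>r. D * 4 powr (2 * s) * r powr (- (2 * s - 1))) \<longlongrightarrow> D * 4 powr (2 * s) * 0) at_top"
      using s by (intro tendsto_mult_left tendsto_neg_powr filterlim_ident) auto
    moreover have "\<forall>\<^sub>F r in at_top. D * 4 powr (2 * s) * r powr (- (2 * s - 1)) = r * (r / 4) powr (- 2 * s) * D"
      using eventually_gt_at_top[of 0]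
      by eventually_elim (simp add: powr_divide powr_diff powr_minus field_simps)
    ultimately show "((\<lambda>r. r * (r / 4) powr (- 2 * s) * D) \<longlongrightarrow> 0) at_top"
      by (simp add: Lim_transform_eventually)
  qed
  have "\<forall>\<^sub>F r in at_top. (\<Sum>n. a n r) + far r
      = r * (\<Sum>n. w n * ?JJ n r) - (\<Sum>n. w n * ?ph n r)"
    using ev
  proof eventually_elim
    case (elim r)
    have r: "r > 0" using elim by simp
    have "summable (\<lambda>n. a n r)"
      using a_bound elim by (intro summable_comparison_test'[OF summable_mult[OF sp]]) blast
    moreover have "summable (\<lambda>n. w n * (if near n r then 0 else r * ?JJ n r))"
      using far_bound[OF r] by (intro summable_comparison_test'[OF summable_mult[OF abs_sum_summable]])
    ultimately have 1: "(\<lambda>n. a n r + w n * (if near n r then 0 else r * ?JJ n r)) sums ((\<Sum>n. a n r) + far r)"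
      unfolding far_def by (intro sums_add summable_sums)
    have sph: "summable (\<lambda>n. w n * ?ph n r)"
    proof (rule summable_comparison_test'[OF sp])
      fix n
      have "\<bar>w n\<bar> * \<bar>?ph n r\<bar> \<le> weight s n * 1"
        by (intro mult_mono w J_phase_bound) auto
      then show "norm (w n * ?ph n r) \<le> weight s n" by (simp add: abs_mult)
    qed
    have "summable (\<lambda>n. w n * ?JJ n r)"
    proof (rule summable_comparison_test'[OF abs_sum_summable[of s m r m']])
      fix n
      show "norm (w n * ?JJ n r) \<le> weight s n * \<bar>?JJ n r\<bar>"
        unfolding real_norm_def abs_mult[of "w n"] by (intro mult_right_mono w) simp
    qed
    then have 2: "(\<lambda>n. r * (w n * ?JJ n r) - w n * ?ph n r) sums (r * (\<Sum>n. w n * ?JJ n r) - (\<Sum>n. w n * ?ph n r))"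
      by (intro sums_diff sums_mult summable_sums sph)
    have "a n r + w n * (if near n r then 0 else r * ?JJ n r) = r * (w n * ?JJ n r) - w n * ?ph n r" for n
      by (simp add: a_def algebra_simps)
    with 1 2 show ?case using sums_unique2 by (simp only:)
  qed
  with tendsto_add[OF lim_near far0] show ?thesis by (simp add: Lim_transform_eventually)
qed

lemma J_phase_consecutive:
  "J_phase (Suc n + m) (Suc n + m') r
     = (cos (pi * (real m - real m') / 2) + (-1) ^ Suc n * sin (2 * r - c7 (m + m'))) / pi"
proof -
  have "2 * r - pi * (real (Suc n + m) + real (Suc n + m')) / 2 = (2 * r - c7 (m + m')) - pi * real (Suc n)"
    by (simp add: c7_def field_simps)
  then have "sin (2 * r - pi * (real (Suc n + m) + real (Suc n + m')) / 2) = (-1) ^ Suc n * sin (2 * r - c7 (m + m'))"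
    by (simp only: sin_diff sin_npi2 cos_npi2) (simp add: mult.commute)
  moreover have "real (Suc n + m) - real (Suc n + m') = real m - real m'" by simp
  ultimately show ?thesis unfolding J_phase_def by (simp only:)
qed

text \<open>
  Adding the zeta series doubles the terms with even \<open>l\<close> and cancels the others.
\<close>

lemma alternating_zeta_sums:
  assumes "x > 1"
  shows "(\<lambda>n. (-1) ^ Suc n * real (Suc n) powr (- x)) sums (- (zeta_real x * (1 - 2 powr (1 - x))))"
proof -
  have z: "(\<lambda>n. real (Suc n) powr (- x)) sums zeta_real x"
    unfolding zeta_real_def by (rule summable_sums[OF zeta_real_summable[OF assms]])
  let ?f = "\<lambda>n. (1 + (-1) ^ Suc n) * real (Suc n) powr (- x)"
  have "(\<lambda>n. 2 * 2 powr (- x) * real (Suc n) powr (- x)) sums (2 * 2 powr (- x) * zeta_real x)"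
    by (intro sums_mult z)
  also have "(\<lambda>n. 2 * 2 powr (- x) * real (Suc n) powr (- x)) = (\<lambda>n. ?f (2 * n + 1))"
  proof
    fix n
    have "real (Suc (2 * n + 1)) = 2 * real (Suc n)" by simp
    then show "2 * 2 powr (- x) * real (Suc n) powr (- x) = ?f (2 * n + 1)"
      by (simp only: powr_mult) simp
  qed
  also have "(\<lambda>n. ?f (2 * n + 1)) sums (2 * 2 powr (- x) * zeta_real x) \<longleftrightarrow> ?f sums (2 * 2 powr (- x) * zeta_real x)"
  proof (rule sums_mono_reindex)
    show "?f n = 0" if "n \<notin> range (\<lambda>n. 2 * n + 1)" for n
    proof -
      have "even n"
      proof (rule ccontr)
        assume "odd n"
        then obtain k where "n = 2 * k + 1" by (elim oddE)
        with that show False by blast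
      qed
      then show ?thesis by simp
    qed
  qed (simp add: strict_mono_def)
  finally have "?f sums (2 * 2 powr (- x) * zeta_real x)" .
  from sums_diff[OF this z]
  have "(\<lambda>n. (-1) ^ Suc n * real (Suc n) powr (- x)) sums (2 * 2 powr (- x) * zeta_real x - zeta_real x)"
    by (simp only: distrib_right mult_1_left add_diff_cancel_left')
  moreover have "2 * 2 powr (- x) * zeta_real x - zeta_real x = - (zeta_real x * (1 - 2 powr (1 - x)))"
    by (simp add: powr_diff powr_minus field_simps)
  ultimately show ?thesis by simp
qed

lemma smallo_inverse_iff: "f \<in> o[at_top](\<lambda>r. 1 / r) \<longleftrightarrow> ((\<lambda>r::real. r * f r) \<longlongrightarrow> 0) at_top"
proof -
  have nz: "\<forall>\<^sub>F r::real in at_top. 1 / r \<noteq> 0"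
    using eventually_gt_at_top[of 0] by eventually_elim simp
  have e: "f r / (1 / r) = r * f r" for r :: real by simp
  show ?thesis
    using smalloI_tendsto[OF _ nz, of f] smalloD_tendsto[of f at_top "\<lambda>r. 1 / r"] unfolding e by blast
qed

lemma mult_diff_divide_cancel: "r > 0 \<Longrightarrow> r * (a - c / r) = r * a - c" for a c r :: real
  by (simp add: field_simps)

lemma bessel_sum_asymp_gt_half:
  assumes s: "s > 1 / 2"
  shows "(\<lambda>r. bessel_sum s m m' r - (c5 s (int m - int m') - c6 s * sin (2 * r - c7 (m + m'))) / r) \<in> o[at_top](\<lambda>r. 1 / r)"
proof -
  let ?w = "\<lambda>n. weight s n"
  let ?main = "\<lambda>r. c5 s (int m - int m') - c6 s * sin (2 * r - c7 (m + m'))"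
  have w1: "?w sums zeta_real (2 * s)"
    using zeta_real_summable[of "2 * s"] s summable_sums by (simp add: zeta_real_def)
  have w2: "(\<lambda>n. (-1) ^ Suc n * ?w n) sums (- (zeta_real (2 * s) * (1 - 2 powr (1 - 2 * s))))"
    using alternating_zeta_sums[of "2 * s"] s by simp
  have ph: "(\<Sum>n. ?w n * J_phase (Suc n + m) (Suc n + m') r) = c5 s (int m - int m') - c6 s * sin (2 * r - c7 (m + m'))" for r
  proof -
    let ?c = "cos (pi * (real m - real m') / 2)" and ?s = "sin (2 * r - c7 (m + m'))"
    have "(\<lambda>n. (?w n * ?c + (-1) ^ Suc n * ?w n * ?s) / pi)
        sums ((zeta_real (2 * s) * ?c + (- (zeta_real (2 * s) * (1 - 2 powr (1 - 2 * s)))) * ?s) / pi)"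
      by (intro sums_divide sums_add sums_mult2 w1 w2)
    moreover have "(\<lambda>n. (?w n * ?c + (-1) ^ Suc n * ?w n * ?s) / pi) = (\<lambda>n. ?w n * J_phase (Suc n + m) (Suc n + m') r)"
      unfolding J_phase_consecutive by (simp only: distrib_left times_divide_eq_right mult_ac)
    moreover have "(zeta_real (2 * s) * ?c + (- (zeta_real (2 * s) * (1 - 2 powr (1 - 2 * s)))) * ?s) / pi
        = c5 s (int m - int m') - c6 s * ?s"
      by (simp add: c5_def c6_def field_simps)
    ultimately have "(\<lambda>n. ?w n * J_phase (Suc n + m) (Suc n + m') r)
        sums (c5 s (int m - int m') - c6 s * ?s)"
      by (simp only:)
    then show ?thesis by (rule sums_unique[symmetric])
  qed
  have "((\<lambda>r. r * bessel_sum s m m' r - ?main r) \<longlongrightarrow> 0) at_top"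
    using bessel_weighted_sum_asymp[OF s, of ?w m m'] unfolding ph
    by (simp add: bessel_sum_def mult.assoc)
  moreover have "\<forall>\<^sub>F r in at_top. r * bessel_sum s m m' r - ?main r
      = r * (bessel_sum s m m' r - ?main r / r)"
    using eventually_gt_at_top[of 0] by eventually_elim (simp only: mult_diff_divide_cancel)
  ultimately show ?thesis unfolding smallo_inverse_iff by (rule Lim_transform_eventually)
qed

section \<open>The critical exponent with odd order difference\<close>

lemma bessel_sum_0_tendsto: "((\<lambda>r. bessel_sum 0 m m' r) \<longlongrightarrow> c1 0 (int m - int m')) at_top"
proof -
  have "(\<lambda>r. bessel_sum 0 m m' r - c1 0 (int m - int m') * r powr (- 2 * 0)) \<in> o[at_top](\<lambda>r. r powr (- 2 * 0))"
    using bessel_sum_leading_general[of 0 m m'] unfolding bessel_sum_leading_def by simp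
  also have "(\<lambda>r::real. r powr (- 2 * 0)) \<in> O[at_top](\<lambda>_. 1 :: real)"
    by (rule bigoI[of _ 1]) (auto intro!: always_eventually simp: powr_def)
  finally have "((\<lambda>r. (bessel_sum 0 m m' r - c1 0 (int m - int m') * r powr (- 2 * 0)) / 1) \<longlongrightarrow> 0) at_top"
    by (rule smalloD_tendsto)
  moreover have "\<forall>\<^sub>F r in at_top. (bessel_sum 0 m m' r - c1 0 (int m - int m') * r powr (- 2 * 0)) / 1
      = bessel_sum 0 m m' r - c1 0 (int m - int m')"
    using eventually_gt_at_top[of 0] by eventually_elim simp
  ultimately have "((\<lambda>r. bessel_sum 0 m m' r - c1 0 (int m - int m')) \<longlongrightarrow> 0) at_top"
    by (rule Lim_transform_eventually)
  then show ?thesis by (simp only: LIM_zero_iff)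
qed

lemma c1_0_0: "c1 0 0 = 1 / 2"
  by (simp add: c1_def powr_minus)

lemma c1_0_even:
  assumes "even \<nu>" "\<nu> \<noteq> 0"
  shows "c1 0 \<nu> = 0"
proof -
  obtain k where k: "\<nu> = 2 * k" using assms by (elim evenE)
  have "(1 - of_int k :: real) \<in> \<int>\<^sub>\<le>\<^sub>0 \<or> (1 + of_int k :: real) \<in> \<int>\<^sub>\<le>\<^sub>0"
  proof (cases "k > 0")
    case True
    then have "(of_int (1 - k) :: real) \<in> \<int>\<^sub>\<le>\<^sub>0" by (intro nonpos_Ints_of_int) auto
    then show ?thesis by simp
  next
    case False
    then have "(of_int (1 + k) :: real) \<in> \<int>\<^sub>\<le>\<^sub>0" using assms k by (intro nonpos_Ints_of_int) auto
    then show ?thesis by simp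
  qed
  then have "rGamma (1 - of_int k :: real) = 0 \<or> rGamma (1 + of_int k :: real) = 0"
    by (simp only: rGamma_eq_zero_iff)
  then show ?thesis unfolding c1_def k by auto
qed

lemma bessel_sum_half_tendsto_0: "((\<lambda>r. bessel_sum (1 / 2) m m' r) \<longlongrightarrow> 0) at_top"
proof -
  have "abs_sum (1 / 2) m m' \<in> o[at_top](\<lambda>r. r powr (- 2 * 0))"
    by (rule abs_sum_smallo) auto
  also have "(\<lambda>r::real. r powr (- 2 * 0)) \<in> O[at_top](\<lambda>_. 1 :: real)"
    by (rule bigoI[of _ 1]) (auto intro!: always_eventually simp: powr_def)
  finally have "((\<lambda>r. abs_sum (1 / 2) m m' r / 1) \<longlongrightarrow> 0) at_top"
    by (rule smalloD_tendsto)
  then have "(abs_sum (1 / 2) m m' \<longlongrightarrow> 0) at_top" by simp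
  then show ?thesis
    by (rule Lim_null_comparison[rotated]) (simp add: abs_bessel_sum_le always_eventually)
qed

lemma bessel_sum_half_recurrence:
  assumes "r > 0"
  shows "r * bessel_sum (1 / 2) m (m' + 2) r + r * bessel_sum (1 / 2) m m' r
    = 2 * bessel_sum 0 m (m' + 1) r + 2 * real (m' + 1) * bessel_sum (1 / 2) m (m' + 1) r"
proof -
  have "r * (- a + 2 / r * b + c / r * d) + r * a = 2 * b + c * d" for a b c d
    using assms by (simp add: field_simps)
  then show ?thesis
    unfolding bessel_sum_recurrence[OF assms, of "1 / 2" m m'] by simp
qed

text \<open>
  At \<open>s = 1/2\<close> the recurrence leads to the exponent 0, where the first case applies with a constant limit.
  So two sums whose second orders differ by 2 determine each other up to \<open>o(1/r)\<close>.
\<close>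

lemma bessel_sum_half_pair_tendsto:
  "((\<lambda>r. r * bessel_sum (1 / 2) m (m' + 2) r + r * bessel_sum (1 / 2) m m' r)
      \<longlongrightarrow> 2 * c1 0 (int m - int (m' + 1))) at_top"
proof -
  have "((\<lambda>r. 2 * bessel_sum 0 m (m' + 1) r + 2 * real (m' + 1) * bessel_sum (1 / 2) m (m' + 1) r)
      \<longlongrightarrow> 2 * c1 0 (int m - int (m' + 1)) + 2 * real (m' + 1) * 0) at_top"
    by (intro tendsto_intros bessel_sum_0_tendsto bessel_sum_half_tendsto_0)
  moreover have "\<forall>\<^sub>F r in at_top. 2 * bessel_sum 0 m (m' + 1) r + 2 * real (m' + 1) * bessel_sum (1 / 2) m (m' + 1) r
      = r * bessel_sum (1 / 2) m (m' + 2) r + r * bessel_sum (1 / 2) m m' r"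
    using eventually_gt_at_top[of 0] by eventually_elim (simp only: bessel_sum_half_recurrence)
  ultimately show ?thesis by (simp add: Lim_transform_eventually)
qed

lemma alternating_difference_sums:
  "(\<lambda>n. (-1) ^ Suc n * (1 / real (Suc n) - 1 / real (Suc (Suc n)))) sums (1 - 2 * ln 2)"
proof -
  have h: "(\<lambda>n. (-1) ^ n / real (Suc n)) sums ln 2"
    using alternating_harmonic_series_sums by simp
  then have "(\<lambda>n. (-1) ^ Suc n / real (Suc (Suc n))) sums (ln 2 - (-1) ^ 0 / real (Suc 0))"
    using sums_Suc_iff[of "\<lambda>n. (-1) ^ n / real (Suc n)"] by simp
  from sums_diff[OF sums_minus[OF h] this]
  have "(\<lambda>n. - ((-1) ^ n / real (Suc n)) - (-1) ^ Suc n / real (Suc (Suc n))) sums (1 - 2 * ln 2)" by simp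
  moreover have "- ((-1) ^ n / real (Suc n)) - (-1) ^ Suc n / real (Suc (Suc n))
      = (-1) ^ Suc n * (1 / real (Suc n) - 1 / real (Suc (Suc n)))" for n
    by (simp add: right_diff_distrib)
  ultimately show ?thesis by (simp only:)
qed

lemma bessel_sum_half_shift_eq:
  "bessel_sum (1 / 2) (Suc m) (Suc m') r - bessel_sum (1 / 2) m m' r
     = (\<Sum>n. (1 / real (Suc n) - 1 / real (Suc (Suc n))) * (J (Suc n + Suc m) r * J (Suc n + Suc m') r))
       - J (Suc m) r * J (Suc m') r"
proof -
  have p: "real k powr (- 2 * (1 / 2)) = 1 / real k" for k
    by (simp add: powr_minus_divide)
  show ?thesis
    using sums_unique[OF bessel_sum_shift_sums[of "1 / 2" m r m']] unfolding p by simp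
qed

text \<open>
  The difference of consecutive sums has the weights \<open>1/l - 1/(l+1)\<close>, so dominated convergence is again
  available. The cosine term vanishes for neighbouring orders, and the alternating series
  contributes \<open>1 - 2 ln 2\<close>, of which the boundary term removes the 1.
\<close>

lemma bessel_sum_half_shift_tendsto:
  "((\<lambda>r. r * (bessel_sum (1 / 2) (Suc m) (Suc (Suc m)) r - bessel_sum (1 / 2) m (Suc m) r)
      + 2 * ln 2 / pi * sin (2 * r - c7 (2 * m + 3))) \<longlongrightarrow> 0) at_top"
proof -
  let ?w = "\<lambda>n. 1 / real (Suc n) - 1 / real (Suc (Suc n))"
  let ?s = "\<lambda>r. sin (2 * r - c7 (2 * m + 3))"
  let ?d = "\<lambda>r. (r * (\<Sum>n. ?w n * (J (Suc n + Suc m) r * J (Suc n + Suc (Suc m)) r)) - (1 - 2 * ln 2) * ?s r / pi)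
      - (r * (J (Suc m) r * J (Suc (Suc m)) r) - ?s r / pi)"
  have w: "\<bar>?w n\<bar> \<le> weight 1 n" for n
  proof -
    have "?w n = 1 / (real (Suc n) * real (Suc (Suc n)))" by (simp add: field_simps)
    moreover have "1 / (real (Suc n) * real (Suc (Suc n))) \<le> 1 / (real (Suc n) * real (Suc n))"
      by (intro divide_left_mono mult_left_mono) auto
    moreover have "weight 1 n = 1 / (real (Suc n) * real (Suc n))"
      by (simp add: powr_minus_divide powr_numeral power2_eq_square del: of_nat_Suc)
    moreover have "0 \<le> 1 / (real (Suc n) * real (Suc (Suc n)))" by simp
    ultimately show ?thesis by linarith
  qed
  have c: "cos (pi * (real (Suc m) - real (Suc (Suc m))) / 2) = 0"
  proof -
    have "pi * (real (Suc m) - real (Suc (Suc m))) / 2 = - (pi / 2)" by simp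
    then show ?thesis by (simp only: cos_minus cos_pi_half)
  qed
  have i: "Suc m + Suc (Suc m) = 2 * m + 3" by simp
  have ph: "(\<Sum>n. ?w n * J_phase (Suc n + Suc m) (Suc n + Suc (Suc m)) r) = (1 - 2 * ln 2) * ?s r / pi" for r
  proof -
    have "(\<lambda>n. (-1) ^ Suc n * ?w n * (?s r / pi)) sums ((1 - 2 * ln 2) * (?s r / pi))"
      by (intro sums_mult2 alternating_difference_sums)
    moreover have "(\<lambda>n. (-1) ^ Suc n * ?w n * (?s r / pi)) = (\<lambda>n. ?w n * J_phase (Suc n + Suc m) (Suc n + Suc (Suc m)) r)"
      unfolding J_phase_consecutive c i by (simp only: add_0 mult_ac times_divide_eq_right)
    ultimately have "(\<lambda>n. ?w n * J_phase (Suc n + Suc m) (Suc n + Suc (Suc m)) r) sums ((1 - 2 * ln 2) * (?s r / pi))"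
      by (simp only:)
    from sums_unique[OF this] show ?thesis by (simp only: times_divide_eq_right)
  qed
  have ph0: "J_phase (Suc m) (Suc (Suc m)) r = ?s r / pi" for r
  proof -
    have "2 * r - pi * (real (Suc m) + real (Suc (Suc m))) / 2 = 2 * r - c7 (2 * m + 3)"
      by (simp add: c7_def)
    then show ?thesis unfolding J_phase_def c by (simp only: add_0)
  qed
  have "((\<lambda>r. ?d r) \<longlongrightarrow> 0 - 0) at_top"
    using bessel_weighted_sum_asymp[of 1 ?w "Suc m" "Suc (Suc m)", OF _ w] J_phase_limit[of "Suc m" "Suc (Suc m)"]
    unfolding ph J_phase_limit_def ph0 by (intro tendsto_diff) auto
  moreover have "?d r
     = r * (bessel_sum (1 / 2) (Suc m) (Suc (Suc m)) r - bessel_sum (1 / 2) m (Suc m) r) + 2 * ln 2 / pi * ?s r" for r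
    unfolding bessel_sum_half_shift_eq by (simp add: field_simps)
  ultimately show ?thesis by simp
qed

definition bessel_sum_half_odd :: "nat \<Rightarrow> nat \<Rightarrow> bool" where
  "bessel_sum_half_odd m m' \<longleftrightarrow>
     ((\<lambda>r. r * bessel_sum (1 / 2) m m' r - (c3 (int m - int m') - c4 * sin (2 * r - c7 (m + m')))) \<longlongrightarrow> 0) at_top"

lemma sin_c7_add_2: "sin (2 * r - c7 (k + 2)) = - sin (2 * r - c7 k)"
proof -
  have "2 * r - c7 (k + 2) = (2 * r - c7 k) - pi" by (simp add: c7_def field_simps)
  moreover have "sin (x - pi) = - sin x" for x :: real by (simp add: sin_diff)
  ultimately show ?thesis by (simp only:)
qed

text \<open>
  The sum and the difference of the values at \<open>m\<close> and \<open>m + 1\<close> have known limits. The sum, which tends to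
  \<open>2 * c1 0 0 = 1\<close>, yields the constant \<open>1/2\<close>. The difference yields the oscillating term.
\<close>

lemma bessel_sum_half_odd_consecutive: "bessel_sum_half_odd m (m + 1)"
proof -
  let ?Q = "\<lambda>r. r * bessel_sum (1 / 2) m (Suc m) r"
  let ?Q' = "\<lambda>r. r * bessel_sum (1 / 2) (Suc m) (Suc (Suc m)) r"
  let ?s = "\<lambda>r. sin (2 * r - c7 (2 * m + 1))"
  have sum: "((\<lambda>r. ?Q' r + ?Q r) \<longlongrightarrow> 1) at_top"
    using bessel_sum_half_pair_tendsto[of "Suc m" m] by (simp add: c1_0_0 bessel_sum_commute[of _ "Suc m" m])
  have diff: "((\<lambda>r. ?Q' r - ?Q r - 2 * ln 2 / pi * ?s r) \<longlongrightarrow> 0) at_top"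
    using bessel_sum_half_shift_tendsto[of m] sin_c7_add_2[of _ "2 * m + 1"]
    by (simp add: right_diff_distrib eval_nat_numeral)
  have c: "c3 (int m - int (m + 1)) = 1 / 2" and i: "m + (m + 1) = 2 * m + 1"
    by (simp_all add: c3_def)
  have alg: "((q' + q) - (q' - q - 2 * ln 2 / pi * z)) / 2 - 1 / 2 = q - (1 / 2 - c4 * z)" for q q' z :: real
    by (simp add: c4_def field_simps)
  show ?thesis
    unfolding bessel_sum_half_odd_def c i
  proof (rule tendsto_0_cong)
    show "((\<lambda>r. ((?Q' r + ?Q r) - (?Q' r - ?Q r - 2 * ln 2 / pi * ?s r)) / 2 - 1 / 2) \<longlongrightarrow> (1 - 0) / 2 - 1 / 2) at_top"
      by (rule tendsto_diff[OF tendsto_divide[OF tendsto_diff[OF sum diff] tendsto_const] tendsto_const]) simp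
    show "((?Q' r + ?Q r) - (?Q' r - ?Q r - 2 * ln 2 / pi * ?s r)) / 2 - 1 / 2
        = r * bessel_sum (1 / 2) m (m + 1) r - (1 / 2 - c4 * ?s r)" for r
      unfolding alg by simp
  qed simp
qed

lemma bessel_sum_half_odd_up: "bessel_sum_half_odd m (m + 2 * k + 1)"
proof (induction k)
  case 0
  show ?case using bessel_sum_half_odd_consecutive by simp
next
  case (Suc k)
  let ?m' = "m + 2 * k + 1"
  have z: "c1 0 (int m - int (?m' + 1)) = 0" by (rule c1_0_even) auto
  have c: "c3 (int m - int (?m' + 2)) = - c3 (int m - int ?m')"
  proof -
    have "\<bar>int m - int (?m' + 2)\<bar> = \<bar>int m - int ?m'\<bar> + 2" by simp
    then have "pi * of_int \<bar>int m - int (?m' + 2)\<bar> / 2 = pi * of_int \<bar>int m - int ?m'\<bar> / 2 + pi"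
      by (simp only: of_int_add) (simp add: field_simps)
    then show ?thesis unfolding c3_def by (simp only: sin_periodic_pi mult_minus_right)
  qed
  have "((\<lambda>r. (r * bessel_sum (1 / 2) m (?m' + 2) r + r * bessel_sum (1 / 2) m ?m' r)
      - (r * bessel_sum (1 / 2) m ?m' r - (c3 (int m - int ?m') - c4 * sin (2 * r - c7 (m + ?m'))))) \<longlongrightarrow> 2 * 0 - 0) at_top"
    using bessel_sum_half_pair_tendsto[of m ?m'] Suc unfolding z bessel_sum_half_odd_def by (intro tendsto_diff) auto
  moreover have "(r * bessel_sum (1 / 2) m (?m' + 2) r + r * bessel_sum (1 / 2) m ?m' r)
      - (r * bessel_sum (1 / 2) m ?m' r - (c3 (int m - int ?m') - c4 * sin (2 * r - c7 (m + ?m'))))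
      = r * bessel_sum (1 / 2) m (?m' + 2) r - (c3 (int m - int (?m' + 2)) - c4 * sin (2 * r - c7 (m + (?m' + 2))))" for r
  proof -
    have "m + (?m' + 2) = (m + ?m') + 2" by simp
    then show ?thesis unfolding c by (simp only: sin_c7_add_2)
  qed
  ultimately have "bessel_sum_half_odd m (?m' + 2)"
    unfolding bessel_sum_half_odd_def by (rule tendsto_0_cong) simp
  moreover have "?m' + 2 = m + 2 * Suc k + 1" by simp
  ultimately show ?case by (simp only:)
qed

lemma bessel_sum_half_odd_general:
  assumes "odd (int m - int m')"
  shows "bessel_sum_half_odd m m'"
proof -
  have up: "bessel_sum_half_odd a b" if "a \<le> b" "odd (int a - int b)" for a b
  proof -
    have "odd (b - a)" using that by (simp add: even_diff_nat of_nat_diff[symmetric])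
    then obtain k where "b - a = 2 * k + 1" by (elim oddE)
    then have "b = a + 2 * k + 1" using that by simp
    then show ?thesis using bessel_sum_half_odd_up by simp
  qed
  show ?thesis
  proof (cases "m \<le> m'")
    case False
    then have "bessel_sum_half_odd m' m" using assms by (intro up) auto
    then show ?thesis
      by (simp add: bessel_sum_half_odd_def bessel_sum_commute[of _ m'] c3_def abs_minus_commute add.commute)
  qed (use up assms in blast)
qed

section \<open>The critical exponent with even order difference\<close>

lemma harm_ln_bound:
  fixes r :: real
  assumes "r \<ge> 4"
  shows "\<bar>harm (nat \<lfloor>r / 4\<rfloor>) - ln r\<bar> \<le> 3"
proof -
  define N where "N = nat \<lfloor>r / 4\<rfloor>"
  have "1 \<le> \<lfloor>r / 4\<rfloor>" using assms by (simp add: le_floor_iff)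
  then have N: "N > 0" "r / 4 \<le> real N + 1" "real N \<le> r / 4"
    unfolding N_def by linarith+
  have "ln r - ln 4 = ln (r / 4)" using assms by (simp add: ln_div)
  also have "\<dots> \<le> ln (real N + 1)" using N assms by simp
  also have "\<dots> \<le> harm N" by (rule ln_le_harm)
  finally have "ln r - 3 \<le> harm N" using ln_le_minus_one[of "4 :: real"] by simp
  moreover have "harm N \<le> 1 + ln r"
  proof -
    obtain k where k: "N = Suc k" using N(1) gr0_conv_Suc by auto
    have "harm (Suc k) - ln (real (Suc k)) \<le> harm (Suc 0) - ln (real (Suc 0))"
      using decseq_harm_diff_ln by (rule decseqD) simp
    moreover have "ln (real N) \<le> ln r" using N assms by (subst ln_le_cancel_iff) auto
    ultimately show ?thesis by (simp add: k harm_expand)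
  qed
  ultimately show ?thesis by (simp add: N_def abs_le_iff)
qed

text \<open>
  The energy drifts by \<open>O(1 / r\<^sup>2)\<close> per step. This is small enough that a sum of the drift with
  weights \<open>1 / l\<close> over \<open>l \<le> r / 4\<close> remains \<open>O(1 / r)\<close>.
\<close>

lemma J_energy_drift:
  assumes "r \<ge> 1" "real l \<le> r / 2"
  shows "\<bar>J_energy l r - J_energy 0 r\<bar> \<le> real l * (216 / r\<^sup>2)"
  using assms(2)
proof (induction l)
  case (Suc l)
  have "\<bar>2 / r * (J l r * J (Suc l) r)\<bar> \<le> 2 / r * (108 / r)"
    unfolding abs_mult[of "2 / r"] using assms(1) Suc.prems by (intro mult_mono J_mult_bound) auto
  also have "\<dots> = 216 / r\<^sup>2" by (simp add: power2_eq_square)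
  finally have "\<bar>J_energy (Suc l) r - J_energy l r\<bar> \<le> 216 / r\<^sup>2"
    using assms(1) by (subst J_energy_Suc) auto
  moreover have "\<bar>J_energy l r - J_energy 0 r\<bar> \<le> real l * (216 / r\<^sup>2)"
    using Suc by simp
  moreover have "\<bar>c - a\<bar> \<le> (x + 1) * K" if "\<bar>c - b\<bar> \<le> K" "\<bar>b - a\<bar> \<le> x * K" for a b c x K :: real
    using that by (simp add: distrib_right abs_le_iff)
  ultimately have "\<bar>J_energy (Suc l) r - J_energy 0 r\<bar> \<le> (real l + 1) * (216 / r\<^sup>2)"
    by blast
  then show ?case by (simp only: of_nat_Suc add.commute)
qed simp

text \<open>
  On average over two consecutive orders, \<open>J\<^sup>2\<close> is half the energy, apart from the mixed
  term, whose factor \<open>l / r\<close> compensates the weight \<open>1 / l\<close>. With the energy frozen at \<open>l = 0\<close> only the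
  harmonic sum remains.
\<close>

lemma J_energy_sum_near:
  assumes r: "r \<ge> 4"
  defines "N \<equiv> nat \<lfloor>r / 4\<rfloor>"
  shows "\<bar>(\<Sum>n<N. ((J (Suc n) r)\<^sup>2 + (J (Suc (Suc n)) r)\<^sup>2) / real (Suc n))
            - J_energy 0 r * harm N\<bar> \<le> 108 / r"
proof -
  let ?f = "\<lambda>n. ((J (Suc n) r)\<^sup>2 + (J (Suc (Suc n)) r)\<^sup>2) / real (Suc n)"
  have N: "real N \<le> r / 4" unfolding N_def using r by linarith
  have term_le: "\<bar>?f n - J_energy 0 r * (1 / real (Suc n))\<bar> \<le> 432 / r\<^sup>2" if "n < N" for n
  proof -
    have n: "real (Suc n) \<le> r / 4" using that N by linarith
    let ?P = "J (Suc n) r * J (Suc (Suc n)) r"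
    have "(J (Suc n) r)\<^sup>2 + (J (Suc (Suc n)) r)\<^sup>2
        = J_energy (Suc n) r + 2 * (real (Suc n) / r) * ?P"
      by (simp add: J_energy_def)
    then have "?f n = J_energy (Suc n) r / real (Suc n) + 2 * (real (Suc n) / r) * ?P / real (Suc n)"
      by (simp only: add_divide_distrib)
    also have "2 * (real (Suc n) / r) * ?P / real (Suc n) = 2 / r * ?P"
      by (simp del: of_nat_Suc)
    finally have e: "?f n - J_energy 0 r * (1 / real (Suc n))
        = (J_energy (Suc n) r - J_energy 0 r) / real (Suc n) + 2 / r * (J (Suc n) r * J (Suc (Suc n)) r)"
      by (simp add: diff_divide_distrib)
    have "\<bar>J_energy (Suc n) r - J_energy 0 r\<bar> / real (Suc n) \<le> real (Suc n) * (216 / r\<^sup>2) / real (Suc n)"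
      using r n by (intro divide_right_mono J_energy_drift) auto
    then have 1: "\<bar>(J_energy (Suc n) r - J_energy 0 r) / real (Suc n)\<bar> \<le> 216 / r\<^sup>2" by (simp del: of_nat_Suc)
    have "\<bar>2 / r * (J (Suc n) r * J (Suc (Suc n)) r)\<bar> \<le> 2 / r * (108 / r)"
      unfolding abs_mult[of "2 / r"] using r n by (intro mult_mono J_mult_bound) auto
    also have "\<dots> = 216 / r\<^sup>2" by (simp add: power2_eq_square)
    finally have 2: "\<bar>2 / r * (J (Suc n) r * J (Suc (Suc n)) r)\<bar> \<le> 216 / r\<^sup>2" .
    have "\<bar>?f n - J_energy 0 r * (1 / real (Suc n))\<bar> \<le> 216 / r\<^sup>2 + 216 / r\<^sup>2"
      unfolding e by (rule order_trans[OF abs_triangle_ineq add_mono[OF 1 2]])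
    then show ?thesis by simp
  qed
  have "(\<Sum>n<N. ?f n) - J_energy 0 r * harm N = (\<Sum>n<N. ?f n - J_energy 0 r * (1 / real (Suc n)))"
    by (simp add: sum_subtractf harm_altdef sum_distrib_left inverse_eq_divide)
  also have "\<bar>\<dots>\<bar> \<le> (\<Sum>n<N. 432 / r\<^sup>2)"
    by (rule order_trans[OF sum_abs]) (intro sum_mono term_le, simp)
  also have "\<dots> = real N * (432 / r\<^sup>2)" by simp
  also have "\<dots> \<le> r / 4 * (432 / r\<^sup>2)" using N by (intro mult_right_mono) auto
  also have "\<dots> = 108 / r" using r by (simp add: power2_eq_square)
  finally show ?thesis .
qed

text \<open>
  The energy at 0 is \<open>2 / (\<pi> r)\<close> with a relative error \<open>O(r powr (- 1/2))\<close>, which outweighs the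
  logarithmic growth of the harmonic sum.
\<close>

lemma J_energy_0_harm:
  assumes r: "r \<ge> 4"
  shows "\<bar>J_energy 0 r * harm (nat \<lfloor>r / 4\<rfloor>) - 2 / pi * (ln r / r)\<bar> \<le> 88 / r"
proof -
  let ?H = "harm (nat \<lfloor>r / 4\<rfloor>) :: real" and ?E = "J_energy 0 r"
  have H: "\<bar>?H - ln r\<bar> \<le> 3" by (rule harm_ln_bound[OF r])
  have "ln (sqrt r) \<le> sqrt r - 1" using r by (intro ln_le_minus_one) simp
  then have "ln r \<le> 2 * sqrt r" using r by (simp add: ln_sqrt)
  moreover have "1 \<le> sqrt r" using r by simp
  ultimately have H5: "?H \<le> 5 * sqrt r" using H by linarith
  have "\<bar>r * ?E - 2 / pi\<bar> \<le> 17 / sqrt r"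
    using J_01_asymp(3)[of r] r by (simp add: J_energy_def)
  then have "\<bar>r * ?E - 2 / pi\<bar> * ?H \<le> 17 / sqrt r * (5 * sqrt r)"
    using H5 r by (intro mult_mono harm_nonneg) auto
  also have "\<dots> = 85" using r by simp
  finally have 1: "\<bar>(r * ?E - 2 / pi) * ?H\<bar> \<le> 85" by (simp add: abs_mult harm_nonneg)
  have "\<bar>2 / pi\<bar> * \<bar>?H - ln r\<bar> \<le> 1 * 3"
    using H pi_ge_two by (intro mult_mono) auto
  then have 2: "\<bar>2 / pi * (?H - ln r)\<bar> \<le> 3" by (simp only: abs_mult mult_1_left)
  have "r * (?E * ?H - 2 / pi * (ln r / r)) = (r * ?E - 2 / pi) * ?H + 2 / pi * (?H - ln r)"
    using r by (simp add: field_simps)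
  then have "\<bar>r * (?E * ?H - 2 / pi * (ln r / r))\<bar> \<le> 85 + 3"
    using order_trans[OF abs_triangle_ineq add_mono[OF 1 2]] by simp
  moreover have "\<bar>x\<bar> \<le> 88 / r" if "\<bar>r * x\<bar> \<le> 85 + 3" for x
    using that r by (simp add: abs_mult field_simps)
  ultimately show ?thesis by blast
qed

text \<open>
  The range \<open>l > r / 4\<close> contributes only \<open>O(1 / r)\<close>, as the weights are at most \<open>4 / r\<close> there and the total
  mass is bounded.
\<close>

lemma bessel_sum_half_pair_bigo:
  "(\<lambda>r. bessel_sum (1 / 2) 0 0 r + bessel_sum (1 / 2) 1 1 r - 2 / pi * (ln r / r)) \<in> O[at_top](\<lambda>r. 1 / r)"
proof (rule bigoI)
  let ?S = "\<lambda>r. bessel_sum (1 / 2) 0 0 r + bessel_sum (1 / 2) 1 1 r"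
  \<comment> \<open>\<open>204 = 108 + 88 + 8\<close>: the drift of the energy, the harmonic sum, and the tail.\<close>
  show "\<forall>\<^sub>F r in at_top. norm (?S r - 2 / pi * (ln r / r)) \<le> 204 * norm (1 / r)"
    using J_mass_le_1[of 0] eventually_ge_at_top[of 4]
  proof eventually_elim
    case (elim r)
    let ?q = "\<lambda>n. (J (Suc n) r)\<^sup>2 + (J (Suc (Suc n)) r)\<^sup>2"
    define f where "f n = ?q n / real (Suc n)" for n
    define N where "N = nat \<lfloor>r / 4\<rfloor>"
    have p: "weight (1 / 2) n = 1 / real (Suc n)" for n
      by (simp add: powr_minus_divide)
    have "(\<lambda>l. 1 / real (Suc l) * (J (Suc l + 0) r)\<^sup>2 + 1 / real (Suc l) * (J (Suc l + 1) r)\<^sup>2)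
        sums (?S r)"
      using sums_add[OF bessel_sum_diag_sums[of "1 / 2" 0 r] bessel_sum_diag_sums[of "1 / 2" 1 r]] unfolding p .
    moreover have "1 / real (Suc l) * (J (Suc l + 0) r)\<^sup>2 + 1 / real (Suc l) * (J (Suc l + 1) r)\<^sup>2 = f l" for l
      by (simp add: f_def add_divide_distrib)
    ultimately have f: "f sums (?S r)" by (simp only:)
    have m1: "(\<lambda>n. (J (Suc n) r)\<^sup>2) sums J_mass 0 r"
      using summable_sums[OF J_mass_summable[of r 0]] by (simp add: J_mass_def)
    then have m2: "(\<lambda>n. (J (Suc (Suc n)) r)\<^sup>2) sums (J_mass 0 r - (J (Suc 0) r)\<^sup>2)"
      using sums_Suc_iff[of "\<lambda>n. (J (Suc n) r)\<^sup>2"] by simp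
    have q: "(\<lambda>n. 4 / r * ?q n) sums (4 / r * (J_mass 0 r + (J_mass 0 r - (J (Suc 0) r)\<^sup>2)))"
      by (intro sums_mult sums_add m1 m2)
    have q0: "0 \<le> 4 / r * ?q n" for n using elim by (intro mult_nonneg_nonneg) auto
    have "(\<Sum>n. f (n + N)) \<le> (\<Sum>n. 4 / r * ?q (n + N))"
    proof (rule suminf_le)
      fix n
      have "r / 4 \<le> real (Suc (n + N))" unfolding N_def using elim by linarith
      then have "1 / real (Suc (n + N)) \<le> 1 / (r / 4)" using elim by (intro divide_left_mono) auto
      then have "?q (n + N) * (1 / real (Suc (n + N))) \<le> ?q (n + N) * (1 / (r / 4))" by (intro mult_left_mono) auto
      then show "f (n + N) \<le> 4 / r * ?q (n + N)" unfolding f_def by (simp add: mult.commute)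
    qed (use summable_ignore_initial_segment[OF sums_summable[OF f]]
           summable_ignore_initial_segment[OF sums_summable[OF q]] in auto)
    also have "\<dots> \<le> (\<Sum>n. 4 / r * ?q n)"
      using suminf_split_initial_segment[OF sums_summable[OF q], of N] sum_nonneg[of "{..<N}" "\<lambda>n. 4 / r * ?q n"] q0
      by simp
    also have "\<dots> = 4 / r * (J_mass 0 r + (J_mass 0 r - (J (Suc 0) r)\<^sup>2))"
      by (rule sums_unique[OF q, symmetric])
    also have "\<dots> \<le> 4 / r * 2"
    proof (rule mult_left_mono)
      show "J_mass 0 r + (J_mass 0 r - (J (Suc 0) r)\<^sup>2) \<le> 2"
        using elim(1) zero_le_power2[of "J (Suc 0) r"] by linarith
    qed (use elim in simp)
    finally have tail: "(\<Sum>n. f (n + N)) \<le> 8 / r" by simp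
    have tail0: "0 \<le> (\<Sum>n. f (n + N))"
      by (intro suminf_nonneg summable_ignore_initial_segment[OF sums_summable[OF f]]) (simp add: f_def)
    have "?S r = (\<Sum>n. f (n + N)) + (\<Sum>n<N. f n)"
      using suminf_split_initial_segment[OF sums_summable[OF f], of N] sums_unique[OF f] by simp
    moreover have "\<bar>(\<Sum>n<N. f n) - J_energy 0 r * harm N\<bar> \<le> 108 / r"
      unfolding f_def N_def by (rule J_energy_sum_near[OF elim(2)])
    moreover have "\<bar>J_energy 0 r * harm N - 2 / pi * (ln r / r)\<bar> \<le> 88 / r"
      unfolding N_def by (rule J_energy_0_harm[OF elim(2)])
    moreover have "108 / r + 88 / r + 8 / r = 204 / r" by (simp add: add_divide_distrib[symmetric])
    moreover have "\<bar>x - g\<bar> \<le> a + b + c"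
      if "x = t + y" "\<bar>y - e\<bar> \<le> a" "\<bar>e - g\<bar> \<le> b" "t \<le> c" "0 \<le> t" for x g a b c t y e :: real
      using that by (simp add: abs_le_iff)
    ultimately have "\<bar>?S r - 2 / pi * (ln r / r)\<bar> \<le> 204 / r"
      using tail tail0 by metis
    then show ?case using elim by simp
  qed
qed

definition bessel_sum_half_log :: "nat \<Rightarrow> nat \<Rightarrow> real \<Rightarrow> bool" where
  "bessel_sum_half_log m m' c \<longleftrightarrow>
     (\<lambda>r. bessel_sum (1 / 2) m m' r - c * (ln r / r)) \<in> O[at_top](\<lambda>r. 1 / r)"

text \<open>
  The shift changes the sum by \<open>O(1 / r)\<close>, so each of the two sums of the pair carries one half of
  the logarithm.
\<close>

lemma bessel_sum_half_log_diag: "bessel_sum_half_log m m (1 / pi)"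
proof (induction m)
  case 0
  have "(\<lambda>r. (bessel_sum (1 / 2) 0 0 r + bessel_sum (1 / 2) 1 1 r - 2 / pi * (ln r / r))
      - (bessel_sum (1 / 2) (Suc 0) (Suc 0) r - bessel_sum (1 / 2) 0 0 r)) \<in> O[at_top](\<lambda>r. 1 / r)"
    by (intro sum_in_bigo bessel_sum_half_pair_bigo bessel_sum_shift_half)
  also have "(\<lambda>r. (bessel_sum (1 / 2) 0 0 r + bessel_sum (1 / 2) 1 1 r - 2 / pi * (ln r / r))
      - (bessel_sum (1 / 2) (Suc 0) (Suc 0) r - bessel_sum (1 / 2) 0 0 r))
      = (\<lambda>r. 2 * (bessel_sum (1 / 2) 0 0 r - 1 / pi * (ln r / r)))"
    by (rule ext) simp
  finally show ?case
    unfolding bessel_sum_half_log_def by (subst (asm) landau_o.big.cmult_in_iff) simp_all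
next
  case (Suc m)
  have "(\<lambda>r. (bessel_sum (1 / 2) (Suc m) (Suc m) r - bessel_sum (1 / 2) m m r)
      + (bessel_sum (1 / 2) m m r - 1 / pi * (ln r / r))) \<in> O[at_top](\<lambda>r. 1 / r)"
    by (rule sum_in_bigo(1)[OF bessel_sum_shift_half Suc[unfolded bessel_sum_half_log_def]])
  then show ?case unfolding bessel_sum_half_log_def by simp
qed

lemma bessel_sum_half_log_step:
  assumes "bessel_sum_half_log m m' c"
  shows "bessel_sum_half_log m (m' + 2) (- c)"
proof -
  let ?d = "\<lambda>r. r * bessel_sum (1 / 2) m (m' + 2) r + r * bessel_sum (1 / 2) m m' r"
  have "(\<lambda>r. ?d r) \<in> O[at_top](\<lambda>_. 1)"
    using bessel_sum_half_pair_tendsto[of m m'] by (intro bigoI_tendsto) auto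
  from landau_o.big.mult[OF landau_o.big_refl[of "\<lambda>r. 1 / r" at_top] this]
  have "(\<lambda>r. 1 / r * (?d r)) \<in> O[at_top](\<lambda>r. 1 / r)"
    by simp
  from sum_in_bigo(2)[OF this assms[unfolded bessel_sum_half_log_def]]
  have "(\<lambda>r. 1 / r * (?d r)
      - (bessel_sum (1 / 2) m m' r - c * (ln r / r))) \<in> O[at_top](\<lambda>r. 1 / r)" .
  also have "?this \<longleftrightarrow> bessel_sum_half_log m (m' + 2) (- c)"
    unfolding bessel_sum_half_log_def
  proof (rule landau_o.big.in_cong)
    show "\<forall>\<^sub>F r in at_top. 1 / r * (?d r)
      - (bessel_sum (1 / 2) m m' r - c * (ln r / r)) = bessel_sum (1 / 2) m (m' + 2) r - - c * (ln r / r)"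
      using eventually_gt_at_top[of 0] by eventually_elim (simp add: distrib_left)
  qed
  finally show ?thesis .
qed

lemma bessel_sum_half_log_up: "bessel_sum_half_log m (m + 2 * k) (c2 (int m - int (m + 2 * k)))"
proof (induction k)
  case 0
  show ?case using bessel_sum_half_log_diag by (simp add: c2_def)
next
  case (Suc k)
  have "pi * of_int (int m - int (m + 2 * k + 2)) / 2 = pi * of_int (int m - int (m + 2 * k)) / 2 - pi"
    by (simp add: field_simps)
  then have "c2 (int m - int (m + 2 * k + 2)) = - c2 (int m - int (m + 2 * k))"
    unfolding c2_def by (simp only: cos_diff) simp
  moreover have "m + 2 * k + 2 = m + 2 * Suc k" by simp
  ultimately show ?case using bessel_sum_half_log_step[OF Suc] by (simp only:)
qed

lemma bessel_sum_half_log_general: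
  assumes "even (int m - int m')"
  shows "bessel_sum_half_log m m' (c2 (int m - int m'))"
proof -
  have up: "bessel_sum_half_log a b (c2 (int a - int b))" if "a \<le> b" "even (int a - int b)" for a b
  proof -
    have "even (b - a)" using that by (simp add: even_diff_nat of_nat_diff[symmetric])
    then obtain k where "b - a = 2 * k" by (elim evenE)
    then have "b = a + 2 * k" using that by simp
    then show ?thesis using bessel_sum_half_log_up by simp
  qed
  show ?thesis
  proof (cases "m \<le> m'")
    case False
    then have "bessel_sum_half_log m' m (c2 (int m' - int m))" using assms by (intro up) auto
    moreover have "c2 (int m' - int m) = c2 (int m - int m')"
    proof -
      have "pi * of_int (int m' - int m) / 2 = - (pi * of_int (int m - int m') / 2)" by (simp add: field_simps)
      then show ?thesis unfolding c2_def by (simp only: cos_minus)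
    qed
    ultimately show ?thesis by (simp only: bessel_sum_half_log_def bessel_sum_commute[of _ m'])
  qed (use up assms in blast)
qed

section \<open>The asymptotics of the weighted sum\<close>

theorem lemma1p2:
  fixes m m' \<mu> :: nat and \<nu> :: int and s :: real
  assumes "\<mu> = m + m'" and "\<nu> = int m - int m'"
  shows "(s < 1/2 \<longrightarrow>
            (\<lambda>r. bessel_sum s m m' r - c1 s \<nu> * r powr (- 2 * s))
              \<in> o[at_top](\<lambda>r. r powr (- 2 * s))) \<and>
         (s = 1/2 \<and> even \<nu> \<longrightarrow>
            (\<lambda>r. bessel_sum s m m' r - c2 \<nu> * (ln r / r)) \<in> O[at_top](\<lambda>r. 1 / r)) \<and>
         (s = 1/2 \<and> odd \<nu> \<longrightarrow>
            (\<lambda>r. bessel_sum s m m' r - (c3 \<nu> - c4 * sin (2 * r - c7 \<mu>)) / r)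
              \<in> o[at_top](\<lambda>r. 1 / r)) \<and>
         (s > 1/2 \<longrightarrow>
            (\<lambda>r. bessel_sum s m m' r - (c5 s \<nu> - c6 s * sin (2 * r - c7 \<mu>)) / r)
              \<in> o[at_top](\<lambda>r. 1 / r))"
proof (intro conjI impI)
  assume "s < 1 / 2"
  then show "(\<lambda>r. bessel_sum s m m' r - c1 s \<nu> * r powr (- 2 * s)) \<in> o[at_top](\<lambda>r. r powr (- 2 * s))"
    using bessel_sum_leading_general unfolding bessel_sum_leading_def assms by blast
next
  assume "s = 1 / 2 \<and> even \<nu>"
  then show "(\<lambda>r. bessel_sum s m m' r - c2 \<nu> * (ln r / r)) \<in> O[at_top](\<lambda>r. 1 / r)"
    using bessel_sum_half_log_general unfolding bessel_sum_half_log_def assms by blast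
next
  assume "s = 1 / 2 \<and> odd \<nu>"
  then have "((\<lambda>r. r * bessel_sum s m m' r - (c3 \<nu> - c4 * sin (2 * r - c7 \<mu>))) \<longlongrightarrow> 0) at_top"
    using bessel_sum_half_odd_general unfolding bessel_sum_half_odd_def assms by blast
  moreover have "\<forall>\<^sub>F r in at_top. r * bessel_sum s m m' r - (c3 \<nu> - c4 * sin (2 * r - c7 \<mu>))
      = r * (bessel_sum s m m' r - (c3 \<nu> - c4 * sin (2 * r - c7 \<mu>)) / r)"
    using eventually_gt_at_top[of 0] by eventually_elim (simp only: mult_diff_divide_cancel)
  ultimately show "(\<lambda>r. bessel_sum s m m' r - (c3 \<nu> - c4 * sin (2 * r - c7 \<mu>)) / r) \<in> o[at_top](\<lambda>r. 1 / r)"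
    unfolding smallo_inverse_iff by (rule Lim_transform_eventually)
next
  assume "s > 1 / 2"
  then show "(\<lambda>r. bessel_sum s m m' r - (c5 s \<nu> - c6 s * sin (2 * r - c7 \<mu>)) / r) \<in> o[at_top](\<lambda>r. 1 / r)"
    using bessel_sum_asymp_gt_half unfolding assms by blast
qed

end
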